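(* Let $\{V_j\}_{j\in\mathbb{Z}}$ be a multiresolution analysis in $L^2(\mathbb{Q}_2)$ and let $\psi\in L^2(\mathbb{Q}_2)$ be a wavelet function for it. If $\psi$ is compactly supported, then the wavelet system $\{2^{j/2}\psi(2^{-j}\cdot-a):a\in I_2,\ j\in\mathbb{Z}\}$ is a frame in $L^2(\mathbb{Q}_2)$.
   Context: $\mathbb{Q}_2$ is the field of $2$-adic numbers with norm $|\cdot|_2$ (so $|2|_2=1/2$) and Haar measure normalized so that $\{|x|_2\le1\}$ has measure $1$. The set of shifts is $I_2=\{2^{-\gamma}(a_0+2a_1+\cdots+2^{\gamma-1}a_{\gamma-1}):\gamma\in\mathbb{N},\ a_j\in\{0,1\}\}$. A multiresolution analysis (MRA) in $L^2(\mathbb{Q}_2)$ is a collection of closed subspaces $V_j\subset L^2(\mathbb{Q}_2)$, $j\in\mathbb{Z}$, such that: (a) $V_j\subset V_{j+1}$ for all $j$; (b) $\bigcup_{j}V_j$ is dense in $L^2(\mathbb{Q}_2)$; (c) $\bigcap_j V_j=\{0\}$; (d) $f(\cdot)\in V_j\Longleftrightarrow f(2^{-1}\cdot)\in V_{j+1}$ for all $j$; (e) there is a function $\phi\in V_0$ with $V_0=\overline{\operatorname{span}\{\phi(\cdot-a):a\in I_2\}}$. The wavelet space $W_j$ is the orthogonal complement of $V_j$ in $V_{j+1}$. A function $\psi\in L^2(\mathbb{Q}_2)$ is a wavelet function for the MRA if $W_0=\overline{\operatorname{span}\{\psi(\cdot-a):a\in I_2\}}$. A countable system $\{f_n\}$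 in a Hilbert space $H$ is a frame if there exist constants $A,B>0$ such that $A\|f\|^2\le\sum_n|\langle f,f_n\rangle|^2\le B\|f\|^2$ for all $f\in H$. *)

theory Defs
  imports "HOL-Analysis.Analysis" "HOL-Computational_Algebra.Primes"
begin

section \<open>The 2-adic absolute value on the rationals\<close>

text \<open>For \<open>x = a / b\<close> this is 2 to the power of minus the 2-adic valuation of \<open>x\<close>, see \<open>abs2_frac\<close>.\<close>

definition abs2 :: "rat \<Rightarrow> real" where
  "abs2 x = (if x = 0 then 0 else
     2 powi (int (multiplicity 2 (snd (quotient_of x))) - int (multiplicity 2 (fst (quotient_of x)))))"

lemma abs2_0 [simp]: "abs2 0 = 0"
  by (simp add: abs2_def)

lemma abs2_frac:
  fixes a b :: int
  assumes "a \<noteq> 0" "b \<noteq> 0"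
  shows "abs2 (of_int a / of_int b) = 2 powi (int (multiplicity 2 b) - int (multiplicity 2 a))"
proof -
  obtain p q where pq: "quotient_of (of_int a / of_int b) = (p, q)" by fastforce
  have q: "q > 0" using pq by (rule quotient_of_denom_pos)
  have eq: "(of_int a / of_int b :: rat) = of_int p / of_int q"
    using pq by (rule quotient_of_div)
  have p: "p \<noteq> 0" using eq assms q by auto
  have "(of_int (a * q) :: rat) = of_int (p * b)"
    using eq assms q by (simp add: field_simps)
  hence "a * q = p * b" by (simp only: of_int_eq_iff)
  hence "multiplicity 2 (a * q) = multiplicity 2 (p * b)" by simp
  hence "multiplicity 2 a + multiplicity 2 q = multiplicity 2 p + multiplicity 2 b"
    using assms p q by (simp add: prime_elem_multiplicity_mult_distrib)
  hence e: "int (multiplicity 2 q) - int (multiplicity 2 p) = int (multiplicity 2 b) - int (multiplicity 2 a)"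
    by linarith
  have "(of_int a / of_int b :: rat) \<noteq> 0" using assms by simp
  thus ?thesis using pq e by (simp add: abs2_def)
qed

lemma rat_frac_cases:
  fixes x :: rat
  obtains a b :: int where "b \<noteq> 0" "x = of_int a / of_int b"
proof -
  obtain p q where pq: "quotient_of x = (p, q)" by fastforce
  show ?thesis using that quotient_of_div[OF pq] quotient_of_denom_pos[OF pq] by (metis less_irrefl)
qed

lemma abs2_nonneg [simp]: "abs2 x \<ge> 0"
  by (simp add: abs2_def)

lemma abs2_eq_0_iff [simp]: "abs2 x = 0 \<longleftrightarrow> x = 0"
  by (simp add: abs2_def)

lemma abs2_pos_iff [simp]: "abs2 x > 0 \<longleftrightarrow> x \<noteq> 0"
  by (simp add: abs2_def)

lemma abs2_of_int: "a \<noteq> 0 \<Longrightarrow> abs2 (of_int a) = 2 powi (- int (multiplicity 2 a))"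
  using abs2_frac[of a 1] by simp

lemma abs2_1 [simp]: "abs2 1 = 1"
  using abs2_of_int[of 1] by simp

lemma abs2_mult: "abs2 (x * y) = abs2 x * abs2 y"
proof (cases "x = 0 \<or> y = 0")
  case False
  obtain a b where x: "b \<noteq> 0" "x = of_int a / of_int b" by (rule rat_frac_cases)
  obtain c d where y: "d \<noteq> 0" "y = of_int c / of_int d" by (rule rat_frac_cases)
  have nz: "a \<noteq> 0" "c \<noteq> 0" using False x y by auto
  have "x * y = of_int (a * c) / of_int (b * d)" using x y by simp
  hence "abs2 (x * y) = 2 powi (int (multiplicity 2 (b * d)) - int (multiplicity 2 (a * c)))"
    using abs2_frac[of "a * c" "b * d"] nz x y by simp
  also have "\<dots> = 2 powi ((int (multiplicity 2 b) - int (multiplicity 2 a))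
      + (int (multiplicity 2 d) - int (multiplicity 2 c)))"
    using nz x y by (simp add: prime_elem_multiplicity_mult_distrib algebra_simps)
  also have "\<dots> = abs2 x * abs2 y"
    using nz x y by (simp add: abs2_frac power_int_add)
  finally show ?thesis .
qed auto

lemma abs2_minus [simp]: "abs2 (- x) = abs2 x"
proof -
  have "abs2 (-1) * abs2 (-1) = 1" using abs2_mult[of "-1" "-1"] by simp
  hence "abs2 (-1) = 1"
    using abs2_nonneg[of "-1"] square_eq_1_iff[of "abs2 (-1)"] by linarith
  thus ?thesis using abs2_mult[of "-1" x] by simp
qed

lemma abs2_add: "abs2 (x + y) \<le> max (abs2 x) (abs2 y)"
proof (cases "x = 0 \<or> y = 0 \<or> x + y = 0")
  case False
  obtain a b where x: "b \<noteq> 0" "x = of_int a / of_int b" by (rule rat_frac_cases)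
  obtain c d where y: "d \<noteq> 0" "y = of_int c / of_int d" by (rule rat_frac_cases)
  define u v w where "u = a * d" and "v = c * b" and "w = b * d"
  have w: "w \<noteq> 0" using x y by (simp add: w_def)
  have xu: "x = of_int u / of_int w" and yv: "y = of_int v / of_int w"
    using x y by (simp_all add: u_def v_def w_def)
  have uv: "u \<noteq> 0" "v \<noteq> 0" using False xu yv by auto
  have s: "x + y = of_int (u + v) / of_int w" using xu yv by (simp add: add_divide_distrib)
  have nz: "u + v \<noteq> 0" using s False by (metis div_0 of_int_0)
  define m where "m = min (multiplicity 2 u) (multiplicity 2 v)"
  have "2 ^ m dvd u" "2 ^ m dvd v" by (auto intro!: multiplicity_dvd' simp: m_def)
  hence "2 ^ m dvd u + v" by (rule dvd_add)
  hence "m \<le> multiplicity 2 (u + v)" using nz by (intro multiplicity_geI) auto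
  hence "abs2 (x + y) \<le> 2 powi (int (multiplicity 2 w) - int m)"
    unfolding s using abs2_frac[OF nz w] by (simp add: power_int_increasing)
  also have "\<dots> \<le> max (abs2 x) (abs2 y)"
    unfolding xu yv abs2_frac[OF uv(1) w] abs2_frac[OF uv(2) w] m_def by (simp add: min_def)
  finally show ?thesis .
qed (auto simp: le_max_iff_disj)

lemma abs2_diff: "abs2 (x - y) \<le> max (abs2 x) (abs2 y)"
  using abs2_add[of x "- y"] by simp

lemma abs2_diff_commute: "abs2 (x - y) = abs2 (y - x)"
  using abs2_minus[of "x - y"] by simp

lemma abs2_triangle: "abs2 (x + y) \<le> abs2 x + abs2 y"
  using abs2_add[of x y] abs2_nonneg[of x] abs2_nonneg[of y] by linarith

lemma abs2_diff_triangle: "\<bar>abs2 x - abs2 y\<bar> \<le> abs2 (x - y)"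
  using abs2_triangle[of "x - y" y] abs2_triangle[of "y - x" x] abs2_diff_commute[of x y] by simp

lemma abs2_inverse: "abs2 (inverse x) = inverse (abs2 x)"
  using abs2_mult[of x "inverse x"] by (cases "x = 0") (auto simp: field_simps)

lemma abs2_2: "abs2 2 = 1/2"
  using abs2_of_int[of 2] by (simp add: power_int_minus)


section \<open>Cauchy sequences and the completion\<close>

definition cauchy2 :: "(nat \<Rightarrow> rat) \<Rightarrow> bool" where
  "cauchy2 X \<longleftrightarrow> (\<forall>e>0. \<exists>N. \<forall>m\<ge>N. \<forall>n\<ge>N. abs2 (X m - X n) < e)"

definition null2 :: "(nat \<Rightarrow> rat) \<Rightarrow> bool" where
  "null2 X \<longleftrightarrow> (\<lambda>n. abs2 (X n)) \<longlonglongrightarrow> 0"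

lemma cauchy2D: "cauchy2 X \<Longrightarrow> e > 0 \<Longrightarrow> \<exists>N. \<forall>m\<ge>N. \<forall>n\<ge>N. abs2 (X m - X n) < e"
  by (simp add: cauchy2_def)

lemma null2D: "null2 X \<Longrightarrow> e > 0 \<Longrightarrow> \<exists>N. \<forall>n\<ge>N. abs2 (X n) < e"
  by (simp add: null2_def LIMSEQ_iff)

lemma null2I: "(\<And>e. e > 0 \<Longrightarrow> \<exists>N. \<forall>n\<ge>N. abs2 (X n) < e) \<Longrightarrow> null2 X"
  by (simp add: null2_def LIMSEQ_iff)

lemma cauchy2_const [simp]: "cauchy2 (\<lambda>n. c)"
  by (simp add: cauchy2_def)

lemma null2_0 [simp]: "null2 (\<lambda>n. 0)"
  by (simp add: null2_def)

lemma null2_const [simp]: "null2 (\<lambda>n. c) \<longleftrightarrow> c = 0"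
  by (simp add: null2_def LIMSEQ_const_iff)

lemma null2_minus: "null2 X \<Longrightarrow> null2 (\<lambda>n. - X n)"
  by (simp add: null2_def)

lemma null2_add:
  assumes "null2 X" "null2 Y" shows "null2 (\<lambda>n. X n + Y n)"
  unfolding null2_def
proof (rule Lim_null_comparison)
  show "(\<lambda>n. abs2 (X n) + abs2 (Y n)) \<longlonglongrightarrow> 0"
    using tendsto_add[OF assms[unfolded null2_def]] by simp
qed (simp add: abs2_triangle)

lemma null2_diff: "null2 X \<Longrightarrow> null2 Y \<Longrightarrow> null2 (\<lambda>n. X n - Y n)"
  using null2_add[of X "\<lambda>n. - Y n"] null2_minus[of Y] by simp

lemma cauchy2_abs2_convergent:
  assumes "cauchy2 X" shows "convergent (\<lambda>n. abs2 (X n))"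
proof (rule real_Cauchy_convergent, rule metric_CauchyI)
  fix e :: real assume "e > 0"
  then obtain N where "\<forall>m\<ge>N. \<forall>n\<ge>N. abs2 (X m - X n) < e"
    using cauchy2D[OF assms] by blast
  thus "\<exists>N. \<forall>m\<ge>N. \<forall>n\<ge>N. dist (abs2 (X m)) (abs2 (X n)) < e"
    unfolding dist_real_def using abs2_diff_triangle by (meson le_less_trans)
qed

lemma cauchy2_bounded:
  assumes "cauchy2 X" shows "\<exists>B>0. \<forall>n. abs2 (X n) \<le> B"
proof -
  have "Bseq (\<lambda>n. abs2 (X n))"
    using cauchy2_abs2_convergent[OF assms] by (rule convergent_imp_Bseq)
  thus ?thesis by (auto simp: Bseq_def)
qed

lemma null2_mult_bounded:
  assumes "cauchy2 X" "null2 Y" shows "null2 (\<lambda>n. X n * Y n)"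
proof -
  obtain B where B: "B > 0" "\<forall>n. abs2 (X n) \<le> B" using cauchy2_bounded[OF assms(1)] by blast
  show ?thesis unfolding null2_def
  proof (rule Lim_null_comparison)
    show "(\<lambda>n. B * abs2 (Y n)) \<longlonglongrightarrow> 0"
      using tendsto_mult_left[OF assms(2)[unfolded null2_def], of B] by simp
    show "\<forall>\<^sub>F n in sequentially. norm (abs2 (X n * Y n)) \<le> B * abs2 (Y n)"
      using B by (simp add: abs2_mult mult_right_mono)
  qed
qed

lemma cauchy2_minus: "cauchy2 X \<Longrightarrow> cauchy2 (\<lambda>n. - X n)"
  unfolding cauchy2_def by (simp add: minus_diff_minus del: minus_diff_eq) (simp add: abs2_diff_commute)

lemma cauchy2_add:
  assumes "cauchy2 X" "cauchy2 Y" shows "cauchy2 (\<lambda>n. X n + Y n)"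
  unfolding cauchy2_def
proof (intro allI impI)
  fix e :: real assume e: "e > 0"
  obtain M where M: "\<forall>m\<ge>M. \<forall>n\<ge>M. abs2 (X m - X n) < e" using cauchy2D[OF assms(1) e] by blast
  obtain N where N: "\<forall>m\<ge>N. \<forall>n\<ge>N. abs2 (Y m - Y n) < e" using cauchy2D[OF assms(2) e] by blast
  have "abs2 (X m + Y m - (X n + Y n)) < e" if "m \<ge> max M N" "n \<ge> max M N" for m n
  proof -
    have "abs2 (X m + Y m - (X n + Y n)) \<le> max (abs2 (X m - X n)) (abs2 (Y m - Y n))"
      using abs2_add[of "X m - X n" "Y m - Y n"] by (simp add: algebra_simps)
    moreover have "abs2 (X m - X n) < e" "abs2 (Y m - Y n) < e" using M N that by auto
    ultimately show ?thesis by linarith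
  qed
  thus "\<exists>N. \<forall>m\<ge>N. \<forall>n\<ge>N. abs2 (X m + Y m - (X n + Y n)) < e" by blast
qed

lemma cauchy2_mult:
  assumes "cauchy2 X" "cauchy2 Y" shows "cauchy2 (\<lambda>n. X n * Y n)"
  unfolding cauchy2_def
proof (intro allI impI)
  fix e :: real assume e: "e > 0"
  obtain A where A: "A > 0" "\<forall>n. abs2 (X n) \<le> A" using cauchy2_bounded[OF assms(1)] by blast
  obtain B where B: "B > 0" "\<forall>n. abs2 (Y n) \<le> B" using cauchy2_bounded[OF assms(2)] by blast
  obtain M where M: "\<forall>m\<ge>M. \<forall>n\<ge>M. abs2 (X m - X n) < e / B"
    using cauchy2D[OF assms(1), of "e / B"] e B by auto
  obtain N where N: "\<forall>m\<ge>N. \<forall>n\<ge>N. abs2 (Y m - Y n) < e / A"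
    using cauchy2D[OF assms(2), of "e / A"] e A by auto
  have "abs2 (X m * Y m - X n * Y n) < e" if mn: "m \<ge> max M N" "n \<ge> max M N" for m n
  proof -
    have "X m * Y m - X n * Y n = X m * (Y m - Y n) + (X m - X n) * Y n" by (simp add: algebra_simps)
    hence "abs2 (X m * Y m - X n * Y n) \<le> max (abs2 (X m) * abs2 (Y m - Y n)) (abs2 (X m - X n) * abs2 (Y n))"
      using abs2_add[of "X m * (Y m - Y n)" "(X m - X n) * Y n"] by (simp add: abs2_mult)
    moreover have "abs2 (X m) * abs2 (Y m - Y n) \<le> A * abs2 (Y m - Y n)"
      using A by (simp add: mult_right_mono)
    moreover have "A * abs2 (Y m - Y n) < e" using N mn A by (simp add: field_simps)
    moreover have "abs2 (X m - X n) * abs2 (Y n) \<le> abs2 (X m - X n) * B"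
      using B by (simp add: mult_left_mono)
    moreover have "abs2 (X m - X n) * B < e" using M mn B by (simp add: field_simps)
    ultimately show ?thesis by linarith
  qed
  thus "\<exists>N. \<forall>m\<ge>N. \<forall>n\<ge>N. abs2 (X m * Y m - X n * Y n) < e" by blast
qed

lemma cauchy2_not_null2:
  assumes "cauchy2 X" "\<not> null2 X"
  shows "\<exists>c>0. \<exists>N. \<forall>n\<ge>N. abs2 (X n) \<ge> c"
proof -
  obtain L where L: "(\<lambda>n. abs2 (X n)) \<longlonglongrightarrow> L"
    using cauchy2_abs2_convergent[OF assms(1)] by (auto simp: convergent_def)
  have "L \<ge> 0" by (rule LIMSEQ_le_const[OF L]) auto
  moreover have "L \<noteq> 0" using assms(2) L by (auto simp: null2_def)
  ultimately have "L > 0" by simp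
  hence "\<forall>\<^sub>F n in sequentially. L / 2 < abs2 (X n)"
    using order_tendstoD(1)[OF L, of "L / 2"] by simp
  thus ?thesis using \<open>L > 0\<close> unfolding eventually_sequentially
    by (intro exI[of _ "L / 2"]) (auto intro: less_imp_le)
qed

lemma cauchy2_inverse:
  assumes "cauchy2 X" "\<not> null2 X"
  shows "cauchy2 (\<lambda>n. inverse (X n))"
  unfolding cauchy2_def
proof (intro allI impI)
  fix e :: real assume e: "e > 0"
  obtain c N where c: "c > 0" "\<forall>n\<ge>N. abs2 (X n) \<ge> c" using cauchy2_not_null2[OF assms] by blast
  obtain M where M: "\<forall>m\<ge>M. \<forall>n\<ge>M. abs2 (X m - X n) < e * c * c"
    using cauchy2D[OF assms(1), of "e * c * c"] e c by auto
  have "abs2 (inverse (X m) - inverse (X n)) < e" if mn: "m \<ge> max M N" "n \<ge> max M N" for m n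
  proof -
    have ge: "abs2 (X m) \<ge> c" "abs2 (X n) \<ge> c" using c mn by auto
    hence nz: "X m \<noteq> 0" "X n \<noteq> 0" using c by auto
    hence "(inverse (X m) - inverse (X n)) * (X m * X n) = X n - X m" by (simp add: field_simps)
    from arg_cong[OF this, of abs2]
    have "abs2 (inverse (X m) - inverse (X n)) * (abs2 (X m) * abs2 (X n)) = abs2 (X n - X m)"
      by (simp only: abs2_mult)
    also have "\<dots> < e * (c * c)" using M mn by (simp add: mult.assoc)
    also have "\<dots> \<le> e * (abs2 (X m) * abs2 (X n))"
      using e c ge by (intro mult_left_mono mult_mono) auto
    finally show ?thesis using nz by (simp add: mult_less_cancel_right)
  qed
  thus "\<exists>N. \<forall>m\<ge>N. \<forall>n\<ge>N. abs2 (inverse (X m) - inverse (X n)) < e" by blast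
qed

definition rel2 :: "(nat \<Rightarrow> rat) \<Rightarrow> (nat \<Rightarrow> rat) \<Rightarrow> bool" where
  "rel2 X Y \<longleftrightarrow> cauchy2 X \<and> cauchy2 Y \<and> null2 (\<lambda>n. X n - Y n)"

lemma rel2_refl: "cauchy2 X \<Longrightarrow> rel2 X X"
  by (simp add: rel2_def)

lemma part_equivp_rel2: "part_equivp rel2"
proof (rule part_equivpI)
  show "\<exists>X. rel2 X X" by (rule exI[of _ "\<lambda>n. 0"]) (simp add: rel2_def)
  show "symp rel2" unfolding symp_def rel2_def
    by (auto dest: null2_minus)
  show "transp rel2"
  proof (rule transpI)
    fix X Y Z assume "rel2 X Y" "rel2 Y Z"
    thus "rel2 X Z"
      using null2_add[of "\<lambda>n. X n - Y n" "\<lambda>n. Y n - Z n"] by (simp add: rel2_def)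
  qed
qed

text \<open>
  The field of 2-adic numbers is the completion of the rationals for the 2-adic absolute value:
  Cauchy sequences modulo null sequences.
\<close>

quotient_type q2 = "nat \<Rightarrow> rat" / partial: rel2
  morphisms rep_q2 Q2
  by (rule part_equivp_rel2)

lemma cr_q2_eq: "pcr_q2 = (\<lambda>X x. cauchy2 X \<and> Q2 X = x)"
  unfolding q2.pcr_cr_eq cr_q2_def rel2_def by auto

lemma Q2_induct [induct type: q2]:
  assumes "\<And>X. cauchy2 X \<Longrightarrow> P (Q2 X)" shows "P x"
proof (induct x)
  case (1 X)
  then have "cauchy2 X" by (simp add: rel2_def)
  then show "P (Q2 X)" by (rule assms)
qed

lemma eq_Q2: "cauchy2 X \<Longrightarrow> cauchy2 Y \<Longrightarrow> Q2 X = Q2 Y \<longleftrightarrow> null2 (\<lambda>n. X n - Y n)"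
  using q2.rel_eq_transfer
  unfolding q2.pcr_cr_eq cr_q2_def rel_fun_def rel2_def by simp

lemma Domainp_pcr_q2 [transfer_domain_rule]: "Domainp pcr_q2 = cauchy2"
  by (simp add: q2.domain_eq rel2_def)

instantiation q2 :: field
begin

lift_definition zero_q2 :: q2 is "\<lambda>n. 0"
  by (simp add: rel2_refl)

lift_definition one_q2 :: q2 is "\<lambda>n. 1"
  by (simp add: rel2_refl)

lift_definition plus_q2 :: "q2 \<Rightarrow> q2 \<Rightarrow> q2" is "\<lambda>X Y n. X n + Y n"
  unfolding rel2_def add_diff_add by (simp only: cauchy2_add null2_add simp_thms)

lift_definition uminus_q2 :: "q2 \<Rightarrow> q2" is "\<lambda>X n. - X n"
  unfolding rel2_def minus_diff_minus by (simp only: cauchy2_minus null2_minus simp_thms)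

lift_definition times_q2 :: "q2 \<Rightarrow> q2 \<Rightarrow> q2" is "\<lambda>X Y n. X n * Y n"
proof -
  fix X X' Y Y' assume a: "rel2 X X'" "rel2 Y Y'"
  hence "null2 (\<lambda>n. X n * (Y n - Y' n) + Y' n * (X n - X' n))"
    unfolding rel2_def by (intro null2_add null2_mult_bounded) auto
  moreover have "(\<lambda>n. X n * (Y n - Y' n) + Y' n * (X n - X' n)) = (\<lambda>n. X n * Y n - X' n * Y' n)"
    by (simp add: fun_eq_iff right_diff_distrib left_diff_distrib mult.commute)
  ultimately show "rel2 (\<lambda>n. X n * Y n) (\<lambda>n. X' n * Y' n)"
    using a by (simp add: rel2_def cauchy2_mult)
qed

lift_definition inverse_q2 :: "q2 \<Rightarrow> q2"
  is "\<lambda>X. if null2 X then (\<lambda>n. 0) else (\<lambda>n. inverse (X n))"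
proof -
  fix X Y assume a: "rel2 X Y"
  hence X: "cauchy2 X" and Y: "cauchy2 Y" and XY: "null2 (\<lambda>n. X n - Y n)"
    by (simp_all add: rel2_def)
  have iff: "null2 X \<longleftrightarrow> null2 Y"
  proof
    assume "null2 X" from null2_diff[OF this XY] show "null2 Y" by simp
  next
    assume "null2 Y" from null2_add[OF this XY] show "null2 X" by simp
  qed
  show "?thesis X Y"
  proof (cases "null2 X")
    case True thus ?thesis using iff by (simp add: rel2_refl)
  next
    case False
    hence nY: "\<not> null2 Y" using iff by simp
    note cX = cauchy2_inverse[OF X False] and cY = cauchy2_inverse[OF Y nY]
    have n: "null2 (\<lambda>n. (inverse (X n) * inverse (Y n)) * - (X n - Y n))"
      using cauchy2_mult[OF cX cY] null2_minus[OF XY] by (rule null2_mult_bounded)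
    obtain c M where c: "c > 0" "\<forall>n\<ge>M. abs2 (X n) \<ge> c" using cauchy2_not_null2[OF X False] by blast
    obtain d N where d: "d > 0" "\<forall>n\<ge>N. abs2 (Y n) \<ge> d" using cauchy2_not_null2[OF Y nY] by blast
    have "(inverse (X n) * inverse (Y n)) * - (X n - Y n) = inverse (X n) - inverse (Y n)"
      if "n \<ge> max M N" for n
    proof -
      have "c \<le> abs2 (X n)" "d \<le> abs2 (Y n)" using c d that by simp_all
      hence "abs2 (X n) > 0" "abs2 (Y n) > 0" using c(1) d(1) by linarith+
      hence "X n \<noteq> 0" "Y n \<noteq> 0" by simp_all
      thus ?thesis by (simp add: field_simps)
    qed
    hence "\<forall>\<^sub>F n in sequentially. abs2 ((inverse (X n) * inverse (Y n)) * - (X n - Y n))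
        = abs2 (inverse (X n) - inverse (Y n))"
      by (intro eventually_sequentiallyI[of "max M N"]) simp
    from tendsto_cong[OF this] have "null2 (\<lambda>n. inverse (X n) - inverse (Y n))"
      using n unfolding null2_def by blast
    thus ?thesis using False nY cX cY by (simp add: rel2_def)
  qed
qed

definition "x - y = x + - y" for x y :: q2

definition "x div y = x * inverse y" for x y :: q2

instance
proof
  fix a b c :: q2
  show "a + b = b + a" by transfer (simp add: ac_simps rel2_def cauchy2_add cauchy2_mult)
  show "(a + b) + c = a + (b + c)" by transfer (simp add: ac_simps rel2_def cauchy2_add cauchy2_mult)
  show "0 + a = a" by transfer (simp add: rel2_def cauchy2_add cauchy2_minus cauchy2_mult)
  show "- a + a = 0" by transfer (simp add: rel2_def cauchy2_add cauchy2_minus cauchy2_mult)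
  show "a - b = a + - b" by (rule minus_q2_def)
  show "(a * b) * c = a * (b * c)" by transfer (simp add: ac_simps rel2_def cauchy2_add cauchy2_mult)
  show "a * b = b * a" by transfer (simp add: ac_simps rel2_def cauchy2_add cauchy2_mult)
  show "1 * a = a" by transfer (simp add: rel2_def cauchy2_add cauchy2_minus cauchy2_mult)
  show "(a + b) * c = a * c + b * c" by transfer (simp add: distrib_right rel2_def cauchy2_add cauchy2_mult)
  show "(0::q2) \<noteq> (1::q2)" by transfer (simp add: rel2_def cauchy2_add cauchy2_minus cauchy2_mult)
  have "null2 (\<lambda>n. inverse (X n) * X n - 1)" if X: "cauchy2 X" "\<not> null2 X" for X
  proof (rule null2I)
    fix e :: real assume "0 < e"
    obtain c k where "c > 0" "\<forall>n\<ge>k. c \<le> abs2 (X n)" using X cauchy2_not_null2 by blast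
    hence "abs2 (X n) > 0" if "n \<ge> k" for n using that by (meson less_le_trans)
    hence "\<forall>n\<ge>k. abs2 (inverse (X n) * X n - 1) < e" using \<open>0 < e\<close> by simp
    thus "\<exists>k. \<forall>n\<ge>k. abs2 (inverse (X n) * X n - 1) < e" by blast
  qed
  then show "a \<noteq> 0 \<Longrightarrow> inverse a * a = 1"
    by transfer (simp add: rel2_def cauchy2_mult cauchy2_inverse)
  show "a div b = a * inverse b" by (rule divide_q2_def)
  show "inverse (0::q2) = 0" by transfer (simp add: rel2_def cauchy2_add cauchy2_minus cauchy2_mult)
qed

end

lemma add_Q2: "cauchy2 X \<Longrightarrow> cauchy2 Y \<Longrightarrow> Q2 X + Q2 Y = Q2 (\<lambda>n. X n + Y n)"
  using plus_q2.transfer by (simp add: cr_q2_eq rel_fun_def)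

lemma minus_Q2: "cauchy2 X \<Longrightarrow> - Q2 X = Q2 (\<lambda>n. - X n)"
  using uminus_q2.transfer by (simp add: cr_q2_eq rel_fun_def)

lemma diff_Q2: "cauchy2 X \<Longrightarrow> cauchy2 Y \<Longrightarrow> Q2 X - Q2 Y = Q2 (\<lambda>n. X n - Y n)"
  by (simp add: minus_q2_def minus_Q2 add_Q2 cauchy2_minus)

lemma mult_Q2: "cauchy2 X \<Longrightarrow> cauchy2 Y \<Longrightarrow> Q2 X * Q2 Y = Q2 (\<lambda>n. X n * Y n)"
  using times_q2.transfer by (simp add: cr_q2_eq rel_fun_def)

text \<open>
  The library restricts its constant \<open>norm\<close> to real normed spaces, so the 2-adic absolute
  value gets its own name.
\<close>

lift_definition norm2 :: "q2 \<Rightarrow> real" is "\<lambda>X. lim (\<lambda>n. abs2 (X n))"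
proof -
  fix X Y assume "rel2 X Y"
  hence X: "cauchy2 X" and XY: "(\<lambda>n. abs2 (X n - Y n)) \<longlonglongrightarrow> 0"
    by (simp_all add: rel2_def null2_def)
  obtain L where L: "(\<lambda>n. abs2 (X n)) \<longlonglongrightarrow> L"
    using cauchy2_abs2_convergent[OF X] by (auto simp: convergent_def)
  have "(\<lambda>n. abs2 (X n) - abs2 (Y n)) \<longlonglongrightarrow> 0"
    by (rule Lim_null_comparison[OF _ XY]) (simp add: abs2_diff_triangle)
  from tendsto_diff[OF L this] have "(\<lambda>n. abs2 (Y n)) \<longlonglongrightarrow> L" by simp
  with L show "lim (\<lambda>n. abs2 (X n)) = lim (\<lambda>n. abs2 (Y n))" by (simp add: limI)
qed

lemma norm_Q2: "cauchy2 X \<Longrightarrow> norm2 (Q2 X) = lim (\<lambda>n. abs2 (X n))"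
  using norm2.transfer by (simp add: cr_q2_eq rel_fun_def)

lemma norm_Q2_LIMSEQ: "cauchy2 X \<Longrightarrow> (\<lambda>n. abs2 (X n)) \<longlonglongrightarrow> norm2 (Q2 X)"
  using cauchy2_abs2_convergent[of X] by (simp add: norm_Q2 convergent_LIMSEQ_iff)

lemma norm2_nonneg [simp]: "norm2 (x :: q2) \<ge> 0"
  by (induct x) (rule LIMSEQ_le_const[OF norm_Q2_LIMSEQ], auto)

lemma norm2_eq_0_iff [simp]: "norm2 (x :: q2) = 0 \<longleftrightarrow> x = 0"
proof (induct x)
  fix X assume X: "cauchy2 X"
  have "norm2 (Q2 X) = 0 \<longleftrightarrow> null2 X"
    using norm_Q2_LIMSEQ[OF X] by (auto simp: null2_def intro: LIMSEQ_unique)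
  also have "\<dots> \<longleftrightarrow> Q2 X = 0"
    unfolding zero_q2_def using X by (simp add: eq_Q2)
  finally show "norm2 (Q2 X) = 0 \<longleftrightarrow> Q2 X = 0" .
qed

lemma norm2_0 [simp]: "norm2 (0 :: q2) = 0"
  by simp

lemma norm2_mult: "norm2 (x * y :: q2) = norm2 x * norm2 y"
proof (induct x)
  fix X assume X: "cauchy2 X"
  show "norm2 (Q2 X * y) = norm2 (Q2 X) * norm2 y"
  proof (induct y)
    fix Y assume Y: "cauchy2 Y"
    show "norm2 (Q2 X * Q2 Y) = norm2 (Q2 X) * norm2 (Q2 Y)"
      using norm_Q2_LIMSEQ[OF cauchy2_mult[OF X Y]] tendsto_mult[OF norm_Q2_LIMSEQ[OF X] norm_Q2_LIMSEQ[OF Y]]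
      by (simp add: abs2_mult mult_Q2 X Y LIMSEQ_unique)
  qed
qed

lemma norm2_add: "norm2 (x + y :: q2) \<le> max (norm2 x) (norm2 y)"
proof (induct x)
  fix X assume X: "cauchy2 X"
  show "norm2 (Q2 X + y) \<le> max (norm2 (Q2 X)) (norm2 y)"
  proof (induct y)
    fix Y assume Y: "cauchy2 Y"
    show "norm2 (Q2 X + Q2 Y) \<le> max (norm2 (Q2 X)) (norm2 (Q2 Y))"
      unfolding add_Q2[OF X Y]
      by (rule LIMSEQ_le[OF norm_Q2_LIMSEQ[OF cauchy2_add[OF X Y]]
          tendsto_max[OF norm_Q2_LIMSEQ[OF X] norm_Q2_LIMSEQ[OF Y]]])
        (use abs2_add in blast)
  qed
qed

lemma norm2_1 [simp]: "norm2 (1 :: q2) = 1"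
  using norm_Q2_LIMSEQ[of "\<lambda>n. 1"] by (simp add: one_q2_def LIMSEQ_const_iff)

lemma norm2_minus [simp]: "norm2 (- x :: q2) = norm2 x"
proof -
  have "norm2 (-1 :: q2) * norm2 (-1 :: q2) = 1" using norm2_mult[of "-1" "-1"] by simp
  hence "norm2 (-1 :: q2) = 1"
    using norm2_nonneg[of "-1"] square_eq_1_iff[of "norm2 (-1)"] by linarith
  thus ?thesis using norm2_mult[of "-1" x] by simp
qed

lemma norm2_diff: "norm2 (x - y :: q2) \<le> max (norm2 x) (norm2 y)"
  using norm2_add[of x "- y"] by simp

lemma norm2_minus_commute: "norm2 (x - y :: q2) = norm2 (y - x)"
  using norm2_minus[of "x - y"] by simp

lemma norm2_inverse: "norm2 (inverse x :: q2) = inverse (norm2 x)"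
  using norm2_mult[of x "inverse x"] by (cases "x = 0") (auto simp: field_simps)

lemma norm2_divide: "norm2 (x / y :: q2) = norm2 x / norm2 y"
  by (simp add: divide_inverse norm2_mult norm2_inverse)

lemma of_nat_Q2: "of_nat k = Q2 (\<lambda>n. of_nat k)"
  by (induct k) (simp_all add: zero_q2_def one_q2_def add_Q2)

lemma of_int_Q2: "of_int k = Q2 (\<lambda>n. of_int k)"
  by (cases k rule: int_diff_cases) (simp add: of_nat_Q2 diff_Q2)

instance q2 :: field_char_0
proof
  show "inj (of_nat :: nat \<Rightarrow> q2)"
    by (auto simp: inj_def of_nat_Q2 eq_Q2)
qed

lemma of_rat_Q2: "of_rat r = Q2 (\<lambda>n. r)"
proof -
  obtain a b where ab: "b \<noteq> 0" "r = of_int a / of_int b" by (rule rat_frac_cases)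
  have "Q2 (\<lambda>n. r) * of_int b = of_int a"
    using ab by (simp add: of_int_Q2 mult_Q2)
  hence "Q2 (\<lambda>n. r) = of_int a / of_int b" using ab(1) by (simp only: eq_divide_eq of_int_eq_0_iff) simp
  also have "\<dots> = of_rat r" using ab(2) by (simp add: of_rat_divide)
  finally show ?thesis ..
qed

lemma norm2_of_rat [simp]: "norm2 (of_rat r :: q2) = abs2 r"
  using norm_Q2_LIMSEQ[of "\<lambda>n. r"] by (simp add: of_rat_Q2 LIMSEQ_const_iff)

lemma norm_2_q2 [simp]: "norm2 (2 :: q2) = 1 / 2"
  using norm2_of_rat[of 2] by (simp add: abs2_2)

instantiation q2 :: metric_space
begin

definition dist_q2 :: "q2 \<Rightarrow> q2 \<Rightarrow> real" where
  "dist_q2 x y = norm2 (x - y)"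

definition uniformity_q2 :: "(q2 \<times> q2) filter" where
  "uniformity_q2 = (INF e\<in>{0<..}. principal {(x, y). dist x y < e})"

definition open_q2 :: "q2 set \<Rightarrow> bool" where
  "open_q2 U \<longleftrightarrow> (\<forall>x\<in>U. \<forall>\<^sub>F (x', y) in uniformity. x' = x \<longrightarrow> y \<in> U)"

instance
proof
  fix x y z :: q2
  show "dist x y = 0 \<longleftrightarrow> x = y" by (simp add: dist_q2_def)
  have "norm2 (x - y) \<le> max (norm2 (x - z)) (norm2 (y - z))"
    using norm2_diff[of "x - z" "y - z"] by simp
  thus "dist x y \<le> dist x z + dist y z"
    using norm2_nonneg[of "x - z"] norm2_nonneg[of "y - z"] unfolding dist_q2_def by linarith
qed (simp_all add: uniformity_q2_def open_q2_def)

end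

lemma of_rat_dense_q2:
  fixes x :: q2
  assumes "e > 0" shows "\<exists>r. dist x (of_rat r) < e"
proof (induct x)
  fix X assume X: "cauchy2 X"
  obtain N where N: "\<forall>m\<ge>N. \<forall>n\<ge>N. abs2 (X m - X n) < e / 2"
    using cauchy2D[OF X, of "e / 2"] assms by auto
  have "cauchy2 (\<lambda>n. X n - X N)" using cauchy2_add[OF X cauchy2_const[of "- X N"]] by simp
  hence "(\<lambda>n. abs2 (X n - X N)) \<longlonglongrightarrow> norm2 (Q2 X - of_rat (X N))"
    unfolding of_rat_Q2 diff_Q2[OF X cauchy2_const] by (rule norm_Q2_LIMSEQ)
  hence "norm2 (Q2 X - of_rat (X N)) \<le> e / 2"
    by (rule LIMSEQ_le_const2) (use N in \<open>meson less_imp_le order_refl\<close>)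
  thus "\<exists>r. dist (Q2 X) (of_rat r) < e" using assms by (intro exI[of _ "X N"]) (simp add: dist_q2_def)
qed

instance q2 :: complete_space
proof
  fix X :: "nat \<Rightarrow> q2" assume C: "Cauchy X"
  have "\<forall>n. \<exists>r. dist (X n) (of_rat r) < 1 / Suc n" using of_rat_dense_q2 by simp
  then obtain r where r: "\<And>n. dist (X n) (of_rat (r n)) < 1 / Suc n" by metis
  have r0: "(\<lambda>n. dist (X n) (of_rat (r n))) \<longlonglongrightarrow> 0"
  proof (rule Lim_null_comparison[OF _ LIMSEQ_inverse_real_of_nat])
    show "\<forall>\<^sub>F n in sequentially. norm (dist (X n) (of_rat (r n))) \<le> inverse (real (Suc n))"
      using r by (intro always_eventually allI) (simp add: less_imp_le inverse_eq_divide)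
  qed
  have cr: "cauchy2 r" unfolding cauchy2_def
  proof (intro allI impI)
    fix e :: real assume e: "e > 0"
    obtain M where M: "\<forall>m\<ge>M. \<forall>n\<ge>M. dist (X m) (X n) < e / 3" using metric_CauchyD[OF C, of "e / 3"] e by auto
    obtain N where N: "\<forall>n\<ge>N. dist (X n) (of_rat (r n)) < e / 3"
      using order_tendstoD(2)[OF r0, of "e / 3"] e by (auto simp: eventually_sequentially)
    have "abs2 (r m - r n) < e" if mn: "m \<ge> max M N" "n \<ge> max M N" for m n
    proof -
      have "abs2 (r m - r n) = dist (of_rat (r m) :: q2) (of_rat (r n))"
        by (simp only: dist_q2_def of_rat_diff[symmetric] norm2_of_rat)
      also have "\<dots> \<le> dist (X m) (of_rat (r m)) + dist (X m) (X n) + dist (X n) (of_rat (r n))"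
        using dist_triangle[of "of_rat (r m)" "of_rat (r n)" "X m"] dist_triangle[of "X m" "of_rat (r n)" "X n"]
        unfolding dist_commute[of "of_rat (r m)" "X m"] by linarith
      also have "\<dots> < e / 3 + e / 3 + e / 3" using M N mn by (intro add_strict_mono) simp_all
      finally show ?thesis by simp
    qed
    thus "\<exists>N. \<forall>m\<ge>N. \<forall>n\<ge>N. abs2 (r m - r n) < e" by blast
  qed
  have "(\<lambda>n. dist (of_rat (r n)) (Q2 r)) \<longlonglongrightarrow> 0"
  proof (rule metric_LIMSEQ_I)
    fix e :: real assume e: "e > 0"
    obtain N where N: "\<forall>m\<ge>N. \<forall>n\<ge>N. abs2 (r m - r n) < e / 2" using cauchy2D[OF cr, of "e / 2"] e by auto
    have "dist (of_rat (r n)) (Q2 r) < e" if n: "n \<ge> N" for n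
    proof -
      have "cauchy2 (\<lambda>k. r k - r n)" using cauchy2_add[OF cr cauchy2_const[of "- r n"]] by simp
      hence "(\<lambda>k. abs2 (r k - r n)) \<longlonglongrightarrow> norm2 (Q2 r - of_rat (r n))"
        unfolding of_rat_Q2 diff_Q2[OF cr cauchy2_const] by (rule norm_Q2_LIMSEQ)
      hence "norm2 (Q2 r - of_rat (r n)) \<le> e / 2"
        by (rule LIMSEQ_le_const2) (use N n in \<open>meson less_imp_le\<close>)
      thus ?thesis using e by (simp add: dist_q2_def norm2_minus_commute)
    qed
    thus "\<exists>N. \<forall>n\<ge>N. dist (dist (of_rat (r n)) (Q2 r)) 0 < e" by (intro exI[of _ N]) (simp add: dist_real_def)
  qed
  hence "(\<lambda>n. dist (X n) (of_rat (r n)) + dist (of_rat (r n)) (Q2 r)) \<longlonglongrightarrow> 0"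
    using tendsto_add[OF r0, of "\<lambda>n. dist (of_rat (r n)) (Q2 r)" 0] by simp
  hence "(\<lambda>n. dist (X n) (Q2 r)) \<longlonglongrightarrow> 0"
  proof (rule Lim_null_comparison[rotated])
    show "\<forall>\<^sub>F n in sequentially. norm (dist (X n) (Q2 r)) \<le>
        dist (X n) (of_rat (r n)) + dist (of_rat (r n)) (Q2 r)"
      using dist_triangle by (intro always_eventually allI) simp
  qed
  hence "X \<longlonglongrightarrow> Q2 r" by (subst tendsto_dist_iff)
  thus "convergent X" by (rule convergentI)
qed


section \<open>Balls and residues\<close>

lemma powi_add_1: "(2::real) powi (n + 1) = 2 * 2 powi n" "(2::real) powi (1 + n) = 2 * 2 powi n"
  by (simp_all add: power_int_add)

lemma powi_minus_Suc: "(2::real) powi (- n - 1) = 2 powi (- n) / 2"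
  by (simp add: power_int_diff)

lemma powi_less_iff: "(2::real) powi a < 2 powi b \<longleftrightarrow> a < b"
  using power_int_strict_increasing[of a b "2::real"] power_int_increasing[of b a "2::real"]
  by (cases "a < b") auto

lemma powi_eq_iff: "(2::real) powi a = 2 powi b \<longleftrightarrow> a = b"
  using powi_less_iff[of a b] powi_less_iff[of b a] by (cases a b rule: linorder_cases) auto

lemma abs2_powi: "x \<noteq> 0 \<Longrightarrow> \<exists>k. abs2 x = 2 powi k"
  unfolding abs2_def by auto

lemma abs2_residue:
  assumes "abs2 r = 1" shows "abs2 (r - 1) \<le> 1 / 2"
proof -
  obtain a b where q: "quotient_of r = (a, b)" by fastforce
  have b: "b > 0" using q by (rule quotient_of_denom_pos)
  have r: "r = of_int a / of_int b" using q by (rule quotient_of_div)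
  have cop: "coprime a b" using q by (rule quotient_of_coprime)
  have a: "a \<noteq> 0" using assms r by auto
  have "(2::real) powi (int (multiplicity 2 b) - int (multiplicity 2 a)) = 2 powi 0"
    using assms abs2_frac[of a b] a b r by simp
  hence eq: "multiplicity 2 a = multiplicity 2 b"
    unfolding powi_eq_iff by simp
  have "odd a \<and> odd b"
  proof (rule ccontr)
    assume "\<not> (odd a \<and> odd b)"
    hence "multiplicity 2 a > 0 \<or> multiplicity 2 b > 0"
      using a b by (auto simp: prime_multiplicity_gt_zero_iff)
    hence "multiplicity 2 a > 0" "multiplicity 2 b > 0" using eq by auto
    hence "even a" "even b" using not_dvd_imp_multiplicity_0 by fastforce+
    thus False using cop by (metis coprime_common_divisor odd_one)
  qed
  hence e: "even (a - b)" and o: "multiplicity 2 b = 0"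
    by (auto intro: not_dvd_imp_multiplicity_0)
  have r1: "r - 1 = of_int (a - b) / of_int b" using r b by (simp add: field_simps)
  show ?thesis
  proof (cases "a = b")
    case True thus ?thesis using r1 by simp
  next
    case False
    hence nz: "a - b \<noteq> 0" by simp
    have "multiplicity 2 (a - b) \<ge> 1" using e nz by (intro multiplicity_geI) auto
    hence "abs2 (r - 1) \<le> 2 powi (-1)"
      unfolding r1 using abs2_frac[OF nz, of b] b o by (simp add: power_int_increasing del: power_int_minus1_right)
    thus ?thesis by simp
  qed
qed

lemma norm2_eqI: "norm2 (x - y) < norm2 x \<Longrightarrow> norm2 y = norm2 x"
  using norm2_diff[of x "x - y"] norm2_add[of "x - y" y] by (auto simp: max_def split: if_splits)

lemma norm2_powi_cases:
  assumes "x \<noteq> 0" shows "\<exists>k. norm2 x = 2 powi k"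
proof -
  have "norm2 x > 0" using assms norm2_nonneg[of x] norm2_eq_0_iff[of x] by linarith
  then obtain r where "norm2 (x - of_rat r) < norm2 x"
    using of_rat_dense_q2[of "norm2 x" x] by (auto simp: dist_q2_def)
  hence e: "norm2 x = abs2 r" using norm2_eqI[of x "of_rat r"] by simp
  hence "r \<noteq> 0" using assms by auto
  thus ?thesis using abs2_powi e by auto
qed

lemma norm2_power_int: "norm2 (2 powi n) = 2 powi (- n)"
proof -
  have p: "norm2 (2 ^ k) = (1 / 2) ^ k" for k by (induct k) (simp_all add: norm2_mult)
  show ?thesis
  proof (cases n rule: int_cases2)
    case (nonneg k)
    thus ?thesis by (simp add: p power_int_minus power_one_over inverse_eq_divide)
  next
    case (nonpos k)
    thus ?thesis by (simp add: p power_int_minus norm2_inverse power_one_over)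
  qed
qed

lemma norm2_residue1:
  assumes "norm2 x \<le> 1" shows "norm2 x \<le> 1 / 2 \<or> norm2 (x - 1) \<le> 1 / 2"
proof (cases "norm2 x = 1")
  case True
  obtain r where r: "norm2 (x - of_rat r) < 1 / 2"
    using of_rat_dense_q2[of "1/2" x] by (auto simp: dist_q2_def)
  hence "abs2 r = 1" using norm2_eqI[of x "of_rat r"] True by simp
  hence "norm2 (of_rat (r - 1)) \<le> 1 / 2" using abs2_residue by (simp only: norm2_of_rat)
  hence "norm2 (of_rat r - 1) \<le> 1 / 2" by (simp add: of_rat_diff)
  thus ?thesis using norm2_add[of "x - of_rat r" "of_rat r - 1"] r by (simp add: max_def split: if_splits)
next
  case False
  show ?thesis
  proof (cases "x = 0")
    case nz: False
    then obtain k where k: "norm2 x = 2 powi k" using norm2_powi_cases by blast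
    have "(2::real) powi k < 2 powi 0" using k assms False by simp
    hence "k < 0" unfolding powi_less_iff .
    hence "(2::real) powi k \<le> 2 powi (-1)" by (intro power_int_increasing) auto
    thus ?thesis using k by simp
  qed simp
qed

lemma norm2_residue:
  assumes "norm2 x \<le> 2 powi (- n)"
  shows "norm2 x \<le> 2 powi (- n - 1) \<or> norm2 (x - 2 powi n) \<le> 2 powi (- n - 1)"
proof -
  define y where "y = x / 2 powi n"
  have x: "x = y * 2 powi n" by (simp add: y_def)
  have nx: "norm2 x = norm2 y * 2 powi (- n)"
    by (simp add: x norm2_mult norm2_power_int)
  have nx1: "norm2 (x - 2 powi n) = norm2 (y - 1) * 2 powi (- n)"
    unfolding norm2_power_int[symmetric] norm2_mult[symmetric] x by (simp add: algebra_simps)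
  have p: "(2::real) powi (- n) > 0" by simp
  have "norm2 y \<le> 1" using assms nx p by simp
  hence "norm2 y \<le> 1 / 2 \<or> norm2 (y - 1) \<le> 1 / 2" by (rule norm2_residue1)
  thus ?thesis unfolding nx nx1 powi_minus_Suc using p by (auto simp: field_simps)
qed

lemma power_int_2_nonzero_q2 [simp]: "(2::q2) powi n \<noteq> 0"
  by simp

definition ball2 :: "q2 \<Rightarrow> int \<Rightarrow> q2 set" where
  "ball2 c n = {x. norm2 (x - c) \<le> 2 powi (- n)}"

lemma ball2_cball: "ball2 c n = cball c (2 powi (- n))"
  by (auto simp: ball2_def dist_q2_def norm2_minus_commute)

lemma ball2_mono:
  assumes "z \<in> ball2 c m" "z \<in> ball2 d n" "m \<ge> n" shows "ball2 c m \<subseteq> ball2 d n"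
proof
  fix x assume "x \<in> ball2 c m"
  hence "norm2 (x - z) \<le> 2 powi (- m)"
    using assms(1) norm2_diff[of "x - c" "z - c"] by (simp add: ball2_def)
  moreover have "(2::real) powi (- m) \<le> 2 powi (- n)"
    using assms(3) by (intro power_int_increasing) auto
  ultimately show "x \<in> ball2 d n"
    using assms(2) norm2_add[of "x - z" "z - d"] by (simp add: ball2_def)
qed

lemma ball2_Int: "ball2 c m \<inter> ball2 d n \<in> {{}, ball2 c m, ball2 d n}"
proof (cases "ball2 c m \<inter> ball2 d n = {}")
  case False
  then obtain z where z: "z \<in> ball2 c m" "z \<in> ball2 d n" by blast
  show ?thesis
    using ball2_mono[OF z] ball2_mono[OF z(2) z(1)] by (cases "m \<ge> n") auto
qed simp

definition balls2 :: "q2 set set" where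
  "balls2 = insert {} {ball2 c n | c n. True}"

lemma Int_stable_balls2: "Int_stable balls2"
proof (rule Int_stableI)
  fix A B assume "A \<in> balls2" "B \<in> balls2"
  moreover have "ball2 c m \<inter> ball2 d n \<in> balls2" for c m d n
    using ball2_Int[of c m d n] unfolding balls2_def by blast
  ultimately show "A \<inter> B \<in> balls2" unfolding balls2_def by blast
qed

lemma powi_small: "e > 0 \<Longrightarrow> \<exists>m. (2::real) powi (- int m) < e"
proof -
  assume "e > 0"
  then obtain m where "(1 / 2 :: real) ^ m < e" using real_arch_pow_inv[of e "1/2"] by auto
  moreover have "(2::real) powi (- int m) = (1 / 2) ^ m"
    by (simp add: power_int_minus power_one_over inverse_eq_divide)
  ultimately show "\<exists>m. (2::real) powi (- int m) < e" by metis
qed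

lemma sets_borel_q2: "sets (borel :: q2 measure) = sigma_sets UNIV balls2"
proof
  show "sigma_sets UNIV balls2 \<subseteq> sets (borel :: q2 measure)"
    by (rule sets.sigma_sets_subset[of balls2 borel, simplified])
      (auto simp: balls2_def ball2_cball)
  have "U \<in> sigma_sets UNIV balls2" if "open U" for U :: "q2 set"
  proof -
    define I where "I = {p :: rat \<times> nat. ball2 (of_rat (fst p)) (int (snd p)) \<subseteq> U}"
    have "x \<in> (\<Union>p\<in>I. ball2 (of_rat (fst p)) (int (snd p)))" if "x \<in> U" for x
    proof -
      obtain e where e: "e > 0" "cball x e \<subseteq> U"
        using \<open>open U\<close> \<open>x \<in> U\<close> open_contains_cball by blast
      obtain m where m: "(2::real) powi (- int m) < e" using powi_small[OF e(1)] by blast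
      obtain r where r: "dist x (of_rat r) < 2 powi (- int m)"
        using of_rat_dense_q2[of "2 powi (- int m)" x] by auto
      have x: "x \<in> ball2 (of_rat r) (int m)" using r by (simp add: ball2_def dist_q2_def)
      have "ball2 (of_rat r) (int m) \<subseteq> ball2 x (int m)"
        by (rule ball2_mono[OF x]) (auto simp: ball2_def)
      also have "\<dots> \<subseteq> U" using e m by (auto simp: ball2_cball)
      finally show ?thesis using x by (intro UN_I[of "(r, m)"]) (simp_all add: I_def)
    qed
    moreover have "(\<Union>p\<in>I. ball2 (of_rat (fst p)) (int (snd p))) \<subseteq> U"
      by (rule UN_least) (simp add: I_def)
    ultimately have U: "U = (\<Union>p\<in>I. ball2 (of_rat (fst p)) (int (snd p)))" by blast
    have "countable ((\<lambda>p. ball2 (of_rat (fst p)) (int (snd p))) ` I)" by (intro countable_image countableI_type)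
    moreover have "ball2 c n \<in> sigma_sets UNIV balls2" for c n
      by (rule sigma_sets.Basic) (auto simp: balls2_def)
    ultimately show ?thesis
      by (subst U, intro sigma_sets_UNION) auto
  qed
  thus "sets (borel :: q2 measure) \<subseteq> sigma_sets UNIV balls2"
    unfolding borel_def by (subst sets_measure_of) (auto intro!: sigma_sets_mono)
qed

lemma q2_measure_eqI:
  fixes M N :: "q2 measure"
  assumes "sets M = sets borel" "sets N = sets borel"
    and "\<And>c n. emeasure M (ball2 c n) = emeasure N (ball2 c n)"
    and "\<And>c n. emeasure M (ball2 c n) \<noteq> \<infinity>"
  shows "M = N"
proof (rule measure_eqI_generator_eq_countable[of balls2 UNIV M N "range (\<lambda>r. ball2 (of_rat r) 0)"])
  show "\<Union> (range (\<lambda>r. ball2 (of_rat r) 0)) = UNIV"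
  proof -
    have "x \<in> \<Union> (range (\<lambda>r. ball2 (of_rat r) 0))" for x
      using of_rat_dense_q2[of 1 x] by (auto simp: ball2_def dist_q2_def intro: less_imp_le)
    thus ?thesis by blast
  qed
qed (use assms sets_borel_q2 Int_stable_balls2 in \<open>auto simp: balls2_def\<close>)


section \<open>Haar measure\<close>

text \<open>
  Existence and uniqueness of the normalized Haar measure are proved below, so the definite
  description \<open>haar\<close> denotes it (\<open>normalized_haar_haar\<close>).
\<close>

definition normalized_haar :: "q2 measure \<Rightarrow> bool" where
  "normalized_haar M \<longleftrightarrow> sets M = sets borel
     \<and> (\<forall>c. \<forall>A\<in>sets borel. emeasure M ((+) c ` A) = emeasure M A)
     \<and> emeasure M {x. norm2 x \<le> 1} = 1"

lemma ball2_translate: "ball2 c n = (+) c ` ball2 0 n"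
proof -
  have "x \<in> (+) c ` ball2 0 n" if "x \<in> ball2 c n" for x
    using that by (intro image_eqI[of _ _ "x - c"]) (auto simp: ball2_def)
  thus ?thesis by (auto simp: ball2_def)
qed

lemma ball2_borel [measurable, simp]: "ball2 c n \<in> sets borel"
  by (simp add: ball2_cball)

lemma ball2_split: "ball2 0 n = ball2 0 (n + 1) \<union> ball2 (2 powi n) (n + 1)"
  and ball2_split_disj: "ball2 0 (n + 1) \<inter> ball2 (2 powi n) (n + 1) = {}"
proof -
  have e: "- (n + 1) = - n - 1" by simp
  have lt: "(2::real) powi (- n - 1) < 2 powi (- n)" unfolding powi_minus_Suc by simp
  have "norm2 x \<le> 2 powi (- n)" if "norm2 (x - 2 powi n) \<le> 2 powi (- n - 1)" for x
    using that norm2_add[of "x - 2 powi n" "2 powi n"] lt by (simp add: norm2_power_int)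
  thus "ball2 0 n = ball2 0 (n + 1) \<union> ball2 (2 powi n) (n + 1)"
    using norm2_residue[of _ n] lt unfolding ball2_def e by (auto intro: order_trans[OF _ less_imp_le])
  have False if "norm2 x \<le> 2 powi (- n - 1)" "norm2 (x - 2 powi n) \<le> 2 powi (- n - 1)" for x
    using norm2_diff[of x "x - 2 powi n"] that lt by (simp add: norm2_power_int)
  thus "ball2 0 (n + 1) \<inter> ball2 (2 powi n) (n + 1) = {}"
    unfolding ball2_def e by auto
qed

lemma normalized_haar_ball2:
  assumes "normalized_haar M" shows "emeasure M (ball2 c n) = ennreal (2 powi (- n))"
proof -
  have sM: "sets M = sets borel" using assms by (simp add: normalized_haar_def)
  have tr: "emeasure M (ball2 c n) = emeasure M (ball2 0 n)" for c n
    unfolding ball2_translate[of c] using assms by (simp add: normalized_haar_def)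
  have dbl: "emeasure M (ball2 0 n) = 2 * emeasure M (ball2 0 (n + 1))" for n
  proof -
    have "emeasure M (ball2 0 n) = emeasure M (ball2 0 (n + 1)) + emeasure M (ball2 (2 powi n) (n + 1))"
      unfolding ball2_split[of n] by (rule plus_emeasure[symmetric]) (simp_all add: sM ball2_split_disj)
    thus ?thesis using tr[of "2 powi n" "n + 1"] by (simp only: mult_2)
  qed
  have h: "ennreal (2 powi (- n)) = 2 * ennreal (2 powi (- (n + 1)))" for n
  proof -
    have "- (n + 1) = - n - 1" by simp
    hence "(2::real) powi (- n) = 2 * 2 powi (- (n + 1))" using powi_minus_Suc[of n] by simp
    moreover have "ennreal (2 * 2 powi (- (n + 1))) = 2 * ennreal (2 powi (- (n + 1)))"
      by (subst ennreal_mult) simp_all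
    ultimately show ?thesis by metis
  qed
  have "emeasure M (ball2 0 n) = ennreal (2 powi (- n))"
  proof (induct n rule: int_induct[where k = 0])
    case base
    show ?case using assms by (simp add: normalized_haar_def ball2_def)
  next
    case (step1 i)
    hence "2 * emeasure M (ball2 0 (i + 1)) = 2 * ennreal (2 powi (- (i + 1)))"
      using dbl[of i] h[of i] by simp
    thus ?case by (simp add: ennreal_mult_cancel_left)
  next
    case (step2 i)
    thus ?case using dbl[of "i - 1"] h[of "i - 1"] by simp
  qed
  thus ?thesis using tr[of c n] by simp
qed

lemma normalized_haar_unique: "normalized_haar M \<Longrightarrow> normalized_haar N \<Longrightarrow> M = N"
  by (rule q2_measure_eqI) (auto simp: normalized_haar_ball2, auto simp: normalized_haar_def)

lemma normalized_haarI:
  assumes sM: "sets M = sets borel" and b: "\<And>c n. emeasure M (ball2 c n) = ennreal (2 powi (- n))"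
  shows "normalized_haar M"
  unfolding normalized_haar_def
proof (intro conjI allI ballI)
  show "sets M = sets borel" by (rule sM)
  have "ball2 0 0 = {x. norm2 x \<le> 1}" by (simp add: ball2_def)
  thus "emeasure M {x. norm2 x \<le> 1} = 1" using b[of 0 0] by simp
  fix c :: q2 and A :: "q2 set" assume A: "A \<in> sets borel"
  have "continuous_on UNIV (\<lambda>x. x - c)"
    unfolding continuous_on_iff by (auto simp: dist_q2_def)
  hence m [measurable]: "(\<lambda>x. x - c) \<in> borel_measurable M"
    using borel_measurable_continuous_onI sM by (metis measurable_cong_sets)
  have im: "(\<lambda>x. x - c) -` B = (+) c ` B" for B
  proof -
    have "x \<in> (+) c ` B" if "x - c \<in> B" for x
      using that by (intro image_eqI[of _ _ "x - c"]) auto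
    thus ?thesis by auto
  qed
  have sp: "space M = UNIV" using sets_eq_imp_space_eq[OF sM] by simp
  have em: "emeasure (distr M borel (\<lambda>x. x - c)) B = emeasure M ((+) c ` B)" if "B \<in> sets borel" for B
    using emeasure_distr[OF m that] by (simp add: im sp)
  have "distr M borel (\<lambda>x. x - c) = M"
  proof (rule q2_measure_eqI)
    fix d n
    have "(+) c ` ball2 d n = ball2 (c + d) n"
      unfolding ball2_translate[of d] ball2_translate[of "c + d"] by (simp add: image_image add.assoc)
    thus "emeasure (distr M borel (\<lambda>x. x - c)) (ball2 d n) = emeasure M (ball2 d n)"
      by (simp add: em b)
    show "emeasure (distr M borel (\<lambda>x. x - c)) (ball2 d n) \<noteq> \<infinity>"
      using \<open>(+) c ` ball2 d n = ball2 (c + d) n\<close> by (simp add: em b)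
    show "sets (distr M borel (\<lambda>x. x - c)) = sets borel" by simp
  qed (rule sM)
  thus "emeasure M ((+) c ` A) = emeasure M A" using em[OF A] by simp
qed

text \<open>
  For existence: reversing binary digits, \<open>\<Sum>b\<^sub>i 2\<^sup>-\<^sup>i\<^sup>-\<^sup>1 \<mapsto> \<Sum>b\<^sub>i 2\<^sup>i\<close>, maps the nonnegative
  reals to the 2-adic numbers, and the preimage of a ball of radius \<open>2\<^sup>-\<^sup>n\<close> is an interval of
  length \<open>2\<^sup>-\<^sup>n\<close>.  The image of Lebesgue measure is therefore the Haar measure.
\<close>

definition digit2 :: "int \<Rightarrow> real \<Rightarrow> int" where
  "digit2 i x = \<lfloor>2 powi (i + 1) * x\<rfloor> mod 2"

definition monna_seq :: "real \<Rightarrow> nat \<Rightarrow> rat" where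
  "monna_seq x m = (\<Sum>i\<in>{-int m..<int m}. of_int (digit2 i x) * 2 powi i)"

definition monna :: "real \<Rightarrow> q2" where
  "monna x = Q2 (monna_seq x)"

lemma of_rat_powi: "(of_rat (2 powi n) :: q2) = 2 powi n"
  by (cases n rule: int_cases2) (simp_all add: power_int_minus of_rat_inverse of_rat_power)

lemma abs2_power_int: "abs2 (2 powi n) = 2 powi (- n)"
  using norm2_of_rat[of "2 powi n"] norm2_power_int[of n] by (simp add: of_rat_powi)

lemma abs2_sum_le:
  assumes "finite A" "\<And>i. i \<in> A \<Longrightarrow> abs2 (f i) \<le> c" "c \<ge> 0"
  shows "abs2 (sum f A) \<le> c"
  using assms
proof (induct A)
  case (insert i A)
  have "abs2 (f i) \<le> c" "abs2 (sum f A) \<le> c" using insert by auto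
  moreover have "sum f (insert i A) = f i + sum f A" using insert by simp
  ultimately show ?case using abs2_add[of "f i" "sum f A"] by simp
qed simp

lemma digit2_01: "digit2 i x = 0 \<or> digit2 i x = 1"
  unfolding digit2_def by presburger

lemma floor_coarsen:
  assumes "i \<le> n"
  shows "\<lfloor>(2::real) powi i * x\<rfloor> = \<lfloor>(2::real) powi n * x\<rfloor> div 2 ^ nat (n - i)"
proof -
  have "(2::real) powi n = 2 powi i * 2 powi (n - i)" by (simp flip: power_int_add)
  also have "(2::real) powi (n - i) = of_int (2 ^ nat (n - i))" using assms by (simp add: power_int_def)
  finally have "(2::real) powi i * x = 2 powi n * x / of_int (2 ^ nat (n - i))" by simp
  thus ?thesis by (simp only: floor_divide_real_eq_div zero_le_power zero_le_numeral)
qed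

lemma digit2_cong:
  assumes "i < n" "\<lfloor>(2::real) powi n * x\<rfloor> = \<lfloor>2 powi n * y\<rfloor>"
  shows "digit2 i x = digit2 i y"
  unfolding digit2_def using floor_coarsen[of "i + 1" n x] floor_coarsen[of "i + 1" n y] assms by simp

lemma floor_refine: "\<lfloor>(2::real) powi (n + 1) * x\<rfloor> = 2 * \<lfloor>2 powi n * x\<rfloor> + digit2 n x"
  using floor_coarsen[of n "n + 1" x] unfolding digit2_def by simp

lemma floor_small: "0 \<le> x \<Longrightarrow> x < 2 ^ N \<Longrightarrow> \<lfloor>(2::real) powi (- int N) * x\<rfloor> = 0"
  by (simp add: floor_eq_iff power_int_minus field_simps)

lemma digit2_0 [simp]: "digit2 i 0 = 0"
  by (simp add: digit2_def)

lemma abs2_digit_term: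
  assumes "n \<le> i" "d \<in> {-1, 0, 1}" shows "abs2 (of_int d * 2 powi i) \<le> 2 powi (- n)"
proof -
  have "(2::real) powi (- i) \<le> 2 powi (- n)" using assms by (intro power_int_increasing) auto
  moreover have "0 \<le> (2::real) powi (- n)" by simp
  ultimately show ?thesis using assms(2) by (auto simp: abs2_power_int simp del: power_int_minus)
qed

lemma cauchy2_monna_seq:
  assumes "x \<ge> 0" shows "cauchy2 (monna_seq x)"
  unfolding cauchy2_def
proof (intro allI impI)
  fix e :: real assume "e > 0"
  then obtain M where M: "(2::real) powi (- int M) < e" using powi_small by blast
  obtain K where K: "x < 2 ^ K" using real_arch_pow[of 2 x] by auto
  have main: "abs2 (monna_seq x m - monna_seq x k) < e" if mk: "max M K \<le> k" "k \<le> m" for m k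
  proof -
    have "monna_seq x m - monna_seq x k = (\<Sum>i\<in>{-int m..<int m} - {-int k..<int k}. of_int (digit2 i x) * 2 powi i)"
      unfolding monna_seq_def using mk by (subst sum_diff) auto
    also have "abs2 \<dots> \<le> 2 powi (- int M)"
    proof (rule abs2_sum_le)
      fix i assume i: "i \<in> {-int m..<int m} - {-int k..<int k}"
      show "abs2 (of_int (digit2 i x) * 2 powi i) \<le> 2 powi (- int M)"
      proof (cases "i < - int k")
        case True
        have "i < - int K" using True mk by simp
        hence "digit2 i x = digit2 i 0"
          by (rule digit2_cong) (simp add: floor_small[OF assms K])
        thus ?thesis by simp
      next
        case False
        thus ?thesis using i mk digit2_01[of i x] by (intro abs2_digit_term) auto
      qed
    qed simp_all
    finally show ?thesis using M by linarith
  qed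
  have "abs2 (monna_seq x m - monna_seq x k) < e" if "m \<ge> max M K" "k \<ge> max M K" for m k
    using main[of k m] main[of m k] that abs2_diff_commute[of "monna_seq x m" "monna_seq x k"]
    by (cases "k \<le> m") auto
  thus "\<exists>N. \<forall>m\<ge>N. \<forall>n\<ge>N. abs2 (monna_seq x m - monna_seq x n) < e" by blast
qed

lemma norm2_Q2_le:
  assumes "cauchy2 X" "\<And>n. n \<ge> N \<Longrightarrow> abs2 (X n) \<le> c" shows "norm2 (Q2 X) \<le> c"
  using norm_Q2_LIMSEQ[OF assms(1)] by (rule LIMSEQ_le_const2) (use assms(2) in blast)

lemma monna_diff_shift:
  assumes xy: "x \<ge> 0" "y \<ge> 0" and fl: "\<lfloor>(2::real) powi n * x\<rfloor> = \<lfloor>2 powi n * y\<rfloor>"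
  shows "norm2 (monna y - monna x - of_int (digit2 n y - digit2 n x) * 2 powi n) \<le> 2 powi (- (n + 1))"
proof -
  note cx = cauchy2_monna_seq[OF xy(1)] and cy = cauchy2_monna_seq[OF xy(2)]
  let ?t = "of_int (digit2 n y - digit2 n x) * 2 powi n :: rat"
  have c1: "cauchy2 (\<lambda>m. monna_seq y m - monna_seq x m)"
    using cauchy2_add[OF cy cauchy2_minus[OF cx]] by simp
  have c2: "cauchy2 (\<lambda>m. monna_seq y m - monna_seq x m - ?t)"
    using cauchy2_add[OF c1 cauchy2_const[of "- ?t"]] by simp
  have "of_int (digit2 n y - digit2 n x) * 2 powi n = (of_rat ?t :: q2)"
    by (simp add: of_rat_mult of_rat_powi of_rat_diff)
  hence eq: "monna y - monna x - of_int (digit2 n y - digit2 n x) * 2 powi n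
      = Q2 (\<lambda>m. monna_seq y m - monna_seq x m - ?t)"
    unfolding monna_def by (simp only: of_rat_Q2 diff_Q2 cx cy c1 cauchy2_const)
  show ?thesis unfolding eq
  proof (rule norm2_Q2_le[OF c2, of "nat \<bar>n\<bar> + 1"])
    fix m assume m: "m \<ge> nat \<bar>n\<bar> + 1"
    have n: "n \<in> {-int m..<int m}" using m by auto
    have "monna_seq y m - monna_seq x m = (\<Sum>i\<in>{-int m..<int m}. of_int (digit2 i y - digit2 i x) * 2 powi i)"
      unfolding monna_seq_def by (simp add: sum_subtractf left_diff_distrib)
    also have "\<dots> = ?t + (\<Sum>i\<in>{-int m..<int m} - {n}. of_int (digit2 i y - digit2 i x) * 2 powi i)"
      using n by (subst sum.remove[of _ n]) auto
    finally have "monna_seq y m - monna_seq x m - ?t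
        = (\<Sum>i\<in>{-int m..<int m} - {n}. of_int (digit2 i y - digit2 i x) * 2 powi i)" by simp
    also have "abs2 \<dots> \<le> 2 powi (- (n + 1))"
    proof (rule abs2_sum_le)
      fix i assume i: "i \<in> {-int m..<int m} - {n}"
      show "abs2 (of_int (digit2 i y - digit2 i x) * 2 powi i) \<le> 2 powi (- (n + 1))"
      proof (cases "i < n")
        case True
        thus ?thesis using digit2_cong[OF True fl] by simp
      next
        case False
        thus ?thesis using i digit2_01[of i x] digit2_01[of i y] by (intro abs2_digit_term) auto
      qed
    qed simp_all
    finally show "abs2 (monna_seq y m - monna_seq x m - ?t) \<le> 2 powi (- (n + 1))" .
  qed
qed

lemma monna_0 [simp]: "monna 0 = 0"
  by (simp add: monna_def monna_seq_def[abs_def] zero_q2_def)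

lemma powi_lt_Suc: "(2::real) powi (- (n + 1)) < 2 powi (- n)"
  by (simp add: powi_less_iff)

lemma norm2_digit_le: "norm2 (of_int (digit2 n y - digit2 n x) * 2 powi n) \<le> 2 powi (- n)"
  using digit2_01[of n x] digit2_01[of n y] by (auto simp: norm2_power_int)

lemma monna_preimage_base:
  assumes x: "x \<ge> 0"
  shows "norm2 (monna x) \<le> 2 powi (int N) \<longleftrightarrow> \<lfloor>2 powi (- int N) * x\<rfloor> = 0"
proof (cases "x < 2 ^ N")
  case True
  have fl: "\<lfloor>2 powi (- int N) * x\<rfloor> = 0" using floor_small[OF x True] .
  have a: "norm2 (monna x - of_int (digit2 (- int N) x - 0) * 2 powi (- int N)) \<le> 2 powi (- (- int N + 1))"
    using monna_diff_shift[of 0 x "- int N"] x fl by simp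
  have b: "norm2 (of_int (digit2 (- int N) x - 0) * 2 powi (- int N)) \<le> 2 powi (int N)"
    using norm2_digit_le[of "- int N" x 0] by simp
  have c: "(2::real) powi (- (- int N + 1)) < 2 powi (int N)"
    using powi_lt_Suc[of "- int N"] by simp
  have "norm2 (monna x) \<le> 2 powi (int N)"
    using norm2_add[of "monna x - of_int (digit2 (- int N) x - 0) * 2 powi (- int N)"
        "of_int (digit2 (- int N) x - 0) * 2 powi (- int N)"] a b c
    unfolding diff_add_cancel by linarith
  thus ?thesis using fl by simp
next
  case False
  define M where "M = (LEAST m::nat. x < 2 ^ m)"
  have "\<exists>m::nat. x < 2 ^ m" using real_arch_pow[of 2 x] by auto
  hence M: "x < 2 ^ M" unfolding M_def by (rule LeastI_ex)
  have "\<not> M \<le> N"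
  proof
    assume "M \<le> N"
    hence "(2::real) ^ M \<le> 2 ^ N" by (intro power_increasing) auto
    thus False using M False by linarith
  qed
  hence NM: "N < M" by simp
  have "\<not> x < 2 ^ (M - 1)" using NM not_less_Least[of "M - 1" "\<lambda>m. x < 2 ^ m"] by (simp add: M_def)
  hence ge: "x \<ge> 2 ^ (M - 1)" by simp
  have p: "(2::real) ^ M = 2 * 2 ^ (M - 1)" using NM by (metis power_Suc Suc_pred' less_nat_zero_code neq0_conv)
  have "(2::real) powi (- int M + 1) = 1 / 2 ^ (M - 1)"
    by (simp only: powi_add_1) (simp add: power_int_minus p field_simps)
  hence "(2::real) powi (- int M + 1) * x = x / 2 ^ (M - 1)" by simp
  moreover have "\<lfloor>x / 2 ^ (M - 1)\<rfloor> = 1"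
    using ge M p by (simp add: floor_eq_iff field_simps)
  ultimately have "\<lfloor>(2::real) powi (- int M + 1) * x\<rfloor> = 1" by simp
  hence d: "digit2 (- int M) x = 1" by (simp add: digit2_def)
  have a: "norm2 (monna x - 2 powi (- int M)) \<le> 2 powi (- (- int M + 1))"
    using monna_diff_shift[of 0 x "- int M"] x floor_small[OF x M] d by simp
  have c: "(2::real) powi (- (- int M + 1)) < 2 powi (int M)"
    using powi_lt_Suc[of "- int M"] by simp
  have "norm2 (2 powi (- int M)) = 2 powi (int M)" by (simp only: norm2_power_int) simp
  hence "norm2 (monna x) = 2 powi (int M)"
    using norm2_eqI[of "2 powi (- int M)" "monna x"] a c
      norm2_minus_commute[of "2 powi (- int M)" "monna x"] by simp
  moreover have "(2::real) powi (int N) < 2 powi (int M)" unfolding powi_less_iff using NM by simp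
  ultimately have "\<not> norm2 (monna x) \<le> 2 powi (int N)" by linarith
  moreover have "\<lfloor>2 powi (- int N) * x\<rfloor> \<noteq> 0"
  proof
    assume "\<lfloor>2 powi (- int N) * x\<rfloor> = 0"
    hence "2 powi (- int N) * x < 1" by linarith
    thus False using False by (simp add: power_int_minus field_simps)
  qed
  ultimately show ?thesis by simp
qed

lemma monna_preimage_step:
  assumes k: "k \<ge> 0" and P: "\<forall>x\<ge>0. norm2 (monna x - c) \<le> 2 powi (- n) \<longleftrightarrow> \<lfloor>2 powi n * x\<rfloor> = k"
  shows "\<exists>k'\<ge>0. \<forall>x\<ge>0. norm2 (monna x - c) \<le> 2 powi (- (n + 1)) \<longleftrightarrow> \<lfloor>2 powi (n + 1) * x\<rfloor> = k'"
proof -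
  define x0 where "x0 = real_of_int k / 2 powi n"
  have x0: "x0 \<ge> 0" "2 powi n * x0 = k" using k by (simp_all add: x0_def)
  have d0: "digit2 n x0 = 0"
  proof -
    have "2 powi (n + 1) * x0 = of_int (2 * k)" using x0(2) by (simp add: powi_add_1)
    thus ?thesis by (simp only: digit2_def floor_of_int) simp
  qed
  have e: "- (n + 1) = - n - 1" by simp
  have "norm2 (monna x0 - c) \<le> 2 powi (- n)" using P x0 by simp
  hence "norm2 (c - monna x0) \<le> 2 powi (- n)" by (simp add: norm2_minus_commute)
  from norm2_residue[OF this] obtain b :: int
    where b: "b = 0 \<or> b = 1" "norm2 (c - monna x0 - of_int b * 2 powi n) \<le> 2 powi (- (n + 1))"
    unfolding e by (metis diff_zero mult_1 mult_zero_left of_int_0 of_int_1)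
  have "norm2 (monna x - c) \<le> 2 powi (- (n + 1)) \<longleftrightarrow> \<lfloor>2 powi (n + 1) * x\<rfloor> = 2 * k + b" if x: "x \<ge> 0" for x
  proof (cases "\<lfloor>2 powi n * x\<rfloor> = k")
    case False
    have "\<not> norm2 (monna x - c) \<le> 2 powi (- (n + 1))" using P x False powi_lt_Suc[of n] by force
    moreover have "\<lfloor>2 powi (n + 1) * x\<rfloor> \<noteq> 2 * k + b"
      unfolding floor_refine using False b(1) digit2_01[of n x] by presburger
    ultimately show ?thesis by simp
  next
    case True
    define d where "d = digit2 n x"
    have d: "d = 0 \<or> d = 1" unfolding d_def by (rule digit2_01)
    have "\<lfloor>2 powi n * x0\<rfloor> = \<lfloor>2 powi n * x\<rfloor>" using True x0 by simp
    from monna_diff_shift[OF x0(1) x this]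
    have s: "norm2 (monna x - monna x0 - of_int d * 2 powi n) \<le> 2 powi (- (n + 1))"
      by (simp add: d0 d_def)
    define u where "u = monna x - monna x0 - of_int d * 2 powi n"
    define v where "v = c - monna x0 - of_int b * 2 powi n"
    have uv: "monna x - c = (u - v) + of_int (d - b) * 2 powi n"
      by (simp add: u_def v_def algebra_simps)
    have nuv: "norm2 (u - v) \<le> 2 powi (- (n + 1))"
      using norm2_diff[of u v] s b(2) unfolding u_def v_def by linarith
    have "norm2 (monna x - c) \<le> 2 powi (- (n + 1)) \<longleftrightarrow> d = b"
    proof
      assume "d = b" thus "norm2 (monna x - c) \<le> 2 powi (- (n + 1))" using uv nuv by simp
    next
      assume "norm2 (monna x - c) \<le> 2 powi (- (n + 1))"
      hence l: "norm2 (of_int (d - b) * 2 powi n) \<le> 2 powi (- (n + 1))"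
        using norm2_diff[of "monna x - c" "u - v"] nuv uv by simp
      show "d = b"
      proof (rule ccontr)
        assume "d \<noteq> b"
        hence "d - b = 1 \<or> d - b = - 1" using d b(1) by auto
        hence "norm2 (of_int (d - b) * 2 powi n) = 2 powi (- n)"
          by (elim disjE) (simp_all only: of_int_1 of_int_minus mult_1 mult_minus_left norm2_minus norm2_power_int)
        thus False using l powi_lt_Suc[of n] by linarith
      qed
    qed
    thus ?thesis unfolding floor_refine True d_def[symmetric] by simp
  qed
  thus ?thesis using k b(1) by (intro exI[of _ "2 * k + b"]) auto
qed

lemma monna_preimage:
  "\<exists>k\<ge>0. \<forall>x\<ge>0. monna x \<in> ball2 c n \<longleftrightarrow> \<lfloor>2 powi n * x\<rfloor> = k"
proof -
  obtain N where N1: "norm2 c < 2 ^ N" using real_arch_pow[of 2 "norm2 c"] by auto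
  define K where "K = max N (nat (- n))"
  have "(2::real) ^ N \<le> 2 ^ K" by (intro power_increasing) (auto simp: K_def)
  hence N: "norm2 c \<le> 2 powi (int K)" unfolding power_int_of_nat using N1 by linarith
  have le: "- int K \<le> n" by (simp add: K_def)
  have "\<exists>k\<ge>0. \<forall>x\<ge>0. norm2 (monna x - c) \<le> 2 powi (- n) \<longleftrightarrow> \<lfloor>2 powi n * x\<rfloor> = k"
    using le
  proof (induct n rule: int_ge_induct)
    case base
    have "norm2 (monna x - c) \<le> 2 powi (int K) \<longleftrightarrow> norm2 (monna x) \<le> 2 powi (int K)" for x
      using norm2_add[of "monna x - c" c] norm2_diff[of "monna x" c] N by auto
    thus ?case using monna_preimage_base by (intro exI[of _ 0]) (simp del: power_int_of_nat)
  next
    case (step i)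
    then obtain k where "k \<ge> 0" "\<forall>x\<ge>0. norm2 (monna x - c) \<le> 2 powi (- i) \<longleftrightarrow> \<lfloor>2 powi i * x\<rfloor> = k" by blast
    thus ?case by (rule monna_preimage_step)
  qed
  thus ?thesis by (simp add: ball2_def)
qed

definition haar_model :: "q2 measure" where
  "haar_model = distr (restrict_space lborel {0..}) borel monna"

lemma monna_vimage_ball2:
  "\<exists>k\<ge>0. monna -` ball2 c n \<inter> {0..} = {real_of_int k / 2 powi n ..< (real_of_int k + 1) / 2 powi n}"
proof -
  obtain k where k: "k \<ge> 0" "\<forall>x\<ge>0. monna x \<in> ball2 c n \<longleftrightarrow> \<lfloor>2 powi n * x\<rfloor> = k"
    using monna_preimage by blast
  have p: "(2::real) powi n > 0" by simp
  have fl: "\<lfloor>2 powi n * x\<rfloor> = k \<longleftrightarrow> x \<in> {real_of_int k / 2 powi n ..< (real_of_int k + 1) / 2 powi n}" for x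
    using p by (simp add: floor_eq_iff pos_divide_le_eq pos_less_divide_eq mult.commute)
  have "x \<ge> 0" if "x \<in> {real_of_int k / 2 powi n ..< (real_of_int k + 1) / 2 powi n}" for x
  proof -
    have "0 \<le> real_of_int k / 2 powi n" using k(1) by simp
    thus ?thesis using that by simp
  qed
  hence "monna -` ball2 c n \<inter> {0..} = {real_of_int k / 2 powi n ..< (real_of_int k + 1) / 2 powi n}"
    using k(2) fl by blast
  thus ?thesis using k(1) by blast
qed

lemma monna_measurable: "monna \<in> measurable (restrict_space lborel {0..}) borel"
proof (rule measurable_sigma_sets[OF sets_borel_q2])
  fix A assume "A \<in> balls2"
  hence "A = {} \<or> (\<exists>c n. A = ball2 c n)" by (auto simp: balls2_def)
  thus "monna -` A \<inter> space (restrict_space lborel {0..}) \<in> sets (restrict_space lborel {0..})"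
  proof (elim disjE exE)
    fix c n assume A: "A = ball2 c n"
    obtain k where "k \<ge> 0" and k: "monna -` ball2 c n \<inter> {0..} =
        {real_of_int k / 2 powi n ..< (real_of_int k + 1) / 2 powi n}"
      using monna_vimage_ball2 by blast
    have "monna -` A \<inter> {0..} \<in> sets lborel" unfolding A k by simp
    thus ?thesis by (subst sets_restrict_space_iff) (auto simp: space_restrict_space)
  qed simp
qed auto

lemma haar_model_ball2: "emeasure haar_model (ball2 c n) = ennreal (2 powi (- n))"
proof -
  obtain k where "k \<ge> 0" and k: "monna -` ball2 c n \<inter> {0..} =
      {real_of_int k / 2 powi n ..< (real_of_int k + 1) / 2 powi n}"
    using monna_vimage_ball2 by blast
  have "emeasure haar_model (ball2 c n) = emeasure (restrict_space lborel {0..}) (monna -` ball2 c n \<inter> {0..})"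
    unfolding haar_model_def by (subst emeasure_distr[OF monna_measurable]) (auto simp: space_restrict_space)
  also have "\<dots> = emeasure lborel (monna -` ball2 c n \<inter> {0..})"
    by (subst emeasure_restrict_space) auto
  also have "\<dots> = ennreal ((real_of_int k + 1) / 2 powi n - real_of_int k / 2 powi n)"
    unfolding k by (rule emeasure_lborel_Ico) (simp add: divide_right_mono)
  also have "(real_of_int k + 1) / 2 powi n - real_of_int k / 2 powi n = 2 powi (- n)"
    by (simp add: add_divide_distrib power_int_minus inverse_eq_divide)
  finally show ?thesis .
qed

lemma normalized_haar_exists: "normalized_haar haar_model"
  by (rule normalized_haarI) (simp_all add: haar_model_ball2, simp add: haar_model_def)

definition haar :: "q2 measure" where
  "haar = (THE M. normalized_haar M)"

lemma normalized_haar_haar: "normalized_haar haar"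
  unfolding haar_def using normalized_haar_exists normalized_haar_unique by (blast intro: theI)


section \<open>Square-integrable functions\<close>

text \<open>
  Elements of \<open>L\<^sup>2\<close> are handled through their representatives: \<open>L2 M\<close> is the space of
  square-integrable functions, with the seminorm \<open>l2_norm M\<close>.  A set that is closed for this
  seminorm contains, with a function, every function in \<open>L2 M\<close> that agrees with it almost
  everywhere, so the closed subspaces below correspond exactly to the closed subspaces of the
  quotient by almost everywhere equality.
\<close>

definition L2 :: "'a measure \<Rightarrow> ('a \<Rightarrow> complex) set" where
  "L2 M = {f \<in> borel_measurable M. integrable M (\<lambda>x. (cmod (f x))\<^sup>2)}"

definition l2_inner :: "'a measure \<Rightarrow> ('a \<Rightarrow> complex) \<Rightarrow> ('a \<Rightarrow> complex) \<Rightarrow> complex" where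
  "l2_inner M f g = (LINT x|M. f x * cnj (g x))"

definition l2_norm :: "'a measure \<Rightarrow> ('a \<Rightarrow> complex) \<Rightarrow> real" where
  "l2_norm M f = sqrt (LINT x|M. (cmod (f x))\<^sup>2)"

definition l2_closure :: "'a measure \<Rightarrow> ('a \<Rightarrow> complex) set \<Rightarrow> ('a \<Rightarrow> complex) set" where
  "l2_closure M S = {f \<in> L2 M. \<forall>e>0. \<exists>g\<in>S. l2_norm M (\<lambda>x. f x - g x) < e}"

definition complex_span :: "('a \<Rightarrow> complex) set \<Rightarrow> ('a \<Rightarrow> complex) set" where
  "complex_span S = {\<lambda>x. \<Sum>g\<in>F. c g * g x | F c. finite F \<and> F \<subseteq> S}"

definition closed_l2_subspace :: "'a measure \<Rightarrow> ('a \<Rightarrow> complex) set \<Rightarrow> bool" where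
  "closed_l2_subspace M V \<longleftrightarrow>
     V \<subseteq> L2 M \<and> (\<lambda>x. 0) \<in> V
     \<and> (\<forall>f\<in>V. \<forall>g\<in>V. (\<lambda>x. f x + g x) \<in> V)
     \<and> (\<forall>c. \<forall>f\<in>V. (\<lambda>x. c * f x) \<in> V)
     \<and> l2_closure M V \<subseteq> V"

definition l2_frame :: "'a measure \<Rightarrow> 'i set \<Rightarrow> ('i \<Rightarrow> 'a \<Rightarrow> complex) \<Rightarrow> bool" where
  "l2_frame M I F \<longleftrightarrow>
     countable I \<and> (\<forall>n\<in>I. F n \<in> L2 M)
     \<and> (\<exists>A>0. \<exists>B>0. \<forall>f\<in>L2 M.
          (\<lambda>n. (cmod (l2_inner M f (F n)))\<^sup>2) summable_on I
          \<and> A * (l2_norm M f)\<^sup>2 \<le> (\<Sum>\<^sub>\<infinity>n\<in>I. (cmod (l2_inner M f (F n)))\<^sup>2)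
          \<and> (\<Sum>\<^sub>\<infinity>n\<in>I. (cmod (l2_inner M f (F n)))\<^sup>2) \<le> B * (l2_norm M f)\<^sup>2)"


section \<open>Multiresolution analyses and wavelets on the 2-adic numbers\<close>

definition shifts2 :: "q2 set" where
  "shifts2 = {2 powi (- int \<gamma>) * (\<Sum>i<\<gamma>. of_nat (a i) * 2 ^ i) | \<gamma> (a :: nat \<Rightarrow> nat). \<forall>i. a i \<in> {0, 1}}"

definition shift_space :: "(q2 \<Rightarrow> complex) \<Rightarrow> (q2 \<Rightarrow> complex) set" where
  "shift_space \<phi> = l2_closure haar (complex_span {\<lambda>x. \<phi> (x - a) | a. a \<in> shifts2})"

definition mra :: "(int \<Rightarrow> (q2 \<Rightarrow> complex) set) \<Rightarrow> bool" where
  "mra V \<longleftrightarrow>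
     (\<forall>j. closed_l2_subspace haar (V j))
     \<and> (\<forall>j. V j \<subseteq> V (j + 1))
     \<and> l2_closure haar (\<Union>j. V j) = L2 haar
     \<and> (\<Inter>j. V j) = {f \<in> L2 haar. AE x in haar. f x = 0}
     \<and> (\<forall>j. \<forall>f\<in>L2 haar. f \<in> V j \<longleftrightarrow> (\<lambda>x. f (2 powi (-1) * x)) \<in> V (j + 1))
     \<and> (\<exists>\<phi>\<in>V 0. V 0 = shift_space \<phi>)"

definition wavelet_space :: "(int \<Rightarrow> (q2 \<Rightarrow> complex) set) \<Rightarrow> int \<Rightarrow> (q2 \<Rightarrow> complex) set" where
  "wavelet_space V j = {f \<in> V (j + 1). \<forall>g\<in>V j. l2_inner haar f g = 0}"

definition wavelet_function :: "(int \<Rightarrow> (q2 \<Rightarrow> complex) set) \<Rightarrow> (q2 \<Rightarrow> complex) \<Rightarrow> bool" where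
  "wavelet_function V \<psi> \<longleftrightarrow> \<psi> \<in> L2 haar \<and> wavelet_space V 0 = shift_space \<psi>"

text \<open>An element of \<open>L\<^sup>2\<close> is compactly supported if it vanishes almost everywhere off a compact set.\<close>

definition compactly_supported :: "(q2 \<Rightarrow> complex) \<Rightarrow> bool" where
  "compactly_supported f \<longleftrightarrow> (\<exists>K. compact K \<and> (AE x in haar. x \<notin> K \<longrightarrow> f x = 0))"

text \<open>Dilation by \<open>2\<^sup>-\<^sup>j\<close> is taken in the field of 2-adic numbers, the factor \<open>2 powr (j / 2)\<close> is real.\<close>

definition wavelet_system :: "(q2 \<Rightarrow> complex) \<Rightarrow> q2 \<times> int \<Rightarrow> q2 \<Rightarrow> complex" where
  "wavelet_system \<psi> = (\<lambda>(a, j) x. complex_of_real (2 powr (of_int j / 2)) * \<psi> (2 powi (- j) * x - a))"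

end

theory Submission
  imports Defs
begin

text \<open>
  Write \<open>\<psi>\<^sub>a\<close> for the translate \<open>x \<mapsto> \<psi> (x - a)\<close> and \<open>B\<close> for a ball of radius \<open>2 ^ M\<close> around 0 that
  carries \<open>\<psi>\<close>.  The shifts are the fractions \<open>k / 2 ^ n\<close> with \<open>0 \<le> k < 2 ^ n\<close>.  Cutting the binary
  expansion of such a fraction after its \<open>M\<close> leading digits writes it as \<open>a + b\<close> with
  \<open>a \<in> {l / 2 ^ M | l < 2 ^ M}\<close>, a point of \<open>B\<close>, while different values of \<open>b\<close> lie in different cosets
  of \<open>B\<close> and all cosets occur.  Therefore the translates \<open>\<psi>\<^bsub>a+b\<^esub>\<close> with a fixed \<open>b\<close> live on \<open>b + B\<close>, and
  they are copies of one and the same finite family \<open>(\<psi>\<^sub>a)\<close>.  The space \<open>W\<^sub>0\<close> which all translates span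
  splits into mutually orthogonal copies of a finite-dimensional space, and the spanning family of each
  copy is the same up to translation.

  A finite family is a frame of its span.  Since the copies are isometric, the two frame constants are
  common to all cosets, and adding over the cosets gives the frame inequality on \<open>W\<^sub>0\<close>
  (\<open>shift_space_frame_inequality\<close>).  The unitary dilations carry \<open>W\<^sub>0\<close> to \<open>W\<^sub>j\<close> and \<open>\<psi>\<^sub>a\<close> to the members of
  the wavelet system of scale \<open>j\<close>, so the same constants serve every scale.

  It remains to add over the scales.  Let \<open>p\<^sub>j\<close> be the orthogonal projection of \<open>f\<close> to \<open>V\<^sub>j\<close>.  Only the
  component \<open>p\<^bsub>j+1\<^esub> - p\<^sub>j \<in> W\<^sub>j\<close> of \<open>f\<close> is seen by the wavelets of scale \<open>j\<close>, and the squared norms of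
  these components telescope to \<open>\<parallel>p\<^sub>n\<parallel>\<^sup>2 - \<parallel>p\<^bsub>-n\<^esub>\<parallel>\<^sup>2\<close>.  This tends to \<open>\<parallel>f\<parallel>\<^sup>2\<close>: density of the union of the \<open>V\<^sub>j\<close>
  gives the limit of the first term (\<open>mra_projection_LIMSEQ\<close>), triviality of their intersection that of
  the second (\<open>mra_projection_LIMSEQ_0\<close>).  The projections, and the limit of the \<open>p\<^bsub>-n\<^esub>\<close>, exist because \<open>L\<^sup>2\<close>
  is complete (\<open>L2_complete\<close>, \<open>l2_projection_exists\<close>).
\<close>

section \<open>Square-integrable functions as a complex semi-inner product space\<close>

lemma L2_measurable: "f \<in> L2 M \<Longrightarrow> f \<in> borel_measurable M"
  by (simp add: L2_def)

lemma L2_integrable: "f \<in> L2 M \<Longrightarrow> integrable M (\<lambda>x. (cmod (f x))\<^sup>2)"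
  by (simp add: L2_def)

lemma L2_zero [simp]: "(\<lambda>x. 0) \<in> L2 M"
  by (simp add: L2_def)

lemma L2_cmult [simp]: "f \<in> L2 M \<Longrightarrow> (\<lambda>x. c * f x) \<in> L2 M"
  by (auto simp: L2_def norm_mult power_mult_distrib)

lemma L2_add [simp]:
  assumes "f \<in> L2 M" "g \<in> L2 M" shows "(\<lambda>x. f x + g x) \<in> L2 M"
proof -
  have [measurable]: "f \<in> borel_measurable M" "g \<in> borel_measurable M"
    using assms by (auto dest: L2_measurable)
  have "integrable M (\<lambda>x. 2 * (cmod (f x))\<^sup>2 + 2 * (cmod (g x))\<^sup>2)"
    using assms by (intro Bochner_Integration.integrable_add integrable_mult_right L2_integrable)
  then have "integrable M (\<lambda>x. (cmod (f x + g x))\<^sup>2)"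
  proof (rule Bochner_Integration.integrable_bound)
    show "AE x in M. norm ((cmod (f x + g x))\<^sup>2) \<le> norm (2 * (cmod (f x))\<^sup>2 + 2 * (cmod (g x))\<^sup>2)"
    proof (rule AE_I2)
      fix x
      have "(cmod (f x + g x))\<^sup>2 \<le> (cmod (f x) + cmod (g x))\<^sup>2"
        by (intro power_mono norm_triangle_ineq) auto
      also have "\<dots> \<le> 2 * (cmod (f x))\<^sup>2 + 2 * (cmod (g x))\<^sup>2"
        using sum_squares_bound[of "cmod (f x)" "cmod (g x)"] by (simp add: power2_sum)
      finally show "norm ((cmod (f x + g x))\<^sup>2) \<le> norm (2 * (cmod (f x))\<^sup>2 + 2 * (cmod (g x))\<^sup>2)"
        by simp
    qed
  qed simp
  then show ?thesis by (simp add: L2_def)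
qed

lemma L2_diff [simp]: "f \<in> L2 M \<Longrightarrow> g \<in> L2 M \<Longrightarrow> (\<lambda>x. f x - g x) \<in> L2 M"
  using L2_add[of f M "\<lambda>x. (-1) * g x"] L2_cmult[of g M "-1"] by simp

lemma L2_sum [simp]: "(\<And>i. i \<in> I \<Longrightarrow> f i \<in> L2 M) \<Longrightarrow> (\<lambda>x. \<Sum>i\<in>I. f i x) \<in> L2 M"
  by (induct I rule: infinite_finite_induct) auto

lemma L2_mult_indicator [simp]:
  assumes "f \<in> L2 M" "A \<in> sets M" shows "(\<lambda>x. f x * indicator A x) \<in> L2 M"
proof -
  have "integrable M (\<lambda>x. (cmod (f x))\<^sup>2 * indicator A x)"
    using assms L2_integrable by (intro integrable_real_mult_indicator)
  moreover have "(\<lambda>x. (cmod (f x))\<^sup>2 * indicator A x) = (\<lambda>x. (cmod (f x * indicator A x))\<^sup>2)"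
    by (auto simp: fun_eq_iff indicator_def)
  moreover have "(\<lambda>x. f x * indicator A x) \<in> borel_measurable M"
    using assms L2_measurable by (intro borel_measurable_times borel_measurable_indicator) auto
  ultimately show ?thesis by (simp add: L2_def)
qed

lemma L2_integrable_mult:
  assumes "f \<in> L2 M" "g \<in> L2 M" shows "integrable M (\<lambda>x. f x * cnj (g x))"
proof -
  have [measurable]: "f \<in> borel_measurable M" "g \<in> borel_measurable M"
    using assms by (auto dest: L2_measurable)
  have m: "(\<lambda>x. cnj (g x)) \<in> borel_measurable M"
    by (rule borel_measurable_continuous_onI[THEN measurable_compose[of g M borel, rotated]])
      (auto intro!: continuous_intros)
  have "integrable M (\<lambda>x. (cmod (f x))\<^sup>2 + (cmod (g x))\<^sup>2)"
    using assms by (intro Bochner_Integration.integrable_add L2_integrable)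
  then show ?thesis
  proof (rule Bochner_Integration.integrable_bound)
    show "(\<lambda>x. f x * cnj (g x)) \<in> borel_measurable M" using m by measurable
    have "cmod (f x) * cmod (g x) \<le> (cmod (f x))\<^sup>2 + (cmod (g x))\<^sup>2" for x
      using sum_squares_bound[of "cmod (f x)" "cmod (g x)"] 
        mult_nonneg_nonneg[of "cmod (f x)" "cmod (g x)"] by (simp del: mult_nonneg_nonneg zero_le_mult_iff)
    then show "AE x in M. norm (f x * cnj (g x)) \<le> norm ((cmod (f x))\<^sup>2 + (cmod (g x))\<^sup>2)"
      by (simp add: norm_mult)
  qed
qed

lemma l2_inner_cnj: "l2_inner M g f = cnj (l2_inner M f g)"
  using Bochner_Integration.integral_cnj[of M "\<lambda>x. f x * cnj (g x)"]
  unfolding l2_inner_def by (simp add: mult.commute)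

lemma l2_inner_add_left:
  "f \<in> L2 M \<Longrightarrow> g \<in> L2 M \<Longrightarrow> h \<in> L2 M \<Longrightarrow>
    l2_inner M (\<lambda>x. f x + g x) h = l2_inner M f h + l2_inner M g h"
  by (simp add: l2_inner_def distrib_right L2_integrable_mult)

lemma l2_inner_diff_left:
  "f \<in> L2 M \<Longrightarrow> g \<in> L2 M \<Longrightarrow> h \<in> L2 M \<Longrightarrow>
    l2_inner M (\<lambda>x. f x - g x) h = l2_inner M f h - l2_inner M g h"
  by (simp add: l2_inner_def left_diff_distrib L2_integrable_mult)

lemma l2_inner_cmult_left: "l2_inner M (\<lambda>x. c * f x) h = c * l2_inner M f h"
  by (simp add: l2_inner_def mult.assoc)

lemma l2_inner_sum_left:
  assumes "\<And>i. i \<in> I \<Longrightarrow> f i \<in> L2 M" "h \<in> L2 M"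
  shows "l2_inner M (\<lambda>x. \<Sum>i\<in>I. f i x) h = (\<Sum>i\<in>I. l2_inner M (f i) h)"
  unfolding l2_inner_def sum_distrib_right
  by (rule Bochner_Integration.integral_sum) (use assms in \<open>auto intro: L2_integrable_mult\<close>)

lemma l2_inner_add_right:
  "f \<in> L2 M \<Longrightarrow> g \<in> L2 M \<Longrightarrow> h \<in> L2 M \<Longrightarrow>
    l2_inner M h (\<lambda>x. f x + g x) = l2_inner M h f + l2_inner M h g"
  using l2_inner_add_left[of f M g h] by (simp add: l2_inner_cnj[of M h])

lemma l2_inner_diff_right:
  "f \<in> L2 M \<Longrightarrow> g \<in> L2 M \<Longrightarrow> h \<in> L2 M \<Longrightarrow>
    l2_inner M h (\<lambda>x. f x - g x) = l2_inner M h f - l2_inner M h g"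
  using l2_inner_diff_left[of f M g h] by (simp add: l2_inner_cnj[of M h])

lemma l2_inner_cmult_right: "l2_inner M h (\<lambda>x. c * f x) = cnj c * l2_inner M h f"
  using l2_inner_cmult_left[of M c f h] by (simp add: l2_inner_cnj[of M h])

lemma l2_inner_sum_right:
  assumes "\<And>i. i \<in> I \<Longrightarrow> f i \<in> L2 M" "h \<in> L2 M"
  shows "l2_inner M h (\<lambda>x. \<Sum>i\<in>I. f i x) = (\<Sum>i\<in>I. l2_inner M h (f i))"
  using l2_inner_sum_left[of I f M h] assms by (simp add: l2_inner_cnj[of M h])

lemma l2_norm_nonneg [simp]: "l2_norm M f \<ge> 0"
  by (simp add: l2_norm_def)

lemma l2_norm_power2: "(l2_norm M f)\<^sup>2 = (LINT x|M. (cmod (f x))\<^sup>2)"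
  by (simp add: l2_norm_def)

lemma l2_inner_self: "l2_inner M f f = of_real ((l2_norm M f)\<^sup>2)"
proof -
  have "(\<lambda>x. f x * cnj (f x)) = (\<lambda>x. of_real ((cmod (f x))\<^sup>2))"
    by (simp only: complex_norm_square)
  then show ?thesis
    unfolding l2_inner_def l2_norm_power2 by (simp only: integral_complex_of_real)
qed

lemma l2_norm_cmult: "l2_norm M (\<lambda>x. c * f x) = cmod c * l2_norm M f"
  by (simp add: l2_norm_def norm_mult power_mult_distrib real_sqrt_mult)

lemma l2_norm_diff_commute: "l2_norm M (\<lambda>x. f x - g x) = l2_norm M (\<lambda>x. g x - f x)"
  by (simp add: l2_norm_def norm_minus_commute)

lemma l2_norm_add_power2:
  assumes "f \<in> L2 M" "g \<in> L2 M"
  shows "(l2_norm M (\<lambda>x. f x + g x))\<^sup>2 = (l2_norm M f)\<^sup>2 + 2 * Re (l2_inner M f g) + (l2_norm M g)\<^sup>2"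
proof -
  have "complex_of_real ((l2_norm M (\<lambda>x. f x + g x))\<^sup>2) =
      of_real ((l2_norm M f)\<^sup>2) + (l2_inner M f g + cnj (l2_inner M f g)) + of_real ((l2_norm M g)\<^sup>2)"
    unfolding l2_inner_self[symmetric] using assms
    by (simp add: l2_inner_add_left l2_inner_add_right l2_inner_cnj[of M g f])
  from arg_cong[OF this, of Re] show ?thesis by simp
qed

lemma l2_norm_diff_power2:
  assumes "f \<in> L2 M" "g \<in> L2 M"
  shows "(l2_norm M (\<lambda>x. f x - g x))\<^sup>2 = (l2_norm M f)\<^sup>2 - 2 * Re (l2_inner M f g) + (l2_norm M g)\<^sup>2"
  using l2_norm_add_power2[of f M "\<lambda>x. (-1) * g x"] assms L2_cmult[of g M "-1"]
  by (simp add: l2_inner_cmult_right[of M f "-1" g, simplified] l2_norm_cmult[of M "-1" g, simplified])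

lemma l2_pythagoras:
  assumes "f \<in> L2 M" "g \<in> L2 M" "l2_inner M f g = 0"
  shows "(l2_norm M (\<lambda>x. f x + g x))\<^sup>2 = (l2_norm M f)\<^sup>2 + (l2_norm M g)\<^sup>2"
  using l2_norm_add_power2[OF assms(1,2)] assms(3) by simp

lemma l2_norm_eq_0_iff:
  assumes "f \<in> L2 M" shows "l2_norm M f = 0 \<longleftrightarrow> (AE x in M. f x = 0)"
  unfolding l2_norm_def using integral_nonneg_eq_0_iff_AE[OF L2_integrable[OF assms]] by simp

lemma l2_inner_eq_0:
  assumes "g \<in> L2 M" "l2_norm M g = 0" shows "l2_inner M f g = 0"
proof -
  have "AE x in M. g x = 0" using assms l2_norm_eq_0_iff by blast
  then have "AE x in M. f x * cnj (g x) = 0" by eventually_elim simp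
  then show ?thesis unfolding l2_inner_def by (rule integral_eq_zero_AE)
qed

lemma l2_Cauchy_Schwarz:
  assumes "f \<in> L2 M" "g \<in> L2 M"
  shows "cmod (l2_inner M f g) \<le> l2_norm M f * l2_norm M g"
proof (cases "l2_norm M g = 0")
  case True
  then show ?thesis using assms l2_inner_eq_0 by simp
next
  case False
  define n where "n = l2_norm M g"
  have n: "n > 0" using False l2_norm_nonneg[of M g] by (simp add: n_def less_le)
  define c where "c = l2_inner M f g / of_real (n\<^sup>2)"
  have "l2_inner M f (\<lambda>x. c * g x) = of_real ((cmod (l2_inner M f g))\<^sup>2 / n\<^sup>2)"
    unfolding l2_inner_cmult_right c_def
    by (simp add: mult.commute complex_norm_square del: of_real_power)
  moreover have "(l2_norm M (\<lambda>x. c * g x))\<^sup>2 = (cmod (l2_inner M f g))\<^sup>2 / n\<^sup>2"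
    using n unfolding l2_norm_cmult c_def n_def[symmetric]
    by (simp add: norm_divide norm_power power_mult_distrib power_divide) (simp add: field_simps power2_eq_square power4_eq_xxxx)
  ultimately have "(l2_norm M (\<lambda>x. f x - c * g x))\<^sup>2 = (l2_norm M f)\<^sup>2 - (cmod (l2_inner M f g))\<^sup>2 / n\<^sup>2"
    using l2_norm_diff_power2[of f M "\<lambda>x. c * g x"] assms by simp
  then have "(cmod (l2_inner M f g))\<^sup>2 / n\<^sup>2 \<le> (l2_norm M f)\<^sup>2"
    using zero_le_power2[of "l2_norm M (\<lambda>x. f x - c * g x)"] by linarith
  then have "(cmod (l2_inner M f g))\<^sup>2 \<le> (l2_norm M f * n)\<^sup>2"
    using n by (simp add: divide_le_eq power_mult_distrib)
  then show ?thesis unfolding n_def by (rule power2_le_imp_le) simp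
qed

lemma l2_norm_triangle:
  assumes "f \<in> L2 M" "g \<in> L2 M"
  shows "l2_norm M (\<lambda>x. f x + g x) \<le> l2_norm M f + l2_norm M g"
proof (rule power2_le_imp_le)
  have "Re (l2_inner M f g) \<le> l2_norm M f * l2_norm M g"
    using l2_Cauchy_Schwarz[OF assms] complex_Re_le_cmod[of "l2_inner M f g"] by linarith
  then show "(l2_norm M (\<lambda>x. f x + g x))\<^sup>2 \<le> (l2_norm M f + l2_norm M g)\<^sup>2"
    unfolding l2_norm_add_power2[OF assms] power2_sum by simp
qed simp

lemma l2_norm_triangle_diff:
  assumes "f \<in> L2 M" "g \<in> L2 M" "h \<in> L2 M"
  shows "l2_norm M (\<lambda>x. f x - h x) \<le> l2_norm M (\<lambda>x. f x - g x) + l2_norm M (\<lambda>x. g x - h x)"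
  using l2_norm_triangle[of "\<lambda>x. f x - g x" M "\<lambda>x. g x - h x"] assms by simp

section \<open>Completeness and orthogonal projections\<close>

lemma l2_nn_integral:
  assumes "f \<in> L2 M" shows "(\<integral>\<^sup>+x. ennreal ((cmod (f x))\<^sup>2) \<partial>M) = ennreal ((l2_norm M f)\<^sup>2)"
  unfolding l2_norm_power2 by (rule nn_integral_eq_integral[OF L2_integrable[OF assms]]) simp

lemma L2_if_nn_integral_le:
  assumes [measurable]: "f \<in> borel_measurable M" and le: "(\<integral>\<^sup>+x. ennreal ((cmod (f x))\<^sup>2) \<partial>M) \<le> ennreal (e\<^sup>2)"
    and "e \<ge> 0"
  shows "f \<in> L2 M" "l2_norm M f \<le> e"
proof -
  have "(\<integral>\<^sup>+x. ennreal (norm ((cmod (f x))\<^sup>2)) \<partial>M) < \<infinity>"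
    using le le_less_trans[OF le, of \<infinity>] by simp
  then have "integrable M (\<lambda>x. (cmod (f x))\<^sup>2)"
    by (intro integrableI_bounded) auto
  then show f: "f \<in> L2 M" by (simp add: L2_def)
  have "(l2_norm M f)\<^sup>2 \<le> e\<^sup>2"
    using le unfolding l2_nn_integral[OF f] by simp
  then show "l2_norm M f \<le> e" using \<open>e \<ge> 0\<close> by (rule power2_le_imp_le)
qed

text \<open>
  The weights \<open>(3/2) ^ k\<close> grow slowly enough to leave the integrals of the weighted squared increments
  summable, with ratio \<open>3/2 * 1/4 = 3/8\<close>, and fast enough for \<open>\<bar>d\<bar> \<le> t * \<bar>d\<bar>\<^sup>2 + 1 / t\<close> with \<open>t = (3/2) ^ k\<close> to make
  the increments themselves absolutely summable at almost every point.
\<close>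

lemma L2_rapidly_Cauchy_AE_convergent:
  assumes f: "\<And>k. f k \<in> L2 M"
    and close: "\<And>k. l2_norm M (\<lambda>x. f (Suc k) x - f k x) \<le> (1/2) ^ k"
  shows "AE x in M. convergent (\<lambda>k. f k x)"
proof -
  have [measurable]: "f k \<in> borel_measurable M" for k using f by (rule L2_measurable)
  define d where "d k x = f (Suc k) x - f k x" for k x
  have d: "d k \<in> L2 M" for k unfolding d_def using f by simp
  have [measurable]: "d k \<in> borel_measurable M" for k using d by (rule L2_measurable)
  have "(\<integral>\<^sup>+x. (\<Sum>k. ennreal ((3/2) ^ k * (cmod (d k x))\<^sup>2)) \<partial>M)
      = (\<Sum>k. \<integral>\<^sup>+x. ennreal ((3/2) ^ k * (cmod (d k x))\<^sup>2) \<partial>M)"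
    by (rule nn_integral_suminf) measurable
  also have "\<dots> \<le> (\<Sum>k. ennreal ((3/8) ^ k))"
  proof (rule suminf_le)
    fix k
    have "(\<integral>\<^sup>+x. ennreal ((3/2) ^ k * (cmod (d k x))\<^sup>2) \<partial>M)
        = ennreal ((3/2) ^ k) * (\<integral>\<^sup>+x. ennreal ((cmod (d k x))\<^sup>2) \<partial>M)"
      by (subst nn_integral_cmult[symmetric]) (auto simp: ennreal_mult)
    also have "\<dots> = ennreal ((3/2) ^ k * (l2_norm M (d k))\<^sup>2)"
      unfolding l2_nn_integral[OF d] by (simp add: ennreal_mult)
    also have "\<dots> \<le> ennreal ((3/2) ^ k * ((1/2) ^ k)\<^sup>2)"
      using close[of k] unfolding d_def
      by (intro ennreal_leI mult_left_mono power_mono) auto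
    also have "(3/2) ^ k * ((1/2) ^ k)\<^sup>2 = (3/8 :: real) ^ k"
      unfolding power2_eq_square by (simp flip: power_mult_distrib)
    finally show "(\<integral>\<^sup>+x. ennreal ((3/2) ^ k * (cmod (d k x))\<^sup>2) \<partial>M) \<le> ennreal ((3/8) ^ k)" .
  qed auto
  also have "\<dots> < \<infinity>"
    by (subst suminf_ennreal2) (auto intro: summable_geometric)
  finally have "AE x in M. (\<Sum>k. ennreal ((3/2) ^ k * (cmod (d k x))\<^sup>2)) \<noteq> \<infinity>"
    by (intro nn_integral_PInf_AE) auto
  then show ?thesis
  proof eventually_elim
    fix x assume "(\<Sum>k. ennreal ((3/2) ^ k * (cmod (d k x))\<^sup>2)) \<noteq> \<infinity>"
    then have "summable (\<lambda>k. (3/2) ^ k * (cmod (d k x))\<^sup>2)"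
      by (intro summable_suminf_not_top) auto
    then have s: "summable (\<lambda>k. (3/2) ^ k * (cmod (d k x))\<^sup>2 + (2/3) ^ k)"
      by (intro summable_add summable_geometric) auto
    have "summable (\<lambda>k. d k x)"
    proof (rule summable_comparison_test[OF _ s], intro exI allI impI)
      fix k
      define a where "a = cmod (d k x)"
      define t where "t = (3/2 :: real) ^ k"
      have t: "t > 0" "(2/3) ^ k = 1 / t" by (simp_all add: t_def power_divide)
      have "a * t \<le> (t * a)\<^sup>2 + 1"
        using sum_squares_bound[of "t * a" 1] mult_nonneg_nonneg[of t a] t(1)
        by (simp add: mult.commute a_def del: mult_nonneg_nonneg zero_le_mult_iff)
      then have "a \<le> t * a\<^sup>2 + 1 / t"
        using t(1) by (simp add: field_simps power2_eq_square)
      then show "norm (d k x) \<le> (3/2) ^ k * (cmod (d k x))\<^sup>2 + (2/3) ^ k"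
        by (simp add: a_def t(2)) (simp add: t_def)
    qed
    then have "convergent (\<lambda>n. f 0 x + (\<Sum>k<n. d k x))"
      unfolding summable_iff_convergent by (intro convergent_add convergent_const)
    moreover have "f 0 x + (\<Sum>k<n. d k x) = f n x" for n
      unfolding d_def by (subst sum_lessThan_telescope) simp
    ultimately show "convergent (\<lambda>k. f k x)" by simp
  qed
qed

text \<open>
  The Riesz-Fischer theorem: a rapidly Cauchy subsequence has a limit almost everywhere, and Fatou's
  lemma along the subsequence shows that the whole sequence tends to it in norm.
\<close>

lemma L2_complete:
  assumes f: "\<And>n. f n \<in> L2 M"
    and C: "\<And>e. e > 0 \<Longrightarrow> \<exists>N. \<forall>m\<ge>N. \<forall>n\<ge>N. l2_norm M (\<lambda>x. f m x - f n x) < e"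
  shows "\<exists>h\<in>L2 M. (\<lambda>n. l2_norm M (\<lambda>x. f n x - h x)) \<longlonglongrightarrow> 0"
proof -
  have [measurable]: "f k \<in> borel_measurable M" for k using f by (rule L2_measurable)
  have "\<forall>k. \<exists>N. \<forall>m\<ge>N. \<forall>n\<ge>N. l2_norm M (\<lambda>x. f m x - f n x) < (1/2) ^ k"
    using C by simp
  then obtain N where N: "\<And>k m n. m \<ge> N k \<Longrightarrow> n \<ge> N k \<Longrightarrow> l2_norm M (\<lambda>x. f m x - f n x) < (1/2) ^ k"
    by metis
  \<comment> \<open>The summand \<open>k\<close> makes the indices tend to infinity even if the \<open>N i\<close> vanish.\<close>
  define r where "r k = k + (\<Sum>i\<le>k. N i)" for k
  have r: "N k \<le> r k" "N k \<le> r (Suc k)" "k \<le> r k" for k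
    using member_le_sum[of k "{..k}" N] by (simp_all add: r_def)
  have conv: "AE x in M. convergent (\<lambda>k. f (r k) x)"
    by (rule L2_rapidly_Cauchy_AE_convergent) (auto intro!: f less_imp_le N r)
  define h where "h x = lim (\<lambda>k. f (r k) x)" for x
  have [measurable]: "h \<in> borel_measurable M" unfolding h_def by measurable
  have close: "(\<lambda>x. f n x - h x) \<in> L2 M \<and> l2_norm M (\<lambda>x. f n x - h x) \<le> e"
    if e: "e > 0" and n: "\<And>k. k \<ge> n \<Longrightarrow> l2_norm M (\<lambda>x. f n x - f k x) \<le> e" for e n
  proof -
    have "AE x in M. ennreal ((cmod (f n x - h x))\<^sup>2) = liminf (\<lambda>k. ennreal ((cmod (f n x - f (r k) x))\<^sup>2))"
      using conv
    proof eventually_elim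
      fix x assume "convergent (\<lambda>k. f (r k) x)"
      then have "(\<lambda>k. f (r k) x) \<longlonglongrightarrow> h x" unfolding h_def by (simp add: convergent_LIMSEQ_iff)
      then have "(\<lambda>k. ennreal ((cmod (f n x - f (r k) x))\<^sup>2)) \<longlonglongrightarrow> ennreal ((cmod (f n x - h x))\<^sup>2)"
        by (intro tendsto_intros) auto
      then show "ennreal ((cmod (f n x - h x))\<^sup>2) = liminf (\<lambda>k. ennreal ((cmod (f n x - f (r k) x))\<^sup>2))"
        by (intro lim_imp_Liminf[symmetric]) auto
    qed
    then have "(\<integral>\<^sup>+x. ennreal ((cmod (f n x - h x))\<^sup>2) \<partial>M)
        = (\<integral>\<^sup>+x. liminf (\<lambda>k. ennreal ((cmod (f n x - f (r k) x))\<^sup>2)) \<partial>M)"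
      by (rule nn_integral_cong_AE)
    also have "\<dots> \<le> liminf (\<lambda>k. \<integral>\<^sup>+x. ennreal ((cmod (f n x - f (r k) x))\<^sup>2) \<partial>M)"
      by (rule nn_integral_liminf) measurable
    also have "\<dots> \<le> ennreal (e\<^sup>2)"
    proof (rule Liminf_le)
      show "\<forall>\<^sub>F k in sequentially. (\<integral>\<^sup>+x. ennreal ((cmod (f n x - f (r k) x))\<^sup>2) \<partial>M) \<le> ennreal (e\<^sup>2)"
      proof (rule eventually_sequentiallyI)
        fix k assume "k \<ge> n"
        then have "r k \<ge> n" using r(3)[of k] by simp
        then have "(l2_norm M (\<lambda>x. f n x - f (r k) x))\<^sup>2 \<le> e\<^sup>2"
          by (intro power_mono n) auto
        then show "(\<integral>\<^sup>+x. ennreal ((cmod (f n x - f (r k) x))\<^sup>2) \<partial>M) \<le> ennreal (e\<^sup>2)"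
          using l2_nn_integral[of "\<lambda>x. f n x - f (r k) x" M] f by (simp add: ennreal_leI)
      qed
    qed simp
    finally have le: "(\<integral>\<^sup>+x. ennreal ((cmod (f n x - h x))\<^sup>2) \<partial>M) \<le> ennreal (e\<^sup>2)" .
    have m: "(\<lambda>x. f n x - h x) \<in> borel_measurable M" by measurable
    show ?thesis using L2_if_nn_integral_le[OF m le] e by simp
  qed
  have ev: "\<exists>n0. \<forall>n\<ge>n0. (\<lambda>x. f n x - h x) \<in> L2 M \<and> l2_norm M (\<lambda>x. f n x - h x) \<le> e" if "e > 0" for e
  proof -
    obtain n0 where "\<forall>m\<ge>n0. \<forall>n\<ge>n0. l2_norm M (\<lambda>x. f m x - f n x) < e" using C[OF \<open>e > 0\<close>] by blast
    then show ?thesis using close[OF \<open>e > 0\<close>] by (intro exI[of _ n0]) (meson less_imp_le order_trans)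
  qed
  have "h \<in> L2 M"
  proof -
    obtain n where "(\<lambda>x. f n x - h x) \<in> L2 M" using ev[of 1] by auto
    from L2_diff[OF f this, of n] show ?thesis by simp
  qed
  moreover have "(\<lambda>n. l2_norm M (\<lambda>x. f n x - h x)) \<longlonglongrightarrow> 0"
  proof (rule LIMSEQ_I)
    fix e :: real assume "e > 0"
    then obtain n0 where "\<forall>n\<ge>n0. l2_norm M (\<lambda>x. f n x - h x) \<le> e / 2" using ev[of "e/2"] by auto
    then show "\<exists>n0. \<forall>n\<ge>n0. norm (l2_norm M (\<lambda>x. f n x - h x) - 0) < e"
      using \<open>e > 0\<close> by (intro exI[of _ n0]) fastforce
  qed
  ultimately show ?thesis by blast
qed

lemma closed_l2_subspaceD:
  assumes "closed_l2_subspace M V"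
  shows "f \<in> V \<Longrightarrow> f \<in> L2 M" "(\<lambda>x. 0) \<in> V" "f \<in> V \<Longrightarrow> g \<in> V \<Longrightarrow> (\<lambda>x. f x + g x) \<in> V"
    "f \<in> V \<Longrightarrow> (\<lambda>x. c * f x) \<in> V" "f \<in> V \<Longrightarrow> g \<in> V \<Longrightarrow> (\<lambda>x. f x - g x) \<in> V"
proof -
  show add: "f \<in> V \<Longrightarrow> g \<in> V \<Longrightarrow> (\<lambda>x. f x + g x) \<in> V" for f g
    using assms unfolding closed_l2_subspace_def by blast
  show cm: "f \<in> V \<Longrightarrow> (\<lambda>x. c * f x) \<in> V" for f c
    using assms unfolding closed_l2_subspace_def by blast
  show "f \<in> V \<Longrightarrow> g \<in> V \<Longrightarrow> (\<lambda>x. f x - g x) \<in> V"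
    using add[of f "\<lambda>x. (-1) * g x"] cm[of g "-1"] by simp
qed (use assms in \<open>auto simp: closed_l2_subspace_def\<close>)

lemma closed_l2_subspace_limit:
  assumes V: "closed_l2_subspace M V" and g: "\<And>n. n \<ge> N \<Longrightarrow> g n \<in> V" and p: "p \<in> L2 M"
    and lim: "(\<lambda>n. l2_norm M (\<lambda>x. g n x - p x)) \<longlonglongrightarrow> 0"
  shows "p \<in> V"
proof -
  have "\<exists>u\<in>V. l2_norm M (\<lambda>x. p x - u x) < e" if "e > 0" for e
  proof -
    have "\<forall>\<^sub>F n in sequentially. l2_norm M (\<lambda>x. g n x - p x) < e"
      by (rule order_tendstoD(2)[OF lim that])
    then obtain n0 where "\<And>n. n \<ge> n0 \<Longrightarrow> l2_norm M (\<lambda>x. g n x - p x) < e"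
      unfolding eventually_sequentially by blast
    from this[of "max n0 N"] g[of "max n0 N"] show ?thesis
      by (auto simp: l2_norm_diff_commute[of M p])
  qed
  then have "p \<in> l2_closure M V" unfolding l2_closure_def using p by simp
  then show ?thesis using V unfolding closed_l2_subspace_def by blast
qed

text \<open>
  If \<open>\<langle>u, g\<rangle>\<close> were not zero, a small step from \<open>u\<close> in the direction \<open>\<langle>u, g\<rangle> g\<close> would shorten \<open>u\<close>.
\<close>

lemma l2_nearest_point_orthogonal:
  assumes V: "closed_l2_subspace M V" and u: "u \<in> L2 M"
    and min: "\<And>g. g \<in> V \<Longrightarrow> (l2_norm M u)\<^sup>2 \<le> (l2_norm M (\<lambda>x. u x - g x))\<^sup>2" and g: "g \<in> V"
  shows "l2_inner M u g = 0"
proof (rule ccontr)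
  assume nz: "l2_inner M u g \<noteq> 0"
  define a where "a = l2_inner M u g"
  \<comment> \<open>The step length need only satisfy \<open>0 < t\<close> and \<open>t * \<parallel>g\<parallel>\<^sup>2 \<le> 1\<close>.\<close>
  define t where "t = 1 / (1 + (l2_norm M g)\<^sup>2)"
  have pos: "1 + (l2_norm M g)\<^sup>2 > 0" using zero_le_power2[of "l2_norm M g"] by linarith
  have t: "t > 0" "t * (l2_norm M g)\<^sup>2 < 1" using pos by (simp_all add: t_def field_simps)
  have g2: "g \<in> L2 M" using closed_l2_subspaceD(1)[OF V g] .
  have re: "Re (cnj (of_real t * a) * a) = t * (cmod a)\<^sup>2"
    unfolding cmod_power2 by (simp add: power2_eq_square algebra_simps)
  have "(l2_norm M u)\<^sup>2 \<le> (l2_norm M (\<lambda>x. u x - (of_real t * a) * g x))\<^sup>2"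
    by (rule min) (rule closed_l2_subspaceD(4)[OF V g])
  also have "\<dots> = (l2_norm M u)\<^sup>2 - 2 * (t * (cmod a)\<^sup>2) + (t * cmod a * l2_norm M g)\<^sup>2"
    unfolding l2_norm_diff_power2[OF u L2_cmult[OF g2]] l2_inner_cmult_right l2_norm_cmult
      a_def[symmetric] re using t(1) by (simp add: norm_mult)
  finally have "2 * (t * (cmod a)\<^sup>2) \<le> (t * (cmod a)\<^sup>2) * (t * (l2_norm M g)\<^sup>2)"
    by (simp add: power2_eq_square mult_ac)
  also have "\<dots> \<le> (t * (cmod a)\<^sup>2) * 1"
    using t by (intro mult_left_mono) auto
  finally have "t * (cmod a)\<^sup>2 \<le> 0" by simp
  then show False using t(1) nz by (simp add: a_def mult_le_0_iff)
qed

text \<open>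
  By the parallelogram law a sequence in \<open>V\<close> whose distances to \<open>f\<close> tend to their infimum is Cauchy;
  its limit is a nearest point of \<open>V\<close>.
\<close>

lemma l2_projection_exists:
  assumes V: "closed_l2_subspace M V" and f: "f \<in> L2 M"
  shows "\<exists>p\<in>V. \<forall>g\<in>V. l2_inner M (\<lambda>x. f x - p x) g = 0"
proof -
  note VD = closed_l2_subspaceD[OF V]
  define S where "S = (\<lambda>g. (l2_norm M (\<lambda>x. f x - g x))\<^sup>2) ` V"
  have S: "S \<noteq> {}" "bdd_below S" using VD(2) unfolding S_def by (auto intro!: bdd_belowI[of _ 0])
  define d where "d = Inf S"
  have ge: "d \<le> (l2_norm M (\<lambda>x. f x - g x))\<^sup>2" if "g \<in> V" for g
    unfolding d_def by (rule cInf_lower[OF _ S(2)]) (use that in \<open>simp add: S_def\<close>)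
  have "\<exists>g\<in>V. (l2_norm M (\<lambda>x. f x - g x))\<^sup>2 < d + 1 / Suc n" for n
    using cInf_lessD[OF S(1), of "d + 1 / Suc n"] unfolding d_def S_def by auto
  then obtain g where g: "\<And>n. g n \<in> V" "\<And>n. (l2_norm M (\<lambda>x. f x - g n x))\<^sup>2 < d + 1 / Suc n"
    by metis
  have gL: "g n \<in> L2 M" for n using g VD by blast
  have par: "(l2_norm M (\<lambda>x. g m x - g n x))\<^sup>2 \<le> 2 / Suc m + 2 / Suc n" for m n
  proof -
    have "(\<lambda>x. (1/2) * (g m x + g n x)) \<in> V" by (intro VD g)
    from ge[OF this] have "4 * d \<le> 4 * (l2_norm M (\<lambda>x. f x - (1/2) * (g m x + g n x)))\<^sup>2" by simp
    also have "\<dots> = (l2_norm M (\<lambda>x. 2 * (f x - (1/2) * (g m x + g n x))))\<^sup>2"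
      unfolding l2_norm_cmult by (simp add: power_mult_distrib)
    also have "(\<lambda>x. 2 * (f x - (1/2) * (g m x + g n x))) = (\<lambda>x. (f x - g m x) + (f x - g n x))"
      by (simp add: fun_eq_iff algebra_simps)
    finally have 1: "4 * d \<le> (l2_norm M (\<lambda>x. (f x - g m x) + (f x - g n x)))\<^sup>2" .
    have "(l2_norm M (\<lambda>x. g m x - g n x)) = (l2_norm M (\<lambda>x. (f x - g m x) - (f x - g n x)))"
      by (subst l2_norm_diff_commute) (simp add: algebra_simps)
    then have "(l2_norm M (\<lambda>x. g m x - g n x))\<^sup>2 =
        2 * (l2_norm M (\<lambda>x. f x - g m x))\<^sup>2 + 2 * (l2_norm M (\<lambda>x. f x - g n x))\<^sup>2
        - (l2_norm M (\<lambda>x. (f x - g m x) + (f x - g n x)))\<^sup>2"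
      using l2_norm_add_power2[OF L2_diff[OF f gL[of m]] L2_diff[OF f gL[of n]]]
        l2_norm_diff_power2[OF L2_diff[OF f gL[of m]] L2_diff[OF f gL[of n]]] by simp
    then show ?thesis using 1 g(2)[of m] g(2)[of n] by simp
  qed
  have "\<exists>N. \<forall>m\<ge>N. \<forall>n\<ge>N. l2_norm M (\<lambda>x. g m x - g n x) < e" if e: "e > 0" for e
  proof -
    obtain N where N: "1 / Suc N < e\<^sup>2 / 4"
      using reals_Archimedean[of "e\<^sup>2 / 4"] e by (auto simp: inverse_eq_divide)
    have "l2_norm M (\<lambda>x. g m x - g n x) < e" if "m \<ge> N" "n \<ge> N" for m n
    proof -
      have "2 / Suc m \<le> 2 / Suc N" "2 / Suc n \<le> 2 / Suc N"
        using that by (auto intro!: divide_left_mono)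
      then have "(l2_norm M (\<lambda>x. g m x - g n x))\<^sup>2 < e\<^sup>2" using par[of m n] N by simp
      then show ?thesis using e by (intro power2_less_imp_less[of _ e]) auto
    qed
    then show ?thesis by blast
  qed
  from L2_complete[OF gL this] obtain p where
    p: "p \<in> L2 M" "(\<lambda>n. l2_norm M (\<lambda>x. g n x - p x)) \<longlonglongrightarrow> 0" by blast
  have pV: "p \<in> V" by (rule closed_l2_subspace_limit[OF V _ p, of 0]) (rule g)
  have u: "(\<lambda>x. f x - p x) \<in> L2 M" using f p by simp
  have "d \<ge> 0" unfolding d_def by (rule cInf_greatest[OF S(1)]) (auto simp: S_def)
  have "l2_norm M (\<lambda>x. f x - p x) \<le> sqrt d"
  proof (rule LIMSEQ_le_const)
    have "(\<lambda>n. d + 1 / Suc n) \<longlonglongrightarrow> d"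
      using tendsto_add[OF tendsto_const LIMSEQ_inverse_real_of_nat, of d]
      by (simp add: inverse_eq_divide)
    then have "(\<lambda>n. sqrt (d + 1 / Suc n)) \<longlonglongrightarrow> sqrt d" by (rule tendsto_real_sqrt)
    from tendsto_add[OF this p(2)]
    show "(\<lambda>n. sqrt (d + 1 / Suc n) + l2_norm M (\<lambda>x. g n x - p x)) \<longlonglongrightarrow> sqrt d" by simp
    have "l2_norm M (\<lambda>x. f x - p x) \<le> sqrt (d + 1 / Suc n) + l2_norm M (\<lambda>x. g n x - p x)" for n
    proof -
      have "l2_norm M (\<lambda>x. f x - g n x) \<le> sqrt (d + 1 / Suc n)"
        using g(2)[of n] by (intro real_le_rsqrt) simp
      then show ?thesis using l2_norm_triangle_diff[OF f gL[of n] p(1)] by simp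
    qed
    then show "\<exists>N. \<forall>n\<ge>N. l2_norm M (\<lambda>x. f x - p x) \<le> sqrt (d + 1 / Suc n) + l2_norm M (\<lambda>x. g n x - p x)"
      by blast
  qed
  from power_mono[OF this, of 2] have le: "(l2_norm M (\<lambda>x. f x - p x))\<^sup>2 \<le> d" using \<open>d \<ge> 0\<close> by simp
  have min: "(l2_norm M (\<lambda>x. f x - p x))\<^sup>2 \<le> (l2_norm M (\<lambda>x. (f x - p x) - h x))\<^sup>2" if "h \<in> V" for h
    using le ge[OF VD(3)[OF pV that]] unfolding diff_diff_eq by linarith
  show ?thesis using pV l2_nearest_point_orthogonal[OF V u min] by blast
qed

section \<open>Frame bounds for finite families\<close>

lemma sum_norm_mult_power2_le:
  fixes c z :: "'i \<Rightarrow> complex"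
  shows "(cmod (\<Sum>i\<in>I. c i * z i))\<^sup>2 \<le> (\<Sum>i\<in>I. (cmod (c i))\<^sup>2) * (\<Sum>i\<in>I. (cmod (z i))\<^sup>2)"
proof -
  have "cmod (\<Sum>i\<in>I. c i * z i) \<le> (\<Sum>i\<in>I. cmod (c i) * cmod (z i))"
    using norm_sum[of "\<lambda>i. c i * z i" I] by (simp add: norm_mult)
  then have "(cmod (\<Sum>i\<in>I. c i * z i))\<^sup>2 \<le> (\<Sum>i\<in>I. cmod (c i) * cmod (z i))\<^sup>2"
    by (rule power_mono) simp
  also have "\<dots> \<le> (\<Sum>i\<in>I. (cmod (c i))\<^sup>2) * (\<Sum>i\<in>I. (cmod (z i))\<^sup>2)"
    by (rule Cauchy_Schwarz_ineq_sum)
  finally show ?thesis .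
qed

text \<open>
  The induction is the Gram-Schmidt process: a new member \<open>v\<^sub>k\<close> adds to the projection of \<open>f\<close> a multiple of
  the part \<open>r\<close> of \<open>v\<^sub>k\<close> that is orthogonal to the earlier members.  The coefficients that express \<open>\<langle>f, r\<rangle>\<close> by
  the \<open>\<langle>f, v\<^sub>i\<rangle>\<close> depend on the family only, hence so does the constant.
\<close>

lemma finite_family_projection_bound:
  assumes "finite I" "\<And>i. i \<in> I \<Longrightarrow> v i \<in> L2 M"
  shows "\<exists>C\<ge>0. \<forall>f\<in>L2 M. \<exists>c. (\<forall>i\<in>I. l2_inner M (\<lambda>x. f x - (\<Sum>j\<in>I. c j * v j x)) (v i) = 0)
    \<and> (l2_norm M (\<lambda>x. \<Sum>j\<in>I. c j * v j x))\<^sup>2 \<le> C * (\<Sum>i\<in>I. (cmod (l2_inner M f (v i)))\<^sup>2)"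
  using assms
proof (induct I)
  case empty
  show ?case by (intro exI[of _ 0]) (simp add: l2_norm_def)
next
  case (insert k I)
  have v: "v k \<in> L2 M" "\<And>i. i \<in> I \<Longrightarrow> v i \<in> L2 M" using insert.prems by auto
  obtain C where C: "C \<ge> 0" "\<And>f. f \<in> L2 M \<Longrightarrow>
      \<exists>c. (\<forall>i\<in>I. l2_inner M (\<lambda>x. f x - (\<Sum>j\<in>I. c j * v j x)) (v i) = 0)
        \<and> (l2_norm M (\<lambda>x. \<Sum>j\<in>I. c j * v j x))\<^sup>2 \<le> C * (\<Sum>i\<in>I. (cmod (l2_inner M f (v i)))\<^sup>2)"
    using insert.hyps(3)[OF v(2)] by blast
  obtain b where b: "\<And>i. i \<in> I \<Longrightarrow> l2_inner M (\<lambda>x. v k x - (\<Sum>j\<in>I. b j * v j x)) (v i) = 0"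
    using C(2)[OF v(1)] by blast
  define r where "r x = v k x - (\<Sum>j\<in>I. b j * v j x)" for x
  have r: "r \<in> L2 M" unfolding r_def using v by (intro L2_diff L2_sum L2_cmult)
  have comb: "(\<lambda>x. \<Sum>j\<in>I. c j * v j x) \<in> L2 M" for c using v(2) by (intro L2_sum L2_cmult)
  have r_orth: "l2_inner M r (v i) = 0" "l2_inner M (v i) r = 0" if "i \<in> I" for i
    using b[OF that] l2_inner_cnj[of M "v i" r] unfolding r_def by simp_all
  have r_comb: "l2_inner M (\<lambda>x. \<Sum>j\<in>I. c j * v j x) r = 0" for c
    using v r by (subst l2_inner_sum_left) (auto simp: l2_inner_cmult_left r_orth)
  have comb_r: "l2_inner M r (\<lambda>x. \<Sum>j\<in>I. c j * v j x) = 0" for c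
    using r_comb[of c] l2_inner_cnj[of M r] by simp
  define n where "n = l2_norm M r"
  define D where "D = 1 + (\<Sum>i\<in>I. (cmod (b i))\<^sup>2)"
  have D: "D \<ge> 0" unfolding D_def by (simp add: sum_nonneg)
  show ?case
  proof (intro exI[of _ "C + D / n\<^sup>2"] conjI ballI)
    show "C + D / n\<^sup>2 \<ge> 0" using C(1) D by simp
    fix f assume f: "f \<in> L2 M"
    let ?S = "\<lambda>J. \<Sum>i\<in>J. (cmod (l2_inner M f (v i)))\<^sup>2"
    obtain c where c: "\<And>i. i \<in> I \<Longrightarrow> l2_inner M (\<lambda>x. f x - (\<Sum>j\<in>I. c j * v j x)) (v i) = 0"
      "(l2_norm M (\<lambda>x. \<Sum>j\<in>I. c j * v j x))\<^sup>2 \<le> C * ?S I"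
      using C(2)[OF f] by blast
    define s where "s x = (\<Sum>j\<in>I. c j * v j x)" for x
    have s: "s \<in> L2 M" unfolding s_def by (rule comb)
    have fs: "(\<lambda>x. f x - s x) \<in> L2 M" using f s by simp
    \<comment> \<open>If \<open>n = 0\<close>, then \<open>r\<close> vanishes almost everywhere and the quotient 0 is the right coefficient.\<close>
    define a where "a = l2_inner M f r / of_real (n\<^sup>2)"
    have ar: "a * l2_inner M r r = l2_inner M f r"
      using l2_inner_eq_0[OF r, of f] by (cases "n = 0") (auto simp: a_def l2_inner_self n_def)
    define e where "e j = (if j = k then a else c j - a * b j)" for j
    have e: "(\<Sum>j\<in>insert k I. e j * v j x) = s x + a * r x" for x
    proof -
      have "(\<Sum>j\<in>I. e j * v j x) = (\<Sum>j\<in>I. c j * v j x - a * (b j * v j x))"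
        using insert.hyps(2) by (intro sum.cong) (auto simp: e_def algebra_simps)
      then show ?thesis using insert.hyps(1,2)
        by (simp add: s_def r_def sum_subtractf sum_distrib_left right_diff_distrib) (simp add: e_def)
    qed
    have sr: "l2_inner M s r = 0" unfolding s_def by (rule r_comb)
    have f_minus: "l2_inner M (\<lambda>x. f x - (s x + a * r x)) g
        = l2_inner M (\<lambda>x. f x - s x) g - a * l2_inner M r g" if "g \<in> L2 M" for g
      using l2_inner_diff_left[OF fs L2_cmult[OF r] that, of a]
      by (simp add: l2_inner_cmult_left diff_diff_eq)
    have orth_I: "l2_inner M (\<lambda>x. f x - (s x + a * r x)) (v i) = 0" if "i \<in> I" for i
      using c(1)[OF that] r_orth(1)[OF that] f_minus[OF v(2)[OF that]] by (simp add: s_def)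
    have "l2_inner M (\<lambda>x. f x - (s x + a * r x)) r = 0"
      using f_minus[OF r] l2_inner_diff_left[OF f s r] sr ar by simp
    moreover have "l2_inner M (\<lambda>x. f x - (s x + a * r x)) (\<lambda>x. \<Sum>j\<in>I. b j * v j x) = 0"
    proof (subst l2_inner_sum_right)
      show "(\<lambda>x. f x - (s x + a * r x)) \<in> L2 M" using f s r by simp
    qed (use v orth_I in \<open>auto simp: l2_inner_cmult_right\<close>)
    moreover have "v k = (\<lambda>x. r x + (\<Sum>j\<in>I. b j * v j x))" by (simp add: r_def)
    ultimately have orth_k: "l2_inner M (\<lambda>x. f x - (s x + a * r x)) (v k) = 0"
      using f s r comb[of b] by (simp add: l2_inner_add_right)
    have "l2_inner M f r = l2_inner M f (v k) - (\<Sum>j\<in>I. cnj (b j) * l2_inner M f (v j))"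
    proof -
      have "l2_inner M f r = l2_inner M f (v k) - l2_inner M f (\<lambda>x. \<Sum>j\<in>I. b j * v j x)"
        unfolding r_def using v(1) comb f by (intro l2_inner_diff_right)
      then show ?thesis using v(2) f by (subst (asm) l2_inner_sum_right) (auto simp: l2_inner_cmult_right)
    qed
    also have "\<dots> = (\<Sum>j\<in>insert k I. (if j = k then 1 else - cnj (b j)) * l2_inner M f (v j))"
      using insert.hyps(1,2) by (simp add: sum_negf[symmetric]) (intro sum.cong, auto)
    finally have "(cmod (l2_inner M f r))\<^sup>2
        \<le> (\<Sum>j\<in>insert k I. (cmod (if j = k then 1 else - cnj (b j)))\<^sup>2) * ?S (insert k I)"
      using sum_norm_mult_power2_le by metis
    also have "(\<Sum>j\<in>insert k I. (cmod (if j = k then 1 else - cnj (b j)))\<^sup>2) = D"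
      unfolding D_def using insert.hyps(1,2) by simp (intro sum.cong, auto)
    finally have fr: "(cmod (l2_inner M f r))\<^sup>2 \<le> D * ?S (insert k I)" .
    have "(l2_norm M (\<lambda>x. s x + a * r x))\<^sup>2 = (l2_norm M s)\<^sup>2 + (cmod a * n)\<^sup>2"
      using l2_pythagoras[OF s L2_cmult[OF r], of a] sr
      by (simp add: l2_inner_cmult_right l2_norm_cmult n_def)
    also have "(cmod a * n)\<^sup>2 = (cmod (l2_inner M f r))\<^sup>2 / n\<^sup>2"
      by (cases "n = 0") (simp_all add: a_def norm_divide norm_power power_mult_distrib power_divide
          field_simps power2_eq_square norm_mult)
    also have "(l2_norm M s)\<^sup>2 + (cmod (l2_inner M f r))\<^sup>2 / n\<^sup>2 \<le>
        C * ?S (insert k I) + D * ?S (insert k I) / n\<^sup>2"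
    proof (rule add_mono)
      have "?S I \<le> ?S (insert k I)" using insert.hyps(1) by (intro sum_mono2) auto
      then have "C * ?S I \<le> C * ?S (insert k I)" using C(1) by (rule mult_left_mono)
      then show "(l2_norm M s)\<^sup>2 \<le> C * ?S (insert k I)" using c(2) unfolding s_def by linarith
    qed (use fr in \<open>simp add: divide_right_mono\<close>)
    finally have bound: "(l2_norm M (\<lambda>x. s x + a * r x))\<^sup>2 \<le> (C + D / n\<^sup>2) * ?S (insert k I)"
      by (simp add: distrib_right)
    show "\<exists>c. (\<forall>i\<in>insert k I. l2_inner M (\<lambda>x. f x - (\<Sum>j\<in>insert k I. c j * v j x)) (v i) = 0) \<and>
        (l2_norm M (\<lambda>x. \<Sum>j\<in>insert k I. c j * v j x))\<^sup>2 \<le> (C + D / n\<^sup>2) * ?S (insert k I)"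
      using orth_I orth_k bound by (intro exI[of _ e]) (auto simp only: e)
  qed
qed

text \<open>
  The inner hypothesis says that \<open>f\<close> belongs to the double orthogonal complement of the family.  Unlike
  membership in the span, it passes at once to limits and to functions changed on a null set.
\<close>

lemma finite_family_lower_frame_bound:
  assumes I: "finite I" and v: "\<And>i. i \<in> I \<Longrightarrow> v i \<in> L2 M"
  shows "\<exists>A>0. \<forall>f\<in>L2 M.
    (\<forall>g\<in>L2 M. (\<forall>i\<in>I. l2_inner M g (v i) = 0) \<longrightarrow> l2_inner M f g = 0) \<longrightarrow>
    A * (l2_norm M f)\<^sup>2 \<le> (\<Sum>i\<in>I. (cmod (l2_inner M f (v i)))\<^sup>2)"
proof -
  obtain C where C: "C \<ge> 0" "\<And>f. f \<in> L2 M \<Longrightarrow>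
      \<exists>c. (\<forall>i\<in>I. l2_inner M (\<lambda>x. f x - (\<Sum>j\<in>I. c j * v j x)) (v i) = 0)
        \<and> (l2_norm M (\<lambda>x. \<Sum>j\<in>I. c j * v j x))\<^sup>2 \<le> C * (\<Sum>i\<in>I. (cmod (l2_inner M f (v i)))\<^sup>2)"
    using finite_family_projection_bound[of I v M] I v by blast
  show ?thesis
  proof (intro exI[of _ "1 / (C + 1)"] conjI ballI impI)
    show "1 / (C + 1) > 0" using C(1) by simp
    fix f assume f: "f \<in> L2 M"
      and perp: "\<forall>g\<in>L2 M. (\<forall>i\<in>I. l2_inner M g (v i) = 0) \<longrightarrow> l2_inner M f g = 0"
    let ?S = "\<Sum>i\<in>I. (cmod (l2_inner M f (v i)))\<^sup>2"
    obtain c where c: "\<And>i. i \<in> I \<Longrightarrow> l2_inner M (\<lambda>x. f x - (\<Sum>j\<in>I. c j * v j x)) (v i) = 0"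
      "(l2_norm M (\<lambda>x. \<Sum>j\<in>I. c j * v j x))\<^sup>2 \<le> C * ?S"
      using C(2)[OF f] by blast
    define s where "s x = (\<Sum>j\<in>I. c j * v j x)" for x
    define g where "g x = f x - s x" for x
    have s: "s \<in> L2 M" unfolding s_def using v by (intro L2_sum L2_cmult)
    have g: "g \<in> L2 M" unfolding g_def using f s by simp
    have gv: "l2_inner M g (v i) = 0" if "i \<in> I" for i using c(1)[OF that] unfolding g_def[abs_def] s_def .
    have "l2_inner M g s = 0"
      unfolding s_def using v g by (subst l2_inner_sum_right) (auto simp: l2_inner_cmult_right gv)
    then have sg: "l2_inner M s g = 0" by (simp add: l2_inner_cnj[of M s])
    have "l2_inner M f g = 0" using perp g gv by blast
    then have "l2_inner M g g = 0"
      using l2_inner_diff_left[OF f s g] sg by (simp add: g_def[abs_def])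
    then have g0: "l2_norm M g = 0" by (simp add: l2_inner_self)
    have "f = (\<lambda>x. s x + g x)" by (simp add: g_def)
    then have "(l2_norm M f)\<^sup>2 = (l2_norm M s)\<^sup>2"
      using l2_pythagoras[OF s g sg] g0 by simp
    also have "\<dots> \<le> (C + 1) * ?S"
      using c(2) by (simp add: s_def[abs_def] distrib_right add_increasing2 sum_nonneg)
    finally show "1 / (C + 1) * (l2_norm M f)\<^sup>2 \<le> ?S" using C(1) by (simp add: field_simps)
  qed
qed

section \<open>Affine changes of variables for the Haar measure\<close>

lemma sets_haar [measurable_cong, simp]: "sets haar = sets borel"
  using normalized_haar_haar by (simp add: normalized_haar_def)

lemma space_haar [simp]: "space haar = UNIV"
  using sets_eq_imp_space_eq[OF sets_haar] by simp

lemma haar_ball2: "emeasure haar (ball2 c n) = ennreal (2 powi (- n))"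
  by (rule normalized_haar_ball2[OF normalized_haar_haar])

lemma q2_affine_measurable [measurable]: "(\<lambda>x. u * x - a :: q2) \<in> borel_measurable borel"
proof (rule borel_measurable_continuous_onI)
  have d: "dist (u * x - a) (u * y - a) = norm2 u * dist x y" for x y
    unfolding dist_q2_def norm2_mult[symmetric] by (simp add: algebra_simps)
  have "(norm2 u + 1)-lipschitz_on UNIV (\<lambda>x. u * x - a)"
    by (rule lipschitz_onI) (auto simp: d intro: mult_right_mono)
  then show "continuous_on UNIV (\<lambda>x. u * x - a)" by (rule lipschitz_on_continuous_on)
qed

lemma ball2_affine_vimage: "(\<lambda>x. 2 powi j * x - a) -` ball2 c n = ball2 ((c + a) / 2 powi j) (n - j)"
proof -
  have "norm2 (2 powi j * x - a - c) \<le> 2 powi (- n) \<longleftrightarrow> norm2 (x - (c + a) / 2 powi j) \<le> 2 powi (- (n - j))" for x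
  proof -
    have "2 powi j * x - a - c = 2 powi j * (x - (c + a) / 2 powi j)"
      by (simp add: field_simps)
    then have "norm2 (2 powi j * x - a - c) = norm2 (x - (c + a) / 2 powi j) * 2 powi (- j)"
      by (simp only: norm2_mult norm2_power_int mult.commute)
    moreover have "(2::real) powi (- n) = 2 powi (- (n - j)) * 2 powi (- j)"
      by (simp flip: power_int_add)
    ultimately show ?thesis
      by (simp only: mult_le_cancel_right_pos zero_less_power_int zero_less_numeral)
  qed
  then show ?thesis by (auto simp: ball2_def)
qed

text \<open>
  A ball is pulled back to a ball whose radius is larger by the factor \<open>2 ^ j\<close>, because
  multiplication by \<open>2 ^ j\<close> contracts 2-adic distances by that factor.
\<close>

lemma haar_distr_affine:
  "distr haar borel (\<lambda>x. 2 powi j * x - a) = density haar (\<lambda>x. ennreal (2 powi j))"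
proof (rule q2_measure_eqI)
  fix c n
  have "emeasure (distr haar borel (\<lambda>x. 2 powi j * x - a)) (ball2 c n) = ennreal (2 powi (j - n))"
    by (subst emeasure_distr) (simp_all add: ball2_affine_vimage haar_ball2 del: power_int_minus)
  moreover have "emeasure (density haar (\<lambda>x. ennreal (2 powi j))) (ball2 c n) = ennreal (2 powi (j - n))"
    by (subst emeasure_density_const) (simp_all add: haar_ball2 power_int_add flip: ennreal_mult, simp add: power_int_diff power_int_minus divide_inverse)
  ultimately show "emeasure (distr haar borel (\<lambda>x. 2 powi j * x - a)) (ball2 c n)
      = emeasure (density haar (\<lambda>x. ennreal (2 powi j))) (ball2 c n)"
    "emeasure (distr haar borel (\<lambda>x. 2 powi j * x - a)) (ball2 c n) \<noteq> \<infinity>" by simp_all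
qed simp_all

lemma haar_integrable_affine_iff:
  fixes g :: "q2 \<Rightarrow> 'b :: {banach, second_countable_topology}"
  assumes [measurable]: "g \<in> borel_measurable haar"
  shows "integrable haar (\<lambda>x. g (2 powi j * x - a)) \<longleftrightarrow> integrable haar g"
proof -
  have "integrable haar (\<lambda>x. g (2 powi j * x - a)) \<longleftrightarrow> integrable (distr haar borel (\<lambda>x. 2 powi j * x - a)) g"
    by (rule integrable_distr_eq[symmetric]) auto
  also have "\<dots> \<longleftrightarrow> integrable haar (\<lambda>x. (2 powi j) *\<^sub>R g x)"
    unfolding haar_distr_affine by (rule integrable_density) auto
  also have "\<dots> \<longleftrightarrow> integrable haar g"
    using integrable_scaleR_right[of "inverse (2 powi j)" haar "\<lambda>x. (2 powi j) *\<^sub>R g x"]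
      integrable_scaleR_right[of "2 powi j" haar g] by auto
  finally show ?thesis .
qed

lemma haar_integral_affine:
  fixes g :: "q2 \<Rightarrow> 'b :: {banach, second_countable_topology}"
  assumes [measurable]: "g \<in> borel_measurable haar"
  shows "(LINT x|haar. g (2 powi j * x - a)) = (2 powi j) *\<^sub>R (LINT x|haar. g x)"
proof -
  have "(LINT x|haar. g (2 powi j * x - a)) = integral\<^sup>L (distr haar borel (\<lambda>x. 2 powi j * x - a)) g"
    by (rule integral_distr[symmetric]) auto
  also have "\<dots> = (LINT x|haar. (2 powi j) *\<^sub>R g x)"
    unfolding haar_distr_affine by (rule integral_density) auto
  finally show ?thesis by simp
qed

lemma haar_AE_affine:
  assumes "AE x in haar. P x" shows "AE x in haar. P (2 powi j * x - a)"
proof -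
  have "AE x in density haar (\<lambda>x. ennreal (2 powi j)). P x"
    using assms by (subst AE_density) auto
  then have "AE x in distr haar borel (\<lambda>x. 2 powi j * x - a). P x" unfolding haar_distr_affine .
  then show ?thesis by (rule AE_distrD[rotated]) simp
qed

text \<open>
  The factor makes the dilation unitary (\<open>l2_inner_dilation2\<close>).
\<close>

definition dilation2 :: "int \<Rightarrow> (q2 \<Rightarrow> complex) \<Rightarrow> q2 \<Rightarrow> complex" where
  "dilation2 j f x = of_real (2 powr (of_int j / 2)) * f (2 powi (- j) * x)"

lemma L2_affine:
  assumes f: "f \<in> L2 haar" shows "(\<lambda>x. f (2 powi j * x - a)) \<in> L2 haar"
proof -
  have [measurable]: "f \<in> borel_measurable haar" using f by (rule L2_measurable)
  have "integrable haar (\<lambda>x. (cmod (f (2 powi j * x - a)))\<^sup>2)"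
    using haar_integrable_affine_iff[of "\<lambda>x. (cmod (f x))\<^sup>2" j a] L2_integrable[OF f] by simp
  moreover have "(\<lambda>x. f (2 powi j * x - a)) \<in> borel_measurable haar" by measurable
  ultimately show ?thesis by (simp add: L2_def)
qed

lemma L2_translate: "f \<in> L2 haar \<Longrightarrow> (\<lambda>x. f (x - a)) \<in> L2 haar"
  using L2_affine[of f 0 a] by simp

lemma L2_dilate: "f \<in> L2 haar \<Longrightarrow> (\<lambda>x. f (2 powi j * x)) \<in> L2 haar"
  using L2_affine[of f j 0] by simp

lemma L2_dilation2: "f \<in> L2 haar \<Longrightarrow> dilation2 j f \<in> L2 haar"
  unfolding dilation2_def[abs_def] by (intro L2_cmult L2_dilate)

lemma l2_inner_translate:
  assumes "f \<in> L2 haar" "g \<in> L2 haar"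
  shows "l2_inner haar (\<lambda>x. f (x - a)) (\<lambda>x. g (x - a)) = l2_inner haar f g"
  unfolding l2_inner_def
  using haar_integral_affine[OF borel_measurable_integrable[OF L2_integrable_mult[OF assms]], of 0 a] by simp

lemma powr_half_sq: "2 powr (of_int j / 2) * 2 powr (of_int j / 2) = (2 powi j :: real)"
  by (simp add: powr_real_of_int' flip: powr_add)

lemma l2_inner_dilation2:
  assumes "f \<in> L2 haar" "g \<in> L2 haar"
  shows "l2_inner haar (dilation2 j f) (dilation2 j g) = l2_inner haar f g"
proof -
  have "l2_inner haar (dilation2 j f) (dilation2 j g)
      = of_real (2 powi j) * l2_inner haar (\<lambda>x. f (2 powi (- j) * x)) (\<lambda>x. g (2 powi (- j) * x))"
    unfolding dilation2_def[abs_def] l2_inner_cmult_left l2_inner_cmult_right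
    unfolding powr_half_sq[symmetric] by simp
  also have "l2_inner haar (\<lambda>x. f (2 powi (- j) * x)) (\<lambda>x. g (2 powi (- j) * x))
      = (2 powi (- j)) *\<^sub>R l2_inner haar f g"
    unfolding l2_inner_def
    using haar_integral_affine[OF borel_measurable_integrable[OF L2_integrable_mult[OF assms]], of "- j" 0]
    by (simp del: power_int_minus)
  finally show ?thesis by (simp add: scaleR_conv_of_real power_int_minus)
qed

lemma l2_norm_dilation2:
  assumes "f \<in> L2 haar" shows "l2_norm haar (dilation2 j f) = l2_norm haar f"
proof -
  have "(l2_norm haar (dilation2 j f))\<^sup>2 = (l2_norm haar f)\<^sup>2"
    using l2_inner_dilation2[OF assms assms, of j] unfolding l2_inner_self of_real_eq_iff .
  then show ?thesis by simp
qed

lemma dilation2_dilation2: "dilation2 i (dilation2 j f) = dilation2 (i + j) f"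
proof
  fix x :: q2
  have "(2::q2) powi (- (i + j)) = 2 powi (- j) * 2 powi (- i)"
    by (subst power_int_add[symmetric]) (simp_all add: algebra_simps)
  then have "2 powi (- (i + j)) * x = 2 powi (- j) * (2 powi (- i) * x)"
    by (simp only: mult.assoc)
  moreover have "2 powr (of_int (i + j) / 2) = 2 powr (of_int i / 2) * (2 powr (of_int j / 2) :: real)"
    by (simp add: add_divide_distrib powr_add)
  ultimately show "dilation2 i (dilation2 j f) x = dilation2 (i + j) f x"
    by (simp only: dilation2_def of_real_mult mult.assoc)
qed

lemma dilation2_0: "dilation2 0 f = f"
  by (simp add: dilation2_def fun_eq_iff)

lemma wavelet_system_eq_dilation2: "wavelet_system \<psi> (a, j) = dilation2 j (\<lambda>x. \<psi> (x - a))"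
  by (simp add: wavelet_system_def dilation2_def fun_eq_iff)

section \<open>The arithmetic of the shifts\<close>

text \<open>
  For \<open>k < 2 ^ n\<close> these are the shifts with at most \<open>n\<close> binary digits (\<open>shifts2_eq\<close>).
\<close>

definition dyadic_shift :: "nat \<Rightarrow> nat \<Rightarrow> q2" where
  "dyadic_shift n k = of_nat k / 2 ^ n"

lemma binary_digits_exist:
  "k < 2 ^ n \<Longrightarrow> \<exists>a :: nat \<Rightarrow> nat. (\<forall>i. a i \<in> {0, 1}) \<and> (\<Sum>i<n. a i * 2 ^ i) = k"
proof (induct n arbitrary: k)
  case 0
  then show ?case by (intro exI[of _ "\<lambda>_. 0"]) simp
next
  case (Suc n)
  have "k mod 2 ^ n < 2 ^ n" by simp
  from Suc.hyps[OF this] obtain a :: "nat \<Rightarrow> nat"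
    where a: "\<And>i. a i \<in> {0, 1}" "(\<Sum>i<n. a i * 2 ^ i) = k mod 2 ^ n" by blast
  have "k div 2 ^ n < 2" using Suc.prems by (simp add: less_mult_imp_div_less)
  then have d: "k div 2 ^ n \<in> {0, 1}" by auto
  have "(\<Sum>i<Suc n. (a(n := k div 2 ^ n)) i * 2 ^ i) = k mod 2 ^ n + k div 2 ^ n * 2 ^ n"
    using a(2) by simp
  also have "\<dots> = k" by (rule mod_div_mult_eq)
  finally show ?case using a(1) d by (intro exI[of _ "a(n := k div 2 ^ n)"]) auto
qed

lemma binary_digits_less: "(\<And>i. a i \<in> {0, 1 :: nat}) \<Longrightarrow> (\<Sum>i<n. a i * 2 ^ i) < 2 ^ n"
proof (induct n)
  case (Suc n)
  have "a n \<le> 1" using Suc.prems[of n] by auto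
  then have "a n * 2 ^ n \<le> 1 * 2 ^ n" by (intro mult_right_mono) auto
  moreover have "(\<Sum>i<n. a i * 2 ^ i) < 2 ^ n" by (rule Suc.hyps[OF Suc.prems])
  ultimately have "(\<Sum>i<n. a i * 2 ^ i) + a n * 2 ^ n < 2 ^ n + 1 * 2 ^ n" by (rule add_less_le_mono[rotated])
  then show ?case by simp
qed simp

lemma shifts2_eq: "shifts2 = (\<Union>n. dyadic_shift n ` {..<2 ^ n})"
proof -
  have e: "2 powi (- int n) * (\<Sum>i<n. of_nat (a i) * 2 ^ i) = dyadic_shift n (\<Sum>i<n. a i * 2 ^ i)"
    for n and a :: "nat \<Rightarrow> nat"
    by (simp add: dyadic_shift_def power_int_minus divide_inverse mult.commute)
  show ?thesis
  proof (intro equalityI subsetI)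
    fix x assume "x \<in> shifts2"
    then obtain n a where "\<And>i. a i \<in> {0, 1}" "x = dyadic_shift n (\<Sum>i<n. a i * 2 ^ i)"
      unfolding shifts2_def e by blast
    then show "x \<in> (\<Union>n. dyadic_shift n ` {..<2 ^ n})" using binary_digits_less[of a n] by blast
  next
    fix x assume "x \<in> (\<Union>n. dyadic_shift n ` {..<2 ^ n})"
    then obtain n k where k: "k < 2 ^ n" "x = dyadic_shift n k" by auto
    from binary_digits_exist[OF this(1)] obtain a :: "nat \<Rightarrow> nat"
      where "\<And>i. a i \<in> {0, 1}" "(\<Sum>i<n. a i * 2 ^ i) = k" by blast
    then show "x \<in> shifts2" unfolding shifts2_def e k(2) by blast
  qed
qed

lemma dyadic_shift_refine: "dyadic_shift (n + m) (k * 2 ^ m) = dyadic_shift n k"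
  by (simp add: dyadic_shift_def power_add)

lemma dyadic_shift_image_mono:
  assumes "m \<le> n" shows "dyadic_shift m ` {..<2 ^ m} \<subseteq> dyadic_shift n ` {..<2 ^ n}"
proof -
  obtain d where n: "n = m + d" using assms le_Suc_ex by blast
  show ?thesis
  proof (clarsimp)
    fix k :: nat assume "k < 2 ^ m"
    then have "k * 2 ^ d < 2 ^ n" by (simp add: n power_add)
    then show "dyadic_shift m k \<in> dyadic_shift n ` {..<2 ^ n}"
      using dyadic_shift_refine[of m d k] by (intro image_eqI[of _ _ "k * 2 ^ d"]) (auto simp: n)
  qed
qed

text \<open>
  The \<open>M\<close> leading binary digits of a fraction with \<open>M + N\<close> digits are those of 2-adic absolute value
  at most \<open>2 ^ M\<close>.  Division of the numerator by \<open>2 ^ N\<close> separates them from the others without a carry.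
\<close>

lemma dyadic_shift_split: "dyadic_shift (M + N) (l * 2 ^ N + h) = dyadic_shift M l + dyadic_shift (M + N) h"
  by (simp add: dyadic_shift_def power_add add_divide_distrib)

lemma inj_dyadic_shift: "inj (dyadic_shift n)"
  by (auto simp: inj_def dyadic_shift_def)

lemma bij_betw_quotient_remainder:
  "bij_betw (\<lambda>(l, h). l * 2 ^ N + h) ({..<2 ^ M} \<times> {..<2 ^ N}) {..<2 ^ (M + N) :: nat}"
proof (rule bij_betw_byWitness[where f' = "\<lambda>k. (k div 2 ^ N, k mod 2 ^ N)"])
  show "(\<lambda>(l, h). l * 2 ^ N + h) ` ({..<2 ^ M} \<times> {..<2 ^ N}) \<subseteq> {..<2 ^ (M + N) :: nat}"
  proof clarsimp
    fix l h :: nat assume lh: "l < 2 ^ M" "h < 2 ^ N"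
    then have "l * 2 ^ N + h < (l + 1) * 2 ^ N" by simp
    also have "\<dots> \<le> 2 ^ M * 2 ^ N" using lh by (intro mult_right_mono) auto
    finally show "l * 2 ^ N + h < 2 ^ (M + N)" by (simp add: power_add)
  qed
  show "(\<lambda>k. (k div 2 ^ N, k mod 2 ^ N)) ` {..<2 ^ (M + N) :: nat} \<subseteq> {..<2 ^ M} \<times> {..<2 ^ N}"
    by (auto simp: power_add less_mult_imp_div_less)
  show "\<forall>k\<in>{..<2 ^ (M + N) :: nat}. (\<lambda>(l, h). l * 2 ^ N + h) (k div 2 ^ N, k mod 2 ^ N) = k"
    by (simp only: prod.case div_mult_mod_eq) blast
qed auto

lemma norm2_of_int_gt:
  assumes "d \<noteq> 0" "\<bar>d\<bar> < 2 ^ N" shows "norm2 (of_int d) > 2 powi (- int N)"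
proof -
  have "multiplicity 2 d < N"
  proof (rule ccontr)
    assume "\<not> multiplicity 2 d < N"
    then have "2 ^ N dvd d" by (intro multiplicity_dvd') simp
    then have "\<bar>2 ^ N\<bar> \<le> \<bar>d\<bar>" using assms(1) by (intro dvd_imp_le_int)
    then show False using assms(2) by simp
  qed
  moreover have "norm2 (of_int d) = 2 powi (- int (multiplicity 2 d))"
    using norm2_of_rat[of "of_int d"] abs2_of_int[OF assms(1)] by simp
  ultimately show ?thesis by (simp only: powi_less_iff)
qed

text \<open>
  A nonzero integer smaller than \<open>2 ^ N\<close> is not divisible by \<open>2 ^ N\<close>, so the difference of the numerators
  has 2-adic absolute value larger than \<open>2 ^ (-N)\<close>.
\<close>

lemma dyadic_shift_separated:
  assumes "h < 2 ^ N" "h' < 2 ^ N" "h \<noteq> h'"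
  shows "norm2 (dyadic_shift (M + N) h - dyadic_shift (M + N) h') > 2 powi (int M)"
proof -
  have "dyadic_shift (M + N) h - dyadic_shift (M + N) h' = of_int (int h - int h') * 2 powi (- int (M + N))"
    by (simp add: dyadic_shift_def diff_divide_distrib divide_inverse power_int_minus left_diff_distrib del: of_nat_add)
  then have "norm2 (dyadic_shift (M + N) h - dyadic_shift (M + N) h')
      = norm2 (of_int (int h - int h')) * 2 powi (int (M + N))"
    by (simp only: norm2_mult norm2_power_int minus_minus)
  also have "\<dots> > 2 powi (- int N) * 2 powi (int (M + N))"
  proof (rule mult_strict_right_mono)
    have "int h < 2 ^ N" "int h' < 2 ^ N" using assms by (simp_all add: of_nat_less_numeral_power_cancel_iff)
    then have "\<bar>int h - int h'\<bar> < 2 ^ N" by linarith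
    then show "2 powi (- int N) < norm2 (of_int (int h - int h'))"
      using assms(3) by (intro norm2_of_int_gt) auto
  qed simp
  also have "2 powi (- int N) * 2 powi (int (M + N)) = (2 powi (int M) :: real)"
    by (simp flip: power_int_add)
  finally show ?thesis .
qed

lemma dyadic_shift_in_ball2:
  assumes "l < 2 ^ M" shows "dyadic_shift M l \<in> ball2 0 (- int M)"
proof -
  have "norm2 (of_nat l) \<le> 1"
  proof (cases "l = 0")
    case False
    then have "norm2 (of_nat l) = 2 powi (- int (multiplicity 2 (int l)))"
      using norm2_of_rat[of "of_int (int l)"] abs2_of_int[of "int l"] by simp
    also have "\<dots> \<le> 2 powi 0" by (rule power_int_increasing) auto
    finally show ?thesis by simp
  qed simp
  moreover have "dyadic_shift M l = of_nat l * 2 powi (- int M)"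
    by (simp add: dyadic_shift_def divide_inverse power_int_minus)
  then have "norm2 (dyadic_shift M l) = norm2 (of_nat l) * 2 powi (int M)"
    by (simp only: norm2_mult norm2_power_int minus_minus)
  ultimately show ?thesis by (simp add: ball2_def)
qed

text \<open>
  The digits are found one after the other, starting with the largest 2-adic absolute value: by \<open>norm2_residue\<close>
  subtracting 0 or \<open>2 ^ (-(M + N))\<close> halves the bound on the absolute value of \<open>x\<close>.
\<close>

lemma dyadic_shift_covers:
  assumes "norm2 x \<le> 2 powi (int (M + N))"
  shows "\<exists>h<2 ^ N. norm2 (x - dyadic_shift (M + N) h) \<le> 2 powi (int M)"
  using assms
proof (induct N arbitrary: x)
  case 0
  then show ?case by (simp add: dyadic_shift_def)
next
  case (Suc N)
  have ex: "- (- int (M + Suc N)) - 1 = int (M + N)" by simp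
  have "norm2 x \<le> 2 powi (- (- int (M + Suc N)))" using Suc.prems by (simp only: minus_minus)
  from norm2_residue[OF this] have
    "norm2 x \<le> 2 powi (int (M + N)) \<or> norm2 (x - 2 powi (- int (M + Suc N))) \<le> 2 powi (int (M + N))"
    unfolding ex .
  moreover have "2 powi (- int n) = dyadic_shift n 1" for n
    by (simp add: dyadic_shift_def power_int_minus divide_inverse)
  moreover have zero: "x - dyadic_shift (M + Suc N) 0 = x" by (simp add: dyadic_shift_def)
  ultimately have "norm2 (x - dyadic_shift (M + Suc N) 0) \<le> 2 powi (int (M + N))
      \<or> norm2 (x - dyadic_shift (M + Suc N) 1) \<le> 2 powi (int (M + N))"
    by (simp only:)
  then obtain e where e: "e < 2" "norm2 (x - dyadic_shift (M + Suc N) e) \<le> 2 powi (int (M + N))"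
    using that[of 0] that[of 1] by (elim disjE) simp_all
  from Suc.hyps[OF e(2)] obtain h where h: "h < 2 ^ N"
    "norm2 (x - dyadic_shift (M + Suc N) e - dyadic_shift (M + N) h) \<le> 2 powi (int M)" by blast
  have "dyadic_shift (M + Suc N) (e + 2 * h) = dyadic_shift (M + Suc N) e + dyadic_shift (M + N) h"
    by (simp add: dyadic_shift_def add_divide_distrib)
  then have "norm2 (x - dyadic_shift (M + Suc N) (e + 2 * h)) \<le> 2 powi (int M)"
    using h(2) by (simp add: diff_diff_eq)
  moreover have "e + 2 * h < 2 ^ Suc N" using e(1) h(1) by simp
  ultimately show ?case by blast
qed

section \<open>The frame inequality on one scale\<close>

lemma l2_closure_span_orthogonal:
  assumes S: "S \<subseteq> L2 M" and u: "u \<in> L2 M" and orth: "\<And>s. s \<in> S \<Longrightarrow> l2_inner M u s = 0"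
    and f: "f \<in> l2_closure M (complex_span S)"
  shows "l2_inner M f u = 0"
proof (rule ccontr)
  assume nz: "l2_inner M f u \<noteq> 0"
  define e where "e = cmod (l2_inner M f u) / (l2_norm M u + 1)"
  have pos: "l2_norm M u + 1 > 0" by (simp add: add_nonneg_pos)
  then have "e > 0" using nz by (simp add: e_def)
  then obtain g where g: "g \<in> complex_span S" "l2_norm M (\<lambda>x. f x - g x) < e"
    using f unfolding l2_closure_def by blast
  have fL: "f \<in> L2 M" using f by (simp add: l2_closure_def)
  obtain F c where F: "finite F" "F \<subseteq> S" "g = (\<lambda>x. \<Sum>s\<in>F. c s * s x)"
    using g(1) unfolding complex_span_def by blast
  have FL: "s \<in> L2 M" if "s \<in> F" for s using that F(2) S by blast
  have gL: "g \<in> L2 M" unfolding F(3) by (intro L2_sum L2_cmult FL)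
  have "l2_inner M s u = 0" if "s \<in> F" for s
    using orth[of s] that F(2) l2_inner_cnj[of M s u] by auto
  then have "l2_inner M g u = 0"
    unfolding F(3) using FL u by (subst l2_inner_sum_left) (auto simp: l2_inner_cmult_left)
  then have "cmod (l2_inner M f u) = cmod (l2_inner M (\<lambda>x. f x - g x) u)"
    using l2_inner_diff_left[OF fL gL u] by simp
  also have "\<dots> \<le> l2_norm M (\<lambda>x. f x - g x) * l2_norm M u"
    using fL gL u by (intro l2_Cauchy_Schwarz) auto
  also have "\<dots> \<le> e * l2_norm M u" using g(2) by (intro mult_right_mono) auto
  also have "\<dots> < e * (l2_norm M u + 1)" using \<open>e > 0\<close> by simp
  also have "\<dots> = cmod (l2_inner M f u)" using pos by (simp add: e_def)
  finally show False by simp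
qed

text \<open>
  The restriction of \<open>w\<close> to the coset \<open>b + B\<close> of the ball \<open>B\<close> of radius \<open>2 ^ M\<close>, translated back to \<open>B\<close>,
  so that the restrictions to all cosets can be compared with one finite family.
\<close>

definition local_part :: "nat \<Rightarrow> q2 \<Rightarrow> (q2 \<Rightarrow> complex) \<Rightarrow> q2 \<Rightarrow> complex" where
  "local_part M b w x = w (x + b) * indicator (ball2 0 (- int M)) x"

lemma L2_local_part [simp]: "w \<in> L2 haar \<Longrightarrow> local_part M b w \<in> L2 haar"
  unfolding local_part_def[abs_def] using L2_translate[of w "- b"] by (intro L2_mult_indicator) simp_all

lemma ball2_0_diff: "x \<in> ball2 0 n \<Longrightarrow> y \<in> ball2 0 n \<Longrightarrow> x - y \<in> ball2 0 n"
  using norm2_diff[of x y] by (auto simp: ball2_def)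

lemma ball2_0_add: "x \<in> ball2 0 n \<Longrightarrow> y \<in> ball2 0 n \<Longrightarrow> x + y \<in> ball2 0 n"
  using norm2_add[of x y] by (auto simp: ball2_def)

text \<open>
  Since \<open>\<psi>\<close> lives on \<open>B\<close> and \<open>B\<close> is a group, the translate by \<open>a + b\<close> lives on \<open>b + B\<close> and sees only that part
  of \<open>w\<close>.
\<close>

lemma l2_inner_local_part:
  assumes w: "w \<in> L2 haar" and psi: "\<psi> \<in> L2 haar"
    and supp: "AE x in haar. x \<notin> ball2 0 (- int M) \<longrightarrow> \<psi> x = 0"
    and a: "a \<in> ball2 0 (- int M)"
  shows "l2_inner haar w (\<lambda>x. \<psi> (x - (a + b))) = l2_inner haar (local_part M b w) (\<lambda>x. \<psi> (x - a))"
proof -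
  have "l2_inner haar w (\<lambda>x. \<psi> (x - (a + b))) = l2_inner haar (\<lambda>x. w (x + b)) (\<lambda>x. \<psi> (x - a))"
    using l2_inner_translate[of "\<lambda>x. w (x + b)" "\<lambda>x. \<psi> (x - a)" b]
      L2_translate[OF w, of "- b"] L2_translate[OF psi, of a] by (simp add: diff_diff_eq add.commute)
  also have "\<dots> = l2_inner haar (local_part M b w) (\<lambda>x. \<psi> (x - a))"
    unfolding l2_inner_def
  proof (rule integral_cong_AE)
    show "(\<lambda>x. w (x + b) * cnj (\<psi> (x - a))) \<in> borel_measurable haar"
      using L2_integrable_mult[of "\<lambda>x. w (x + b)" haar "\<lambda>x. \<psi> (x - a)"]
        L2_translate[OF w, of "- b"] L2_translate[OF psi, of a] by simp
    show "(\<lambda>x. local_part M b w x * cnj (\<psi> (x - a))) \<in> borel_measurable haar"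
      using L2_integrable_mult[of "local_part M b w" haar "\<lambda>x. \<psi> (x - a)"]
        w L2_translate[OF psi, of a] by simp
    have "AE x in haar. x - a \<notin> ball2 0 (- int M) \<longrightarrow> \<psi> (x - a) = 0"
      using haar_AE_affine[OF supp, of 0 a] by simp
    then show "AE x in haar. w (x + b) * cnj (\<psi> (x - a)) = local_part M b w x * cnj (\<psi> (x - a))"
    proof eventually_elim
      fix x assume "x - a \<notin> ball2 0 (- int M) \<longrightarrow> \<psi> (x - a) = 0"
      moreover have "x \<in> ball2 0 (- int M)" if "x - a \<in> ball2 0 (- int M)"
        using ball2_0_add[OF that a] by simp
      ultimately show "w (x + b) * cnj (\<psi> (x - a)) = local_part M b w x * cnj (\<psi> (x - a))"
        by (auto simp: local_part_def indicator_def)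
    qed
  qed
  finally show ?thesis .
qed

lemma local_part_far:
  assumes "norm2 (b - b') > 2 powi (int M)"
  shows "local_part M b (\<lambda>x. local_part M c g (x - b')) = (\<lambda>x. 0)"
proof
  fix x
  have "\<not> (x \<in> ball2 0 (- int M) \<and> x + b - b' \<in> ball2 0 (- int M))"
  proof
    assume "x \<in> ball2 0 (- int M) \<and> x + b - b' \<in> ball2 0 (- int M)"
    then have "(x + b - b') - x \<in> ball2 0 (- int M)" by (blast intro: ball2_0_diff)
    then have "b - b' \<in> ball2 0 (- int M)" by (simp add: algebra_simps)
    then show False using assms by (simp add: ball2_def)
  qed
  then show "local_part M b (\<lambda>x. local_part M c g (x - b')) x = 0"
    by (auto simp: local_part_def indicator_def)
qed

text \<open>
  A function \<open>g\<close> orthogonal to the translates \<open>\<psi>\<^sub>a\<close>, \<open>a \<in> {l / 2 ^ M | l < 2 ^ M}\<close>, stays orthogonal to all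
  translates after it is cut off to \<open>B\<close> and moved to \<open>b + B\<close>: there it meets only the \<open>\<psi>\<^bsub>a+b\<^esub>\<close>.  Hence it is
  orthogonal to the closed span of all translates, and in particular to \<open>w\<close>.
\<close>

lemma local_part_shift_space_double_perp:
  assumes psi: "\<psi> \<in> L2 haar"
    and supp: "AE x in haar. x \<notin> ball2 0 (- int M) \<longrightarrow> \<psi> x = 0"
    and w: "w \<in> shift_space \<psi>" and h: "h < 2 ^ N" and g: "g \<in> L2 haar"
    and perp: "\<And>l. l < 2 ^ M \<Longrightarrow> l2_inner haar g (\<lambda>x. \<psi> (x - dyadic_shift M l)) = 0"
  shows "l2_inner haar (local_part M (dyadic_shift (M + N) h) w) g = 0"
proof -
  define b where "b = dyadic_shift (M + N) h"
  define G where "G x = local_part M 0 g (x - b)" for x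
  have wL: "w \<in> L2 haar" using w by (simp add: shift_space_def l2_closure_def)
  have G: "G \<in> L2 haar" unfolding G_def using g by (intro L2_translate L2_local_part)
  have orth: "l2_inner haar G (\<lambda>x. \<psi> (x - a)) = 0" if a: "a \<in> shifts2" for a
  proof -
    \<comment> \<open>Both \<open>a\<close> and \<open>b\<close> are written with \<open>M + (N + n)\<close> digits, so that their last digits can be compared.\<close>
    obtain n where "a \<in> dyadic_shift n ` {..<2 ^ n}" using a unfolding shifts2_eq by blast
    then have "a \<in> dyadic_shift (M + (N + n)) ` {..<2 ^ (M + (N + n))}"
      using dyadic_shift_image_mono[of n "M + (N + n)"] by auto
    then obtain k where k: "k < 2 ^ (M + (N + n))" "a = dyadic_shift (M + (N + n)) k" by blast
    define l where "l = k div 2 ^ (N + n)"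
    define h' where "h' = k mod 2 ^ (N + n)"
    have kl: "k = l * 2 ^ (N + n) + h'" unfolding l_def h'_def by (rule div_mult_mod_eq[symmetric])
    have l: "l < 2 ^ M"
      unfolding l_def by (rule less_mult_imp_div_less) (use k(1) in \<open>simp add: power_add\<close>)
    have h': "h' < 2 ^ (N + n)" by (simp add: h'_def)
    define b' where "b' = dyadic_shift (M + (N + n)) h'"
    have a': "a = dyadic_shift M l + b'" unfolding k(2) kl dyadic_shift_split b'_def ..
    have bb: "b = dyadic_shift (M + (N + n)) (h * 2 ^ n)"
      using dyadic_shift_refine[of "M + N" n h] by (simp add: b_def add.assoc)
    have "l2_inner haar G (\<lambda>x. \<psi> (x - a)) = l2_inner haar (local_part M b' G) (\<lambda>x. \<psi> (x - dyadic_shift M l))"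
      unfolding a' by (rule l2_inner_local_part[OF G psi supp dyadic_shift_in_ball2[OF l]])
    also have "\<dots> = 0"
    proof (cases "h' = h * 2 ^ n")
      case True
      then have "b' = b" unfolding b'_def bb by simp
      then have "local_part M b' G = local_part M 0 g"
        by (auto simp: local_part_def G_def fun_eq_iff indicator_def)
      then show ?thesis
        using l2_inner_local_part[OF g psi supp dyadic_shift_in_ball2[OF l], of 0] perp[OF l]
        by simp
    next
      case False
      have "h * 2 ^ n < 2 ^ (N + n)" using h by (simp add: power_add)
      from dyadic_shift_separated[OF h' this False, of M]
      have "local_part M b' G = (\<lambda>x. 0)"
        unfolding G_def[abs_def] b'_def[symmetric] bb[symmetric] by (rule local_part_far)
      then show ?thesis by (simp add: l2_inner_def)
    qed
    finally show ?thesis .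
  qed
  have "l2_inner haar w G = 0"
  proof (rule l2_closure_span_orthogonal[OF _ G])
    show "{\<lambda>x. \<psi> (x - a) |a. a \<in> shifts2} \<subseteq> L2 haar" using psi L2_translate by blast
    show "w \<in> l2_closure haar (complex_span {\<lambda>x. \<psi> (x - a) |a. a \<in> shifts2})"
      using w by (simp add: shift_space_def)
  qed (use orth in blast)
  also have "l2_inner haar w G = l2_inner haar (\<lambda>x. w (x + b)) (local_part M 0 g)"
    using l2_inner_translate[of "\<lambda>x. w (x + b)" "local_part M 0 g" b] L2_translate[OF wL, of "- b"] g
    by (simp add: G_def[abs_def])
  also have "\<dots> = l2_inner haar (local_part M b w) g"
    unfolding l2_inner_def local_part_def by (intro Bochner_Integration.integral_cong) (auto simp: indicator_def)
  finally show ?thesis by (simp add: b_def)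
qed

text \<open>
  The ball of radius \<open>2 ^ (M + N)\<close> is the disjoint union of the cosets \<open>b + B\<close> over the \<open>2 ^ N\<close> fractions
  \<open>b = h / 2 ^ (M + N)\<close>.
\<close>

lemma indicator_ball2_sum:
  "(\<Sum>h<2 ^ N. indicator (ball2 0 (- int M)) (x - dyadic_shift (M + N) h))
    = (indicator (ball2 0 (- int (M + N))) x :: real)"
proof (cases "x \<in> ball2 0 (- int (M + N))")
  case True
  then obtain h where h: "h < 2 ^ N" "x - dyadic_shift (M + N) h \<in> ball2 0 (- int M)"
    using dyadic_shift_covers[of x M N] unfolding ball2_def minus_minus diff_zero mem_Collect_eq by blast
  have uniq: "x - dyadic_shift (M + N) k \<notin> ball2 0 (- int M)" if "k < 2 ^ N" "k \<noteq> h" for k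
  proof
    assume "x - dyadic_shift (M + N) k \<in> ball2 0 (- int M)"
    from ball2_0_diff[OF this h(2)] have "dyadic_shift (M + N) h - dyadic_shift (M + N) k \<in> ball2 0 (- int M)"
      by simp
    then show False using dyadic_shift_separated[OF h(1) that(1), of M] that(2) by (simp add: ball2_def)
  qed
  have "(\<Sum>k<2 ^ N. indicator (ball2 0 (- int M)) (x - dyadic_shift (M + N) k))
      = (\<Sum>k<2 ^ N. if k = h then 1 else 0 :: real)"
    using uniq h(2) by (intro sum.cong) (auto simp: indicator_def)
  also have "\<dots> = 1" using h(1) by simp
  finally show ?thesis using True by simp
next
  case False
  have "x - dyadic_shift (M + N) h \<notin> ball2 0 (- int M)" if "h < 2 ^ N" for h
  proof
    assume "x - dyadic_shift (M + N) h \<in> ball2 0 (- int M)"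
    moreover have "(2::nat) ^ N \<le> 2 ^ (M + N)" by (rule power_increasing) simp_all
    then have "h < 2 ^ (M + N)" using that by linarith
    ultimately have "x - dyadic_shift (M + N) h \<in> ball2 0 (- int (M + N))"
      "dyadic_shift (M + N) h \<in> ball2 0 (- int (M + N))"
      using ball2_mono[of 0 0 "- int M" 0 "- int (M + N)"] dyadic_shift_in_ball2[of h "M + N"]
      by (auto simp: ball2_def)
    from ball2_0_add[OF this] show False using False by simp
  qed
  then show ?thesis using False by (auto simp: indicator_def intro!: sum.neutral)
qed

lemma l2_norm_local_parts:
  assumes w: "w \<in> L2 haar"
  shows "(l2_norm haar (\<lambda>x. w x * indicator (ball2 0 (- int (M + N))) x))\<^sup>2
    = (\<Sum>h<2 ^ N. (l2_norm haar (local_part M (dyadic_shift (M + N) h) w))\<^sup>2)"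
proof -
  define p where "p b x = (cmod (local_part M b w x))\<^sup>2" for b x
  have p: "integrable haar (p b)" for b
    unfolding p_def using L2_integrable[OF L2_local_part[OF w]] .
  then have [measurable]: "p b \<in> borel_measurable haar" for b by (rule borel_measurable_integrable)
  have p': "integrable haar (\<lambda>x. p b (x - b))" for b
    using haar_integrable_affine_iff[of "p b" 0 b] p by simp
  have eq: "(cmod (w x * indicator (ball2 0 (- int (M + N))) x))\<^sup>2
      = (\<Sum>h<2 ^ N. p (dyadic_shift (M + N) h) (x - dyadic_shift (M + N) h))" for x
  proof -
    have "(cmod (w x * indicator (ball2 0 (- int (M + N))) x))\<^sup>2
        = (cmod (w x))\<^sup>2 * indicator (ball2 0 (- int (M + N))) x" by (simp add: indicator_def)
    also have "\<dots> = (\<Sum>h<2 ^ N. (cmod (w x))\<^sup>2 * indicator (ball2 0 (- int M)) (x - dyadic_shift (M + N) h))"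
      unfolding indicator_ball2_sum[symmetric] by (rule sum_distrib_left)
    also have "\<dots> = (\<Sum>h<2 ^ N. p (dyadic_shift (M + N) h) (x - dyadic_shift (M + N) h))"
      by (intro sum.cong) (auto simp: p_def local_part_def indicator_def)
    finally show ?thesis .
  qed
  have "(l2_norm haar (\<lambda>x. w x * indicator (ball2 0 (- int (M + N))) x))\<^sup>2
      = (\<Sum>h<2 ^ N. LINT x|haar. p (dyadic_shift (M + N) h) (x - dyadic_shift (M + N) h))"
    unfolding l2_norm_power2 eq by (rule Bochner_Integration.integral_sum) (rule p')
  also have "\<dots> = (\<Sum>h<2 ^ N. LINT x|haar. p (dyadic_shift (M + N) h) x)"
    using haar_integral_affine[of "p b" 0 b for b] by simp
  finally show ?thesis unfolding l2_norm_power2 p_def .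
qed

text \<open>
  The sum runs over the shifts in the ball of radius \<open>2 ^ (M + N)\<close>; the constants do not depend on \<open>N\<close>, because
  each of the \<open>2 ^ N\<close> cosets of \<open>B\<close> in this ball contributes the inequality for the same finite family
  \<open>v l = \<psi>\<^bsub>l / 2 ^ M\<^esub>\<close>.
\<close>

lemma shift_space_frame_inequality:
  assumes psi: "\<psi> \<in> L2 haar"
    and supp: "AE x in haar. x \<notin> ball2 0 (- int M) \<longrightarrow> \<psi> x = 0"
  shows "\<exists>A>0. \<exists>B>0. \<forall>w\<in>shift_space \<psi>. \<forall>N.
    A * (l2_norm haar (\<lambda>x. w x * indicator (ball2 0 (- int (M + N))) x))\<^sup>2
      \<le> (\<Sum>a\<in>dyadic_shift (M + N) ` {..<2 ^ (M + N)}. (cmod (l2_inner haar w (\<lambda>x. \<psi> (x - a))))\<^sup>2) \<and>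
    (\<Sum>a\<in>dyadic_shift (M + N) ` {..<2 ^ (M + N)}. (cmod (l2_inner haar w (\<lambda>x. \<psi> (x - a))))\<^sup>2)
      \<le> B * (l2_norm haar w)\<^sup>2"
proof -
  define v where "v l x = \<psi> (x - dyadic_shift M l)" for l x
  have v: "v l \<in> L2 haar" for l unfolding v_def using psi by (rule L2_translate)
  have norm_v: "l2_norm haar (v l) = l2_norm haar \<psi>" for l
  proof -
    have "(l2_norm haar (v l))\<^sup>2 = (l2_norm haar \<psi>)\<^sup>2"
      using l2_inner_translate[OF psi psi, of "dyadic_shift M l"]
      unfolding l2_inner_self of_real_eq_iff v_def[abs_def] .
    then show ?thesis by simp
  qed
  obtain A where A: "A > 0" "\<And>f. f \<in> L2 haar \<Longrightarrow>
      (\<And>g. g \<in> L2 haar \<Longrightarrow> (\<And>l. l < 2 ^ M \<Longrightarrow> l2_inner haar g (v l) = 0) \<Longrightarrow> l2_inner haar f g = 0) \<Longrightarrow>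
      A * (l2_norm haar f)\<^sup>2 \<le> (\<Sum>l<2 ^ M. (cmod (l2_inner haar f (v l)))\<^sup>2)"
    using finite_family_lower_frame_bound[of "{..<2 ^ M}" v haar] v by (metis finite_lessThan lessThan_iff)
  \<comment> \<open>The summand 1 keeps the constant positive if \<open>\<psi>\<close> vanishes almost everywhere.\<close>
  define B where "B = 2 ^ M * (l2_norm haar \<psi>)\<^sup>2 + 1"
  have B: "B > 0" unfolding B_def by (simp add: add_nonneg_pos)
  have upper: "(\<Sum>l<2 ^ M. (cmod (l2_inner haar f (v l)))\<^sup>2) \<le> B * (l2_norm haar f)\<^sup>2"
    if f: "f \<in> L2 haar" for f
  proof -
    have "(cmod (l2_inner haar f (v l)))\<^sup>2 \<le> (l2_norm haar f * l2_norm haar \<psi>)\<^sup>2" for l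
      using l2_Cauchy_Schwarz[OF f v[of l]] by (intro power_mono) (simp_all add: norm_v)
    then have "(\<Sum>l<2 ^ M. (cmod (l2_inner haar f (v l)))\<^sup>2) \<le> (\<Sum>l<2 ^ M :: nat. (l2_norm haar f * l2_norm haar \<psi>)\<^sup>2)"
      by (intro sum_mono)
    also have "\<dots> \<le> B * (l2_norm haar f)\<^sup>2" by (simp add: B_def power_mult_distrib algebra_simps)
    finally show ?thesis .
  qed
  have main: "A * (l2_norm haar (\<lambda>x. w x * indicator (ball2 0 (- int (M + N))) x))\<^sup>2
      \<le> (\<Sum>a\<in>dyadic_shift (M + N) ` {..<2 ^ (M + N)}. (cmod (l2_inner haar w (\<lambda>x. \<psi> (x - a))))\<^sup>2) \<and>
    (\<Sum>a\<in>dyadic_shift (M + N) ` {..<2 ^ (M + N)}. (cmod (l2_inner haar w (\<lambda>x. \<psi> (x - a))))\<^sup>2)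
      \<le> B * (l2_norm haar w)\<^sup>2" if w: "w \<in> shift_space \<psi>" for w N
  proof -
    have wL: "w \<in> L2 haar" using w by (simp add: shift_space_def l2_closure_def)
    let ?I = "\<lambda>x. indicator (ball2 0 (- int (M + N))) x"
    let ?w = "\<lambda>h. local_part M (dyadic_shift (M + N) h) w"
    have wh: "?w h \<in> L2 haar" for h using wL by simp
    have "(\<Sum>a\<in>dyadic_shift (M + N) ` {..<2 ^ (M + N)}. (cmod (l2_inner haar w (\<lambda>x. \<psi> (x - a))))\<^sup>2)
        = (\<Sum>k<2 ^ (M + N). (cmod (l2_inner haar w (\<lambda>x. \<psi> (x - dyadic_shift (M + N) k))))\<^sup>2)"
      by (subst sum.reindex) (auto intro: inj_on_subset[OF inj_dyadic_shift])
    also have "\<dots> = (\<Sum>(l, h)\<in>{..<2 ^ M} \<times> {..<2 ^ N}. (cmod (l2_inner haar w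
        (\<lambda>x. \<psi> (x - dyadic_shift (M + N) (l * 2 ^ N + h)))))\<^sup>2)"
      by (subst sum.reindex_bij_betw[OF bij_betw_quotient_remainder[of N M], symmetric]) (simp add: case_prod_unfold)
    also have "\<dots> = (\<Sum>(l, h)\<in>{..<2 ^ M} \<times> {..<2 ^ N}. (cmod (l2_inner haar (?w h) (v l)))\<^sup>2)"
      unfolding dyadic_shift_split v_def
      by (intro sum.cong) (auto simp: l2_inner_local_part[OF wL psi supp] dyadic_shift_in_ball2)
    also have "\<dots> = (\<Sum>h<2 ^ N. \<Sum>l<2 ^ M. (cmod (l2_inner haar (?w h) (v l)))\<^sup>2)"
      by (subst sum.swap) (simp add: sum.cartesian_product)
    finally have S: "(\<Sum>a\<in>dyadic_shift (M + N) ` {..<2 ^ (M + N)}. (cmod (l2_inner haar w (\<lambda>x. \<psi> (x - a))))\<^sup>2)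
        = (\<Sum>h<2 ^ N. \<Sum>l<2 ^ M. (cmod (l2_inner haar (?w h) (v l)))\<^sup>2)" .
    have n: "(l2_norm haar (\<lambda>x. w x * ?I x))\<^sup>2 = (\<Sum>h<2 ^ N. (l2_norm haar (?w h))\<^sup>2)"
      by (rule l2_norm_local_parts[OF wL])
    have "(l2_norm haar (\<lambda>x. w x * ?I x))\<^sup>2 \<le> (l2_norm haar w)\<^sup>2"
      unfolding l2_norm_power2 using wL L2_mult_indicator[OF wL, of "ball2 0 (- int (M + N))"]
      by (intro integral_mono L2_integrable) (auto simp: indicator_def)
    then have "B * (\<Sum>h<2 ^ N. (l2_norm haar (?w h))\<^sup>2) \<le> B * (l2_norm haar w)\<^sup>2"
      unfolding n using B by simp
    moreover have "(\<Sum>h<2 ^ N. \<Sum>l<2 ^ M. (cmod (l2_inner haar (?w h) (v l)))\<^sup>2)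
        \<le> B * (\<Sum>h<2 ^ N. (l2_norm haar (?w h))\<^sup>2)"
      unfolding sum_distrib_left by (intro sum_mono upper wh)
    moreover have "A * (\<Sum>h<2 ^ N. (l2_norm haar (?w h))\<^sup>2)
        \<le> (\<Sum>h<2 ^ N. \<Sum>l<2 ^ M. (cmod (l2_inner haar (?w h) (v l)))\<^sup>2)"
      unfolding sum_distrib_left
    proof (intro sum_mono A(2) wh)
      fix h g assume "h \<in> {..<2 ^ N :: nat}" "g \<in> L2 haar" "\<And>l. l < 2 ^ M \<Longrightarrow> l2_inner haar g (v l) = 0"
      then show "l2_inner haar (?w h) g = 0"
        by (intro local_part_shift_space_double_perp[OF psi supp w]) (auto simp: v_def[abs_def])
    qed
    ultimately show ?thesis unfolding S n by linarith
  qed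
  show ?thesis
    by (rule exI[of _ A], rule conjI[OF A(1)], rule exI[of _ B], rule conjI[OF B]) (intro ballI allI main)
qed

lemma l2_norm_truncation_LIMSEQ:
  assumes w: "w \<in> L2 haar"
  shows "(\<lambda>N. (l2_norm haar (\<lambda>x. w x * indicator (ball2 0 (- int (M + N))) x))\<^sup>2) \<longlonglongrightarrow> (l2_norm haar w)\<^sup>2"
  unfolding l2_norm_power2
proof (rule integral_dominated_convergence)
  have [measurable]: "w \<in> borel_measurable haar" using w by (rule L2_measurable)
  show "(\<lambda>x. (cmod (w x))\<^sup>2) \<in> borel_measurable haar" by measurable
  show "(\<lambda>x. (cmod (w x * indicator (ball2 0 (- int (M + N))) x))\<^sup>2) \<in> borel_measurable haar" for N
    using L2_integrable[OF L2_mult_indicator[OF w, of "ball2 0 (- int (M + N))"]] by simp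
  show "integrable haar (\<lambda>x. (cmod (w x))\<^sup>2)" using w by (rule L2_integrable)
  show "AE x in haar. norm ((cmod (w x * indicator (ball2 0 (- int (M + N))) x))\<^sup>2) \<le> (cmod (w x))\<^sup>2" for N
    by (auto simp: indicator_def)
  show "AE x in haar. (\<lambda>N. (cmod (w x * indicator (ball2 0 (- int (M + N))) x))\<^sup>2) \<longlonglongrightarrow> (cmod (w x))\<^sup>2"
  proof (rule AE_I2)
    fix x
    obtain N0 where N0: "norm2 x < 2 ^ N0" using real_arch_pow[of 2 "norm2 x"] by auto
    show "(\<lambda>N. (cmod (w x * indicator (ball2 0 (- int (M + N))) x))\<^sup>2) \<longlonglongrightarrow> (cmod (w x))\<^sup>2"
    proof (rule tendsto_eventually, rule eventually_sequentiallyI)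
      fix N assume "N \<ge> N0"
      then have "(2::real) ^ N0 \<le> 2 ^ (M + N)" by (intro power_increasing) auto
      then have "norm2 x \<le> 2 powi (int (M + N))" using N0 unfolding power_int_of_nat by linarith
      then have "x \<in> ball2 0 (- int (M + N))" unfolding ball2_def minus_minus diff_zero by (rule CollectI)
      then show "(cmod (w x * indicator (ball2 0 (- int (M + N))) x))\<^sup>2 = (cmod (w x))\<^sup>2" by simp
    qed
  qed
qed

section \<open>The orthogonal decomposition into scales\<close>

lemma compactly_supported_ball2:
  assumes "compactly_supported \<psi>"
  shows "\<exists>M. AE x in haar. x \<notin> ball2 0 (- int M) \<longrightarrow> \<psi> x = 0"
proof -
  obtain K where K: "compact K" "AE x in haar. x \<notin> K \<longrightarrow> \<psi> x = 0"
    using assms unfolding compactly_supported_def by blast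
  obtain e where e: "\<And>x. x \<in> K \<Longrightarrow> dist 0 x \<le> e"
    using compact_imp_bounded[OF K(1)] unfolding bounded_any_center[of K 0] by blast
  obtain M where M: "e < 2 ^ M" using real_arch_pow[of 2 e] by auto
  have "K \<subseteq> ball2 0 (- int M)"
    using e M unfolding ball2_def by (force simp: dist_q2_def)
  then show ?thesis using K(2) by (intro exI[of _ M]) (auto elim!: eventually_mono)
qed

lemma closed_l2_subspace_cmult_iff:
  assumes "closed_l2_subspace M V" "c \<noteq> 0" shows "(\<lambda>x. c * f x) \<in> V \<longleftrightarrow> f \<in> V"
  using closed_l2_subspaceD(4)[OF assms(1), of f c]
    closed_l2_subspaceD(4)[OF assms(1), of "\<lambda>x. c * f x" "inverse c"] assms(2)
  by (auto simp flip: mult.assoc)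

lemma mra_closed: "mra V \<Longrightarrow> closed_l2_subspace haar (V j)"
  by (simp add: mra_def)

lemma mra_mono:
  assumes "mra V" "i \<le> j" shows "V i \<subseteq> V j"
  using assms(2)
proof (induct rule: int_ge_induct)
  case (step i)
  moreover have "V i \<subseteq> V (i + 1)" using assms(1) by (simp add: mra_def)
  ultimately show ?case by blast
qed simp

lemma mra_dilation2_nat:
  assumes V: "mra V" and f: "f \<in> L2 haar"
  shows "dilation2 (int n) f \<in> V (j + int n) \<longleftrightarrow> f \<in> V j"
proof (induct n)
  case 0
  then show ?case by (simp add: dilation2_0)
next
  case (Suc n)
  define g where "g = dilation2 (int n) f"
  have g: "g \<in> L2 haar" unfolding g_def using f by (rule L2_dilation2)
  have "dilation2 (int (Suc n)) f = dilation2 1 g" by (simp add: g_def dilation2_dilation2)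
  moreover have "dilation2 1 g \<in> V (j + int n + 1) \<longleftrightarrow> (\<lambda>x. g (2 powi (-1) * x)) \<in> V (j + int n + 1)"
    unfolding dilation2_def[abs_def] by (rule closed_l2_subspace_cmult_iff[OF mra_closed[OF V]]) simp
  moreover have "\<dots> \<longleftrightarrow> g \<in> V (j + int n)" using V g unfolding mra_def by blast
  moreover have "j + int (Suc n) = j + int n + 1" by simp
  ultimately show ?case using Suc unfolding g_def by (simp only:)
qed

lemma mra_dilation2:
  assumes V: "mra V" and f: "f \<in> L2 haar"
  shows "dilation2 i f \<in> V (j + i) \<longleftrightarrow> f \<in> V j"
proof (cases i rule: int_cases2)
  case (nonneg n)
  then show ?thesis using mra_dilation2_nat[OF V f] by simp
next
  case (nonpos n)
  have "dilation2 (int n) (dilation2 i f) \<in> V (j + i + int n) \<longleftrightarrow> dilation2 i f \<in> V (j + i)"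
    by (rule mra_dilation2_nat[OF V L2_dilation2[OF f]])
  then show ?thesis by (simp add: nonpos dilation2_dilation2 dilation2_0)
qed

lemma wavelet_space_dilation2:
  assumes V: "mra V" and f: "f \<in> wavelet_space V j"
  shows "dilation2 i f \<in> wavelet_space V (j + i)"
proof -
  have fV: "f \<in> V (j + 1)" "\<And>g. g \<in> V j \<Longrightarrow> l2_inner haar f g = 0"
    using f by (auto simp: wavelet_space_def)
  have fL: "f \<in> L2 haar" using closed_l2_subspaceD(1)[OF mra_closed[OF V] fV(1)] .
  have "dilation2 i f \<in> V (j + i + 1)"
    using mra_dilation2[OF V fL, of i "j + 1"] fV(1) by (simp add: ac_simps)
  moreover have "l2_inner haar (dilation2 i f) g = 0" if g: "g \<in> V (j + i)" for g
  proof -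
    have gL: "g \<in> L2 haar" using closed_l2_subspaceD(1)[OF mra_closed[OF V] g] .
    have "dilation2 (- i) g \<in> V j" using mra_dilation2[OF V gL, of "- i" "j + i"] g by simp
    then have "l2_inner haar f (dilation2 (- i) g) = 0" by (rule fV(2))
    moreover have "dilation2 i (dilation2 (- i) g) = g" by (simp add: dilation2_dilation2 dilation2_0)
    ultimately show ?thesis using l2_inner_dilation2[OF fL L2_dilation2[OF gL], of i "- i"] by simp
  qed
  ultimately show ?thesis by (simp add: wavelet_space_def)
qed

lemma translate_in_shift_space:
  assumes "\<psi> \<in> L2 haar" "a \<in> shifts2" shows "(\<lambda>x. \<psi> (x - a)) \<in> shift_space \<psi>"
proof -
  let ?s = "\<lambda>x. \<psi> (x - a)"
  have "?s = (\<lambda>x. \<Sum>g\<in>{?s}. 1 * g x)" by simp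
  then have "?s \<in> complex_span {\<lambda>x. \<psi> (x - a) |a. a \<in> shifts2}"
    unfolding complex_span_def using assms(2)
    by (intro CollectI exI[of _ "{?s}"] exI[of _ "\<lambda>_. 1"]) auto
  moreover have "l2_norm haar (\<lambda>x. ?s x - ?s x) = 0" by (simp add: l2_norm_def)
  ultimately show ?thesis
    unfolding shift_space_def l2_closure_def using L2_translate[OF assms(1), of a]
    by (auto intro!: bexI[of _ ?s])
qed

lemma wavelet_system_in_wavelet_space:
  assumes "mra V" "wavelet_function V \<psi>" "a \<in> shifts2"
  shows "wavelet_system \<psi> (a, j) \<in> wavelet_space V j"
  using wavelet_space_dilation2[of V "\<lambda>x. \<psi> (x - a)" 0 j] translate_in_shift_space[of \<psi> a] assms
  by (simp add: wavelet_system_eq_dilation2 wavelet_function_def)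

definition mra_projections ::
  "(int \<Rightarrow> (q2 \<Rightarrow> complex) set) \<Rightarrow> (q2 \<Rightarrow> complex) \<Rightarrow> (int \<Rightarrow> q2 \<Rightarrow> complex) \<Rightarrow> bool" where
  "mra_projections V f p \<longleftrightarrow> (\<forall>j. p j \<in> V j \<and> (\<forall>g\<in>V j. l2_inner haar (\<lambda>x. f x - p j x) g = 0))"

lemma mra_projections_exist: "mra V \<Longrightarrow> f \<in> L2 haar \<Longrightarrow> \<exists>p. mra_projections V f p"
  unfolding mra_projections_def using l2_projection_exists[OF mra_closed, of V f] by metis

context
  fixes V f p
  assumes V: "mra V" and f: "f \<in> L2 haar" and p: "mra_projections V f p"
begin

lemma mra_projection_in: "p j \<in> V j"
  using p by (simp add: mra_projections_def)

lemma mra_projection_L2: "p j \<in> L2 haar"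
  using closed_l2_subspaceD(1)[OF mra_closed[OF V] mra_projection_in] .

lemma mra_projection_inner: "g \<in> V j \<Longrightarrow> l2_inner haar (p j) g = l2_inner haar f g"
  using p l2_inner_diff_left[OF f mra_projection_L2[of j], of g]
    closed_l2_subspaceD(1)[OF mra_closed[OF V], of g j] by (simp add: mra_projections_def)

lemma mra_projection_pythagoras:
  assumes "g \<in> V j"
  shows "(l2_norm haar (\<lambda>x. f x - g x))\<^sup>2 =
    (l2_norm haar (\<lambda>x. f x - p j x))\<^sup>2 + (l2_norm haar (\<lambda>x. p j x - g x))\<^sup>2"
proof -
  have d: "(\<lambda>x. p j x - g x) \<in> V j"
    by (rule closed_l2_subspaceD(5)[OF mra_closed[OF V] mra_projection_in assms])
  then have "l2_inner haar (\<lambda>x. f x - p j x) (\<lambda>x. p j x - g x) = 0"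
    using p by (simp add: mra_projections_def)
  from l2_pythagoras[OF L2_diff[OF f mra_projection_L2] _ this]
  show ?thesis using closed_l2_subspaceD(1)[OF mra_closed[OF V] d] by simp
qed

lemma mra_projection_norm: "(l2_norm haar f)\<^sup>2 = (l2_norm haar (\<lambda>x. f x - p j x))\<^sup>2 + (l2_norm haar (p j))\<^sup>2"
  using mra_projection_pythagoras[OF closed_l2_subspaceD(2)[OF mra_closed[OF V]], of j] by simp

lemma mra_projection_increment:
  assumes "i \<le> j" "g \<in> V i" shows "l2_inner haar (\<lambda>x. p j x - p i x) g = 0"
proof -
  have "g \<in> V j" using assms mra_mono[OF V] by blast
  then show ?thesis
    using mra_projection_inner assms(2) closed_l2_subspaceD(1)[OF mra_closed[OF V] assms(2)]
    by (simp add: l2_inner_diff_left mra_projection_L2)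
qed

lemma mra_projection_increment_norm:
  assumes "i \<le> j"
  shows "(l2_norm haar (\<lambda>x. p j x - p i x))\<^sup>2 = (l2_norm haar (p j))\<^sup>2 - (l2_norm haar (p i))\<^sup>2"
  using l2_pythagoras[OF L2_diff[OF mra_projection_L2 mra_projection_L2] mra_projection_L2
      mra_projection_increment[OF assms mra_projection_in]] by simp

lemma mra_projection_increment_wavelet: "(\<lambda>x. p (j + 1) x - p j x) \<in> wavelet_space V j"
proof -
  have "p j \<in> V (j + 1)" using mra_projection_in[of j] mra_mono[OF V, of j "j + 1"] by auto
  then show ?thesis unfolding wavelet_space_def
    using closed_l2_subspaceD(5)[OF mra_closed[OF V] mra_projection_in] mra_projection_increment[of j "j + 1"]
    by simp
qed

text \<open>
  Wavelets of scale \<open>j\<close> lie in \<open>V (j + 1)\<close> and are orthogonal to \<open>V j\<close>, so they do not distinguish \<open>f\<close> from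
  the component of \<open>f\<close> in \<open>W\<^sub>j\<close>.
\<close>

lemma wavelet_space_inner:
  assumes g: "g \<in> wavelet_space V j"
  shows "l2_inner haar f g = l2_inner haar (\<lambda>x. p (j + 1) x - p j x) g"
proof -
  have gV: "g \<in> V (j + 1)" using g by (simp add: wavelet_space_def)
  have gL: "g \<in> L2 haar" using closed_l2_subspaceD(1)[OF mra_closed[OF V] gV] .
  have "l2_inner haar g (p j) = 0" using g mra_projection_in by (simp add: wavelet_space_def)
  then have "l2_inner haar (p j) g = 0" by (simp add: l2_inner_cnj[of haar "p j"])
  then show ?thesis using mra_projection_inner[OF gV] gL by (simp add: l2_inner_diff_left mra_projection_L2)
qed

lemma sum_increment_norms:
  "(\<Sum>j\<in>{- int n..<int n}. (l2_norm haar (\<lambda>x. p (j + 1) x - p j x))\<^sup>2)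
    = (l2_norm haar (p (int n)))\<^sup>2 - (l2_norm haar (p (- int n)))\<^sup>2"
proof -
  have t: "(\<Sum>j\<in>{- int n..<i}. (l2_norm haar (\<lambda>x. p (j + 1) x - p j x))\<^sup>2)
      = (l2_norm haar (p i))\<^sup>2 - (l2_norm haar (p (- int n)))\<^sup>2" if "i \<ge> - int n" for i
    using that
  proof (induct i rule: int_ge_induct)
    case (step i)
    have "{- int n..<i + 1} = insert i {- int n..<i}" using step.hyps(1) by auto
    then show ?case using step.hyps(2) mra_projection_increment_norm[of i "i + 1"] by simp
  qed simp
  show ?thesis by (rule t) simp
qed

text \<open>
  A function of some \<open>V J\<close> that is close to \<open>f\<close> belongs to all later spaces, whose projections are at
  least as close.
\<close>

lemma mra_projection_LIMSEQ: "(\<lambda>n. (l2_norm haar (p (int n)))\<^sup>2) \<longlonglongrightarrow> (l2_norm haar f)\<^sup>2"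
proof -
  have "(\<lambda>n. l2_norm haar (\<lambda>x. f x - p (int n) x)) \<longlonglongrightarrow> 0"
  proof (rule LIMSEQ_I)
    fix e :: real assume "e > 0"
    have "f \<in> l2_closure haar (\<Union>j. V j)" using V f by (simp add: mra_def)
    then obtain J g where g: "g \<in> V J" "l2_norm haar (\<lambda>x. f x - g x) < e"
      using \<open>e > 0\<close> unfolding l2_closure_def by blast
    have "l2_norm haar (\<lambda>x. f x - p (int n) x) < e" if "n \<ge> nat J" for n
    proof -
      have "g \<in> V (int n)" using subsetD[OF mra_mono[OF V, of J "int n"] g(1)] that by simp
      from mra_projection_pythagoras[OF this]
      have "(l2_norm haar (\<lambda>x. f x - p (int n) x))\<^sup>2 \<le> (l2_norm haar (\<lambda>x. f x - g x))\<^sup>2" by simp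
      then have "l2_norm haar (\<lambda>x. f x - p (int n) x) \<le> l2_norm haar (\<lambda>x. f x - g x)"
        by (rule power2_le_imp_le) simp
      then show ?thesis using g(2) by simp
    qed
    then show "\<exists>n0. \<forall>n\<ge>n0. norm (l2_norm haar (\<lambda>x. f x - p (int n) x) - 0) < e" by auto
  qed
  then have "(\<lambda>n. (l2_norm haar f)\<^sup>2 - (l2_norm haar (\<lambda>x. f x - p (int n) x))\<^sup>2) \<longlonglongrightarrow> (l2_norm haar f)\<^sup>2 - 0\<^sup>2"
    by (intro tendsto_intros)
  moreover have "(l2_norm haar f)\<^sup>2 - (l2_norm haar (\<lambda>x. f x - p (int n) x))\<^sup>2 = (l2_norm haar (p (int n)))\<^sup>2" for n
    using mra_projection_norm[of "int n"] by simp
  ultimately show ?thesis by simp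
qed

text \<open>
  As \<open>j\<close> decreases to \<open>-\<infinity>\<close> the norms of the \<open>p\<^sub>j\<close> decrease, hence converge, and Pythagoras turns this into the
  Cauchy property of the \<open>p\<^sub>j\<close> themselves.  Their limit lies in every \<open>V\<^sub>j\<close>, so it vanishes almost everywhere.
\<close>

lemma mra_projection_LIMSEQ_0: "(\<lambda>n. (l2_norm haar (p (- int n)))\<^sup>2) \<longlonglongrightarrow> 0"
proof -
  define q where "q n = p (- int n)" for n
  have q: "q n \<in> L2 haar" for n unfolding q_def by (rule mra_projection_L2)
  define s where "s n = (l2_norm haar (q n))\<^sup>2" for n
  have diff: "(l2_norm haar (\<lambda>x. q n x - q m x))\<^sup>2 = s n - s m" if "n \<le> m" for n m
    unfolding q_def s_def by (rule mra_projection_increment_norm) (use that in simp)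
  have "decseq s"
    unfolding decseq_def using diff zero_le_power2 by (metis diff_ge_0_iff_ge)
  then obtain L where "s \<longlonglongrightarrow> L" using decseq_convergent[of s 0] by (auto simp: s_def)
  then have C: "Cauchy s" by (rule LIMSEQ_imp_Cauchy)
  have "\<exists>N. \<forall>m\<ge>N. \<forall>n\<ge>N. l2_norm haar (\<lambda>x. q m x - q n x) < e" if e: "e > 0" for e
  proof -
    obtain N where N: "\<And>m n. m \<ge> N \<Longrightarrow> n \<ge> N \<Longrightarrow> dist (s m) (s n) < e\<^sup>2"
      using metric_CauchyD[OF C, of "e\<^sup>2"] e by auto
    have "l2_norm haar (\<lambda>x. q m x - q n x) < e" if mn: "m \<ge> N" "n \<ge> N" for m n
    proof -
      have "(l2_norm haar (\<lambda>x. q m x - q n x))\<^sup>2 = \<bar>s m - s n\<bar>"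
      proof (cases "m \<le> n")
        case True
        then show ?thesis using diff[OF True] zero_le_power2[of "l2_norm haar (\<lambda>x. q m x - q n x)"] by simp
      next
        case False
        then have "n \<le> m" by simp
        from diff[OF this] show ?thesis
          using l2_norm_diff_commute[of haar "q m" "q n"]
            zero_le_power2[of "l2_norm haar (\<lambda>x. q n x - q m x)"] by simp
      qed
      also have "\<dots> < e\<^sup>2" using N[OF mn] by (simp add: dist_real_def)
      finally show ?thesis using e by (intro power2_less_imp_less[of _ e]) auto
    qed
    then show ?thesis by blast
  qed
  from L2_complete[OF q this] obtain h where
    h: "h \<in> L2 haar" "(\<lambda>n. l2_norm haar (\<lambda>x. q n x - h x)) \<longlonglongrightarrow> 0" by blast
  have "h \<in> V j" for j
  proof (rule closed_l2_subspace_limit[OF mra_closed[OF V] _ h])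
    fix n assume "n \<ge> nat (- j)"
    then show "q n \<in> V j" 
      unfolding q_def using subsetD[OF mra_mono[OF V, of "- int n" j] mra_projection_in] by simp
  qed
  then have "h \<in> (\<Inter>j. V j)" by blast
  then have "AE x in haar. h x = 0" using V unfolding mra_def by blast
  then have "l2_norm haar h = 0" using l2_norm_eq_0_iff[OF h(1)] by simp
  then have "l2_norm haar (q n) \<le> l2_norm haar (\<lambda>x. q n x - h x)" for n
    using l2_norm_triangle[OF L2_diff[OF q h(1)] h(1), of n] by simp
  then have "(\<lambda>n. l2_norm haar (q n)) \<longlonglongrightarrow> 0"
    by (intro Lim_null_comparison[OF _ h(2)]) simp
  from tendsto_power[OF this, of 2] show ?thesis by (simp add: q_def)
qed

end

section \<open>Compactly supported wavelets generate frames\<close>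

text \<open>
  These finite sets exhaust the index set of the wavelet system; shifts and scales have separate bounds
  because the lower frame bound is obtained by letting first \<open>m\<close> and then \<open>n\<close> tend to infinity.
\<close>

definition scale_box :: "nat \<Rightarrow> nat \<Rightarrow> (q2 \<times> int) set" where
  "scale_box m n = dyadic_shift m ` {..<2 ^ m} \<times> {- int n..<int n}"

lemma finite_subset_scale_box:
  assumes "finite F" "F \<subseteq> shifts2 \<times> UNIV" shows "\<exists>k. F \<subseteq> scale_box (M + k) k"
  using assms
proof (induct F)
  case (insert x F)
  then obtain k where k: "F \<subseteq> scale_box (M + k) k" by auto
  obtain a j where x: "x = (a, j)" by fastforce
  then obtain m where m: "a \<in> dyadic_shift m ` {..<2 ^ m}"
    using insert.prems unfolding shifts2_eq by blast
  define n where "n = max k (max m (nat (\<bar>j\<bar> + 1)))"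
  have "scale_box (M + k) k \<subseteq> scale_box (M + n) n"
    unfolding scale_box_def by (intro Sigma_mono dyadic_shift_image_mono) (auto simp: n_def)
  moreover have "a \<in> dyadic_shift (M + n) ` {..<2 ^ (M + n)}"
    by (rule subsetD[OF dyadic_shift_image_mono m]) (simp add: n_def)
  then have "x \<in> scale_box (M + n) n"
    unfolding x scale_box_def by (auto simp: n_def)
  ultimately show ?case using k by blast
qed simp

theorem theorem5p2:
  fixes V :: "int \<Rightarrow> (q2 \<Rightarrow> complex) set" and \<psi> :: "q2 \<Rightarrow> complex"
  assumes "mra V"
    and "wavelet_function V \<psi>"
    and "compactly_supported \<psi>"
  shows "l2_frame haar (shifts2 \<times> (UNIV :: int set)) (wavelet_system \<psi>)"
proof -
  note V = assms(1)
  have psi: "\<psi> \<in> L2 haar" and W0: "wavelet_space V 0 = shift_space \<psi>"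
    using assms(2) by (auto simp: wavelet_function_def)
  let ?I = "shifts2 \<times> (UNIV :: int set)"
  have WL: "wavelet_system \<psi> i \<in> L2 haar" for i
    by (cases i) (simp add: wavelet_system_eq_dilation2 L2_dilation2 L2_translate psi)
  obtain M where supp: "AE x in haar. x \<notin> ball2 0 (- int M) \<longrightarrow> \<psi> x = 0"
    using compactly_supported_ball2[OF assms(3)] by blast
  let ?t = "\<lambda>N w. (l2_norm haar (\<lambda>x. w x * indicator (ball2 0 (- int (M + N))) x))\<^sup>2"
  let ?s = "\<lambda>N w. \<Sum>a\<in>dyadic_shift (M + N) ` {..<2 ^ (M + N)}. (cmod (l2_inner haar w (\<lambda>x. \<psi> (x - a))))\<^sup>2"
  obtain A B where A: "A > 0" and B: "B > 0"
    and lower: "\<And>w N. w \<in> shift_space \<psi> \<Longrightarrow> A * ?t N w \<le> ?s N w"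
    and upper: "\<And>w N. w \<in> shift_space \<psi> \<Longrightarrow> ?s N w \<le> B * (l2_norm haar w)\<^sup>2"
    using shift_space_frame_inequality[OF psi supp] by blast
  have frame: "(\<lambda>i. (cmod (l2_inner haar f (wavelet_system \<psi> i)))\<^sup>2) summable_on ?I \<and>
      A * (l2_norm haar f)\<^sup>2 \<le> (\<Sum>\<^sub>\<infinity>i\<in>?I. (cmod (l2_inner haar f (wavelet_system \<psi> i)))\<^sup>2) \<and>
      (\<Sum>\<^sub>\<infinity>i\<in>?I. (cmod (l2_inner haar f (wavelet_system \<psi> i)))\<^sup>2) \<le> B * (l2_norm haar f)\<^sup>2"
    if f: "f \<in> L2 haar" for f
  proof -
    obtain p where p: "mra_projections V f p" using mra_projections_exist[OF V f] by blast
    define w where "w j x = p (j + 1) x - p j x" for j x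
    define u where "u j = dilation2 (- j) (w j)" for j
    define g where "g i = (cmod (l2_inner haar f (wavelet_system \<psi> i)))\<^sup>2" for i
    have w: "w j \<in> wavelet_space V j" for j
      unfolding w_def by (rule mra_projection_increment_wavelet[OF V f p])
    have wL: "w j \<in> L2 haar" for j
      unfolding w_def by (intro L2_diff mra_projection_L2[OF V f p])
    have u: "u j \<in> shift_space \<psi>" for j
      unfolding u_def W0[symmetric] using wavelet_space_dilation2[OF V w[of j], of "- j"] by simp
    have uL: "u j \<in> L2 haar" for j unfolding u_def by (rule L2_dilation2[OF wL])
    have norm_u: "l2_norm haar (u j) = l2_norm haar (w j)" for j
      unfolding u_def by (rule l2_norm_dilation2[OF wL])
    have g: "g (a, j) = (cmod (l2_inner haar (u j) (\<lambda>x. \<psi> (x - a))))\<^sup>2" if "a \<in> shifts2" for a j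
    proof -
      have "l2_inner haar f (wavelet_system \<psi> (a, j)) = l2_inner haar (w j) (wavelet_system \<psi> (a, j))"
        unfolding w_def
        by (rule wavelet_space_inner[OF V f p wavelet_system_in_wavelet_space[OF V assms(2) that]])
      also have "w j = dilation2 j (u j)" by (simp add: u_def dilation2_dilation2 dilation2_0)
      also have "l2_inner haar (dilation2 j (u j)) (wavelet_system \<psi> (a, j)) = l2_inner haar (u j) (\<lambda>x. \<psi> (x - a))"
        unfolding wavelet_system_eq_dilation2 by (rule l2_inner_dilation2[OF uL L2_translate[OF psi]])
      finally show ?thesis by (simp add: g_def)
    qed
    have g0: "g i \<ge> 0" for i by (simp add: g_def)
    have box: "sum g (scale_box (M + N) n) = (\<Sum>j\<in>{- int n..<int n}. ?s N (u j))" for N n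
    proof -
      have "sum g (scale_box (M + N) n)
          = (\<Sum>j\<in>{- int n..<int n}. \<Sum>a\<in>dyadic_shift (M + N) ` {..<2 ^ (M + N)}. g (a, j))"
        unfolding scale_box_def by (subst sum.swap) (simp add: sum.cartesian_product)
      also have "\<dots> = (\<Sum>j\<in>{- int n..<int n}. ?s N (u j))"
        by (intro sum.cong refl g) (auto simp: shifts2_eq)
      finally show ?thesis .
    qed
    have tele: "(\<Sum>j\<in>{- int n..<int n}. (l2_norm haar (u j))\<^sup>2)
        = (l2_norm haar (p (int n)))\<^sup>2 - (l2_norm haar (p (- int n)))\<^sup>2" for n
      unfolding norm_u w_def by (rule sum_increment_norms[OF V f p])
    have fin: "sum g F \<le> B * (l2_norm haar f)\<^sup>2" if F: "finite F" "F \<subseteq> ?I" for F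
    proof -
      obtain k where k: "F \<subseteq> scale_box (M + k) k" using finite_subset_scale_box[OF F] by blast
      have "sum g F \<le> sum g (scale_box (M + k) k)"
        by (rule sum_mono2[OF _ k]) (auto simp: scale_box_def g0)
      also have "\<dots> \<le> B * (\<Sum>j\<in>{- int k..<int k}. (l2_norm haar (u j))\<^sup>2)"
        unfolding box sum_distrib_left by (intro sum_mono upper u)
      also have "\<dots> \<le> B * (l2_norm haar f)\<^sup>2"
        unfolding tele using mra_projection_norm[OF V f p, of "int k"] B
          zero_le_power2[of "l2_norm haar (\<lambda>x. f x - p (int k) x)"]
          zero_le_power2[of "l2_norm haar (p (- int k))"]
        by (intro mult_left_mono) linarith+
      finally show ?thesis .
    qed
    have sm: "g summable_on ?I"
      by (rule nonneg_bdd_above_summable_on) (auto simp: g0 intro!: bdd_aboveI[of _ "B * (l2_norm haar f)\<^sup>2"] fin)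
    have up: "infsum g ?I \<le> B * (l2_norm haar f)\<^sup>2"
      by (rule infsum_le_finite_sums[OF sm]) (rule fin)
    have low_N: "(\<Sum>j\<in>{- int n..<int n}. A * ?t N (u j)) \<le> infsum g ?I" for N n
    proof -
      have "(\<Sum>j\<in>{- int n..<int n}. A * ?t N (u j)) \<le> sum g (scale_box (M + N) n)"
        unfolding box by (intro sum_mono lower u)
      also have "\<dots> \<le> infsum g ?I"
        by (rule finite_sum_le_infsum[OF sm]) (auto simp: scale_box_def shifts2_eq g0)
      finally show ?thesis .
    qed
    have low_n: "A * ((l2_norm haar (p (int n)))\<^sup>2 - (l2_norm haar (p (- int n)))\<^sup>2) \<le> infsum g ?I" for n
      unfolding tele[symmetric] sum_distrib_left
    proof (rule LIMSEQ_le_const2)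
      show "(\<lambda>N. \<Sum>j\<in>{- int n..<int n}. A * ?t N (u j)) \<longlonglongrightarrow> (\<Sum>j\<in>{- int n..<int n}. A * (l2_norm haar (u j))\<^sup>2)"
        by (intro tendsto_sum tendsto_mult tendsto_const l2_norm_truncation_LIMSEQ uL)
    qed (use low_N in blast)
    have "(\<lambda>n. A * ((l2_norm haar (p (int n)))\<^sup>2 - (l2_norm haar (p (- int n)))\<^sup>2)) \<longlonglongrightarrow> A * ((l2_norm haar f)\<^sup>2 - 0)"
      by (intro tendsto_mult tendsto_const tendsto_diff mra_projection_LIMSEQ[OF V f p] mra_projection_LIMSEQ_0[OF V f p])
    then have "A * ((l2_norm haar f)\<^sup>2 - 0) \<le> infsum g ?I"
      by (rule LIMSEQ_le_const2) (use low_n in blast)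
    then show ?thesis using sm up unfolding g_def by simp
  qed
  have "countable shifts2"
    unfolding shifts2_eq by (intro countable_UN) (auto intro: countable_finite)
  then have "countable ?I" by (intro countable_SIGMA) auto
  then show ?thesis unfolding l2_frame_def using WL A B frame by blast
qed

end
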